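(* Let $\Omega\subset\mathbb{R}^n$ be open, bounded and connected, let $v$ be a weight on $\Omega$ with $v\in L^1(\Omega)$, and let $Q$ be a matrix function on $\Omega$ such that, for some $k>0$, $|Q(x)|_{\mathrm{op}}\le k\,v(x)$ for a.e. $x\in\Omega$. Suppose that: (1) for some $\sigma>1$ there is $C>0$ such that for all $\varphi\in\mathrm{Lip}_0(\Omega)$, $\big(\int_\Omega|\varphi|^{2\sigma}v\,dx\big)^{\frac1{2\sigma}}\le C\big(\int_\Omega|\sqrt Q\nabla\varphi|^2dx\big)^{\frac12}$; (2) there is $c\ge1$ such that for every $\epsilon>0$ there exists $\delta>0$ such that if $0<r<\delta$ and $B(x_0,cr)\subset\Omega$, then for all $\varphi\in\mathrm{Lip}_0(\Omega)$, $$\int_{B(x_0,r)}|\varphi-\varphi_{B,v}|^2\,v\,dx\le\epsilon\int_{B(x_0,cr)}|\sqrt Q\nabla\varphi|^2\,dx,$$ where $B=B(x_0,r)$ and $\varphi_{B,v}=v(B)^{-1}\int_B\varphi\,v\,dx$, $v(B)=\int_Bv\,dx$; (3) $f,h\in L^2(v,\Omega)$; (4) $d\in L^2(v,\Omega)$ and, for some $q>2\sigma'$, $d\in L^{q/2}(v,\Omega)$; (5) $\mathbf b,\mathbf c,\mathbf e:\Omega\to\mathbb{R}^n$ are measurable and degenerate subunit, i.e. for each $\mathbf w\in\{\mathbf b,\mathbf c,\mathbf e\}$, a.e. $x\in\Omega$ and all $\xi\in\mathbb{R}^n$, $\langle\mathbf w(x),\xi\rangle^2\le v(x)^{-1}\langle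 Q(x)\xi,\xi\rangle$; (6) $\int_\Omega(d\varphi-\mathbf c\cdot\nabla\varphi)\,v\,dx\le0$ for every nonnegative $\varphi\in Q\mathrm{Lip}_0(v,\Omega)$. Then the Dirichlet problem $$v^{-1}\operatorname{div}(Q\nabla u)+\mathbf b\cdot\nabla u+v^{-1}\operatorname{div}(v\mathbf cu)+du=f+v^{-1}\operatorname{div}(v\mathbf eh)\ \text{in }\Omega,\qquad u=0\ \text{on }\partial\Omega,$$ has a unique degenerate weak solution $u\in QH^{1,2}_0(v,\Omega)$.
   Context: $\sigma'=\sigma/(\sigma-1)$; $B(x,r)$ denotes a Euclidean ball; $|\cdot|_{\mathrm{op}}$ is the operator norm. A weight is a nonnegative measurable function $v$ with $0<v(x)<\infty$ a.e. A matrix function $Q$ on $\Omega$ is a map whose values are real, symmetric, positive semidefinite $n\times n$ matrices, with measurable entries finite a.e., and with $Q(x)$ invertible for a.e. $x$; $\sqrt Q$ is the positive semidefinite square root. $L^p(v,\Omega)$ has norm $(\int_\Omega|f|^pv\,dx)^{1/p}$. $QL^2(\Omega)$ is the space of measurable $\mathbf f:\Omega\to\mathbb{R}^n$ with $\|\mathbf f\|_{QL^2(\Omega)}=(\int_\Omega|\sqrt Q\mathbf f|^2dx)^{1/2}<\infty$. $\mathrm{Lip}_0(\Omega)$ is the set of Lipschitz functions with compact support in $\Omega$. $Q\mathrm{Lip}_0(v,\Omega)$ is the set of $\varphi\in\mathrm{Lip}_0(\Omega)$ with $\|\varphi\|_{L^2(v,\Omega)}+\|\nabla\varphi\|_{QL^2(\Omega)}<\infty$.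 $QH^{1,2}_0(v,\Omega)$ is the closure of $\{(\varphi,\nabla\varphi):\varphi\in Q\mathrm{Lip}_0(v,\Omega)\}$ in $L^2(v,\Omega)\oplus QL^2(\Omega)$. Its elements are pairs $(u,\mathbf g)$; one writes $\nabla u:=\mathbf g$ by convention, although $\mathbf g$ need not be a weak derivative of $u$ nor be determined by $u$, and one often writes just $u$ for the pair. A degenerate weak solution of the problem is a pair $(u,\nabla u)\in QH^{1,2}_0(v,\Omega)$ such that for all $\varphi\in Q\mathrm{Lip}_0(v,\Omega)$, $$-\int_\Omega Q\nabla u\cdot\nabla\varphi\,dx+\int_\Omega(\mathbf b\cdot\nabla u)\varphi\,v\,dx-\int_\Omega u\,\mathbf c\cdot\nabla\varphi\,v\,dx+\int_\Omega du\varphi\,v\,dx=\int_\Omega f\varphi\,v\,dx-\int_\Omega h\,\mathbf e\cdot\nabla\varphi\,v\,dx .$$ *)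

theory Defs
  imports "HOL-Analysis.Analysis"
begin

text \<open>
  Points of the domain are vectors in \<open>real ^ 'n\<close>. Functions on \<open>\<Omega>\<close> are represented by
  total functions whose values outside \<open>\<Omega>\<close> are irrelevant; measurability, null sets and integrals
  are those of Lebesgue measure restricted to \<open>\<Omega>\<close>. Elements of \<open>L\<^sup>p\<close>-type spaces are represented
  by functions, not by classes of functions modulo equality almost everywhere.
\<close>

definition weight :: "(real ^ 'n) set \<Rightarrow> (real ^ 'n \<Rightarrow> real) \<Rightarrow> bool" where
  "weight \<Omega> v \<longleftrightarrow>
     v \<in> borel_measurable (lebesgue_on \<Omega>) \<and>
     (\<forall>x\<in>\<Omega>. 0 \<le> v x) \<and>
     (AE x in lebesgue_on \<Omega>. 0 < v x)"

definition psd :: "real ^ 'n ^ 'n \<Rightarrow> bool" where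
  "psd A \<longleftrightarrow> transpose A = A \<and> (\<forall>\<xi>. 0 \<le> (A *v \<xi>) \<bullet> \<xi>)"

definition matrix_function :: "(real ^ 'n) set \<Rightarrow> (real ^ 'n \<Rightarrow> real ^ 'n ^ 'n) \<Rightarrow> bool" where
  "matrix_function \<Omega> Q \<longleftrightarrow>
     (\<forall>x\<in>\<Omega>. psd (Q x)) \<and>
     (\<forall>i j. (\<lambda>x. Q x $ i $ j) \<in> borel_measurable (lebesgue_on \<Omega>)) \<and>
     (AE x in lebesgue_on \<Omega>. invertible (Q x))"

definition op_norm :: "real ^ 'n ^ 'n \<Rightarrow> real" where
  "op_norm A = onorm (\<lambda>\<xi>. A *v \<xi>)"

text \<open>A positive semidefinite matrix has exactly one positive semidefinite square root.\<close>

definition psd_sqrt :: "real ^ 'n ^ 'n \<Rightarrow> real ^ 'n ^ 'n" where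
  "psd_sqrt A = (THE S. psd S \<and> S ** S = A)"

definition degenerate_subunit ::
  "(real ^ 'n) set \<Rightarrow> (real ^ 'n \<Rightarrow> real) \<Rightarrow> (real ^ 'n \<Rightarrow> real ^ 'n ^ 'n) \<Rightarrow>
    (real ^ 'n \<Rightarrow> real ^ 'n) \<Rightarrow> bool" where
  "degenerate_subunit \<Omega> v Q w \<longleftrightarrow>
     (AE x in lebesgue_on \<Omega>. \<forall>\<xi>. (w x \<bullet> \<xi>)\<^sup>2 \<le> inverse (v x) * ((Q x *v \<xi>) \<bullet> \<xi>))"

definition wLp :: "real \<Rightarrow> (real ^ 'n \<Rightarrow> real) \<Rightarrow> (real ^ 'n) set \<Rightarrow> (real ^ 'n \<Rightarrow> real) set" where
  "wLp p v \<Omega> = {f \<in> borel_measurable (lebesgue_on \<Omega>).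
     integrable (lebesgue_on \<Omega>) (\<lambda>x. \<bar>f x\<bar> powr p * v x)}"

definition wLp_norm ::
  "real \<Rightarrow> (real ^ 'n \<Rightarrow> real) \<Rightarrow> (real ^ 'n) set \<Rightarrow> (real ^ 'n \<Rightarrow> real) \<Rightarrow> real" where
  "wLp_norm p v \<Omega> f = (LINT x|lebesgue_on \<Omega>. \<bar>f x\<bar> powr p * v x) powr (1 / p)"

definition QL2 ::
  "(real ^ 'n \<Rightarrow> real ^ 'n ^ 'n) \<Rightarrow> (real ^ 'n) set \<Rightarrow> (real ^ 'n \<Rightarrow> real ^ 'n) set" where
  "QL2 Q \<Omega> = {g \<in> borel_measurable (lebesgue_on \<Omega>).
     integrable (lebesgue_on \<Omega>) (\<lambda>x. (norm (psd_sqrt (Q x) *v g x))\<^sup>2)}"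

definition QL2_norm ::
  "(real ^ 'n \<Rightarrow> real ^ 'n ^ 'n) \<Rightarrow> (real ^ 'n) set \<Rightarrow> (real ^ 'n \<Rightarrow> real ^ 'n) \<Rightarrow> real" where
  "QL2_norm Q \<Omega> g = sqrt (LINT x|lebesgue_on \<Omega>. (norm (psd_sqrt (Q x) *v g x))\<^sup>2)"

text \<open>
  The gradient is the vector of classical partial derivatives. For a Lipschitz function these exist
  almost everywhere; on the exceptional null set \<open>deriv\<close> takes an unspecified value, which
  no integral below can see.
\<close>

definition grad :: "(real ^ 'n \<Rightarrow> real) \<Rightarrow> real ^ 'n \<Rightarrow> real ^ 'n" where
  "grad \<phi> x = (\<chi> i. deriv (\<lambda>t. \<phi> (x + t *\<^sub>R axis i 1)) 0)"

text \<open>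
  A Lipschitz function on \<open>\<Omega>\<close> with compact support in \<open>\<Omega>\<close> is identified with its extension by
  zero, which is Lipschitz on the whole space.
\<close>

definition Lip0 :: "(real ^ 'n) set \<Rightarrow> (real ^ 'n \<Rightarrow> real) set" where
  "Lip0 \<Omega> = {\<phi>. (\<exists>L. L-lipschitz_on UNIV \<phi>) \<and>
     compact (closure {x. \<phi> x \<noteq> 0}) \<and> closure {x. \<phi> x \<noteq> 0} \<subseteq> \<Omega>}"

definition QLip0 ::
  "(real ^ 'n \<Rightarrow> real ^ 'n ^ 'n) \<Rightarrow> (real ^ 'n \<Rightarrow> real) \<Rightarrow> (real ^ 'n) set \<Rightarrow>
    (real ^ 'n \<Rightarrow> real) set" where
  "QLip0 Q v \<Omega> = {\<phi> \<in> Lip0 \<Omega>. \<phi> \<in> wLp 2 v \<Omega> \<and> grad \<phi> \<in> QL2 Q \<Omega>}"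

text \<open>
  The closure of \<open>{(\<phi>, grad \<phi>) | \<phi> \<in> QLip0 Q v \<Omega>}\<close> in the direct sum of \<open>wLp 2 v \<Omega>\<close> and
  \<open>QL2 Q \<Omega>\<close>, normed by the sum of the two norms.
\<close>

definition QH0 ::
  "(real ^ 'n \<Rightarrow> real ^ 'n ^ 'n) \<Rightarrow> (real ^ 'n \<Rightarrow> real) \<Rightarrow> (real ^ 'n) set \<Rightarrow>
    ((real ^ 'n \<Rightarrow> real) \<times> (real ^ 'n \<Rightarrow> real ^ 'n)) set" where
  "QH0 Q v \<Omega> = {(u, g). u \<in> wLp 2 v \<Omega> \<and> g \<in> QL2 Q \<Omega> \<and>
     (\<forall>\<epsilon>>0. \<exists>\<phi>\<in>QLip0 Q v \<Omega>.
        wLp_norm 2 v \<Omega> (\<lambda>x. \<phi> x - u x) + QL2_norm Q \<Omega> (\<lambda>x. grad \<phi> x - g x) < \<epsilon>)}"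

definition sobolev_inequality ::
  "(real ^ 'n \<Rightarrow> real ^ 'n ^ 'n) \<Rightarrow> (real ^ 'n \<Rightarrow> real) \<Rightarrow> (real ^ 'n) set \<Rightarrow> real \<Rightarrow> bool" where
  "sobolev_inequality Q v \<Omega> \<sigma> \<longleftrightarrow>
     (\<exists>C>0. \<forall>\<phi>\<in>Lip0 \<Omega>. wLp_norm (2 * \<sigma>) v \<Omega> \<phi> \<le> C * QL2_norm Q \<Omega> (grad \<phi>))"

definition weighted_mean ::
  "(real ^ 'n \<Rightarrow> real) \<Rightarrow> (real ^ 'n) set \<Rightarrow> (real ^ 'n \<Rightarrow> real) \<Rightarrow> real" where
  "weighted_mean v B \<phi> = (LINT x|lebesgue_on B. \<phi> x * v x) / (LINT x|lebesgue_on B. v x)"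

definition local_poincare ::
  "(real ^ 'n \<Rightarrow> real ^ 'n ^ 'n) \<Rightarrow> (real ^ 'n \<Rightarrow> real) \<Rightarrow> (real ^ 'n) set \<Rightarrow> bool" where
  "local_poincare Q v \<Omega> \<longleftrightarrow>
     (\<exists>c\<ge>1. \<forall>\<epsilon>>0. \<exists>\<delta>>0. \<forall>x\<^sub>0 r. 0 < r \<and> r < \<delta> \<and> ball x\<^sub>0 (c * r) \<subseteq> \<Omega> \<longrightarrow>
        (\<forall>\<phi>\<in>Lip0 \<Omega>.
           (LINT x|lebesgue_on (ball x\<^sub>0 r). \<bar>\<phi> x - weighted_mean v (ball x\<^sub>0 r) \<phi>\<bar>\<^sup>2 * v x)
           \<le> \<epsilon> * (LINT x|lebesgue_on (ball x\<^sub>0 (c * r)). (norm (psd_sqrt (Q x) *v grad \<phi> x))\<^sup>2)))"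

definition weak_solution ::
  "(real ^ 'n) set \<Rightarrow> (real ^ 'n \<Rightarrow> real) \<Rightarrow> (real ^ 'n \<Rightarrow> real ^ 'n ^ 'n) \<Rightarrow>
    (real ^ 'n \<Rightarrow> real ^ 'n) \<Rightarrow> (real ^ 'n \<Rightarrow> real ^ 'n) \<Rightarrow> (real ^ 'n \<Rightarrow> real) \<Rightarrow>
    (real ^ 'n \<Rightarrow> real) \<Rightarrow> (real ^ 'n \<Rightarrow> real ^ 'n) \<Rightarrow> (real ^ 'n \<Rightarrow> real) \<Rightarrow>
    (real ^ 'n \<Rightarrow> real) \<Rightarrow> (real ^ 'n \<Rightarrow> real ^ 'n) \<Rightarrow> bool" where
  "weak_solution \<Omega> v Q b c d f e h u g \<longleftrightarrow>
     (u, g) \<in> QH0 Q v \<Omega> \<and>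
     (\<forall>\<phi>\<in>QLip0 Q v \<Omega>.
        - (LINT x|lebesgue_on \<Omega>. (Q x *v g x) \<bullet> grad \<phi> x)
        + (LINT x|lebesgue_on \<Omega>. (b x \<bullet> g x) * \<phi> x * v x)
        - (LINT x|lebesgue_on \<Omega>. u x * (c x \<bullet> grad \<phi> x) * v x)
        + (LINT x|lebesgue_on \<Omega>. d x * u x * \<phi> x * v x)
        = (LINT x|lebesgue_on \<Omega>. f x * \<phi> x * v x)
        - (LINT x|lebesgue_on \<Omega>. h x * (e x \<bullet> grad \<phi> x) * v x))"

end

theory Submission
  imports Defs
begin

text \<open>
  For test functions \<open>\<phi>\<close> put \<open>N \<phi> = (\<integral> |sqrt Q \<nabla>\<phi>|\<^sup>2)\<^sup>1\<^sup>/\<^sup>2\<close>. The weak equation asks for \<open>B(u, \<phi>) = F \<phi>\<close>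
  for all \<open>\<phi>\<close>, where \<open>B(u, \<phi>) = \<integral> Q \<nabla>u \<sqdot> \<nabla>\<phi> + R(u, \<phi>)\<close> and \<open>R\<close> collects the terms with \<open>b\<close>, \<open>c\<close>
  and \<open>d\<close>. By the Sobolev inequality and the subunit conditions \<open>R\<close> and \<open>F\<close> are bounded with respect
  to \<open>N\<close>. All functional analysis takes place in the incomplete space of test functions; elements
  of the completion only enter at the end, as limits of Cauchy sequences.

  The heart of the matter is a lower bound for the adjoint forms, uniform in \<open>\<tau> \<in> [0, 1]\<close>
  (\<open>adjoint_bounded_below\<close>): if \<open>|\<integral> Q \<nabla>\<phi> \<sqdot> \<nabla>u + \<tau> R(\<phi>, u)| \<le> \<delta> N \<phi>\<close> for all \<open>\<phi>\<close>, then \<open>\<kappa> N u \<le> \<delta>\<close>.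
  Insert \<open>\<phi> = H(u)\<close> with \<open>H\<close> increasing and \<open>H(0) = 0\<close>. The sign condition on \<open>d - div c\<close>, used with the
  nonnegative function \<open>u H(u)\<close>, removes the zeroth order term and leaves only first order terms with
  the derivative on \<open>\<phi>\<close>; these are absorbed, and \<open>energy_inequality\<close> results:
  \<open>1/2 \<integral> H'(u) |sqrt Q \<nabla>u|\<^sup>2 \<le> \<delta> N(H(u)) + 2 \<integral> H'(u) u\<^sup>2 v\<close>.
  Two choices of \<open>H\<close> are combined. For \<open>H(s) = s\<close> this is Garding's inequality: if \<open>N u = 1\<close> and \<open>\<delta>\<close> is
  small, then \<open>\<integral> u\<^sup>2 v\<close> cannot be small. For \<open>H(s) = arctan(s/\<epsilon>)/\<epsilon>\<close> the right-hand side stays bounded,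
  since \<open>H'(s) s\<^sup>2 \<le> 1\<close>, and the left-hand side controls \<open>\<nabla> ln(1 + u\<^sup>2/\<epsilon>\<^sup>2)\<close>. Hence
  \<open>ln(1 + u\<^sup>2/\<epsilon>\<^sup>2)\<close> is bounded in \<open>L\<^sup>2(v)\<close> uniformly in \<open>\<epsilon>\<close>, as long as \<open>\<delta> \<le> \<epsilon>\<^sup>2\<close>, which makes \<open>u\<close> small
  in \<open>v\<close>-measure; as \<open>u\<close> is bounded in \<open>L\<^sup>2\<^sup>\<sigma>(v)\<close> with \<open>\<sigma> > 1\<close>, it is small in \<open>L\<^sup>2(v)\<close> as well,
  contradicting the first choice. This replaces a compactness argument.

  The bound passes from the adjoint to \<open>B\<close> by the method of continuity
  (\<open>solvable_of_adjoint_bounded_below\<close>): at \<open>\<tau> = 0\<close> the equation is approximately solvable by the Riesz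
  argument, solvability survives small changes of \<open>\<tau>\<close> because of the uniform lower bound, and
  solvability of the adjoint equation turns the bound for the adjoint into the same bound for \<open>B\<close>.
  A second continuation then solves \<open>B(u, \<cdot>) = F\<close> approximately.

  Approximate solutions form a Cauchy sequence by the lower bound. The spaces \<open>L\<^sup>2(v)\<close> and \<open>QL\<^sup>2\<close> are
  complete (\<open>form_field.complete\<close>; for \<open>QL\<^sup>2\<close> the invertibility of \<open>Q\<close> yields pointwise limits of the
  gradients), and the limit pair is a weak solution. Test functions approximating any
  other weak solution are approximate solutions too, so the lower bound forces them to have the same
  limit, both in the function and in the gradient component.

  Two classical facts about the objects of the problem are proved first: a positive semidefinite
  matrix has exactly one positive semidefinite square root (via an orthonormal eigenbasis), and a
  Lipschitz function has partial derivatives almost everywhere, so that the classical gradient obeys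
  the sum and chain rules outside a null set. The latter comes from the Radon-Nikodym theorem on lines
  and Fubini's theorem.
\<close>

section \<open>Square roots of positive semidefinite matrices\<close>

text \<open>
  The quadratic form \<open>x \<bullet> f x\<close> attains its maximum on the unit sphere of \<open>S\<close>, and a maximum point is an
  eigenvector: the first variation in every direction of \<open>S\<close> orthogonal to it vanishes.
\<close>

lemma symmetric_map_eigenvector_exists:
  fixes f :: "'a::euclidean_space \<Rightarrow> 'a"
  assumes f: "linear f" and sym: "\<And>x y. f x \<bullet> y = x \<bullet> f y"
    and S: "subspace S" and inv: "\<And>x. x \<in> S \<Longrightarrow> f x \<in> S" and ne: "S \<noteq> {0}"
  obtains x lam where "x \<in> S" "norm x = 1" "f x = lam *\<^sub>R x"
proof -
  let ?K = "S \<inter> sphere 0 1"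
  have "compact ?K"
    using closed_subspace[OF S] compact_sphere by (simp add: closed_Int_compact)
  obtain z where z: "z \<in> S" "z \<noteq> 0" using ne S subspace_0 by fastforce
  have "(1 / norm z) *\<^sub>R z \<in> ?K" using z S by (simp add: subspace_scale)
  then have "?K \<noteq> {}" by blast
  moreover have "continuous_on ?K (\<lambda>x. x \<bullet> f x)"
    using f by (intro continuous_intros linear_continuous_on) (simp add: linear_conv_bounded_linear)
  ultimately obtain x where x: "x \<in> ?K" and mx: "\<And>y. y \<in> ?K \<Longrightarrow> y \<bullet> f y \<le> x \<bullet> f x"
    using continuous_attains_sup[OF \<open>compact ?K\<close>] by blast
  define lam where "lam = x \<bullet> f x"
  have xS: "x \<in> S" and nx: "norm x = 1" using x by auto
  have xx: "x \<bullet> x = 1" using nx by (simp add: dot_square_norm)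
  have bound: "y \<bullet> f y \<le> lam * (y \<bullet> y)" if "y \<in> S" for y
  proof (cases "y = 0")
    case False
    let ?w = "(1 / norm y) *\<^sub>R y"
    have "?w \<bullet> f ?w \<le> lam" unfolding lam_def
      using that False S by (intro mx) (simp add: subspace_scale)
    then have "(y \<bullet> f y) / (norm y)^2 \<le> lam"
      by (simp add: linear_cmul[OF f] power2_eq_square)
    then show ?thesis using False by (simp add: field_simps dot_square_norm)
  qed (simp add: linear_0[OF f])
  have orth: "y \<bullet> f x = 0" if y: "y \<in> S" "x \<bullet> y = 0" for y
  proof -
    define C where "C = lam * (y \<bullet> y) - y \<bullet> f y"
    have ineq: "2 * t * (y \<bullet> f x) \<le> t\<^sup>2 * C" for t
    proof -
      have "(x + t *\<^sub>R y) \<bullet> f (x + t *\<^sub>R y) \<le> lam * ((x + t *\<^sub>R y) \<bullet> (x + t *\<^sub>R y))"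
        using y xS S by (intro bound) (simp add: subspace_add subspace_scale)
      moreover have "x \<bullet> f y = y \<bullet> f x" using sym[of x y] by (simp add: inner_commute)
      ultimately show ?thesis
        using y(2) xx unfolding C_def
        by (simp add: linear_add[OF f] linear_cmul[OF f] inner_add_left inner_add_right
            inner_commute[of y x] lam_def[symmetric] algebra_simps power2_eq_square)
    qed
    show ?thesis
    proof (rule ccontr)
      assume n: "y \<bullet> f x \<noteq> 0"
      \<comment> \<open>The value \<open>t = (y \<bullet> f x) / D\<close> makes the term linear in \<open>t\<close> dominate.\<close>
      define D where "D = \<bar>C\<bar> + 1"
      have "D > 0" "C < D" unfolding D_def by auto
      have "2 * ((y \<bullet> f x) / D) * (y \<bullet> f x) \<le> ((y \<bullet> f x) / D)\<^sup>2 * C" by (rule ineq)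
      also have "\<dots> \<le> ((y \<bullet> f x) / D)\<^sup>2 * D" using \<open>C < D\<close> by (intro mult_left_mono) auto
      also have "\<dots> = ((y \<bullet> f x) / D) * (y \<bullet> f x)" using \<open>D > 0\<close> by (simp add: power2_eq_square)
      finally have "((y \<bullet> f x) / D) * (y \<bullet> f x) \<le> 0" by simp
      moreover have "((y \<bullet> f x) / D) * (y \<bullet> f x) > 0"
        using n \<open>D > 0\<close> by (simp add: zero_less_divide_iff zero_less_mult_iff) argo
      ultimately show False by linarith
    qed
  qed
  define y where "y = f x - lam *\<^sub>R x"
  have yS: "y \<in> S" unfolding y_def using inv[OF xS] xS S by (simp add: subspace_diff subspace_scale)
  have xy: "x \<bullet> y = 0" unfolding y_def by (simp add: inner_diff_right xx lam_def)
  have "y \<bullet> y = y \<bullet> f x - lam * (x \<bullet> y)"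
    unfolding y_def by (simp add: inner_diff_left inner_commute)
  then have "y = 0" using orth[OF yS xy] xy by auto
  then show thesis using that[OF xS nx, of lam] unfolding y_def by simp
qed

text \<open>
  Induction on the dimension: the orthogonal complement, within \<open>S\<close>, of an eigenvector is invariant again.
\<close>

lemma symmetric_map_eigenbasis:
  fixes f :: "'a::euclidean_space \<Rightarrow> 'a"
  assumes f: "linear f" and sym: "\<And>x y. f x \<bullet> y = x \<bullet> f y"
    and S: "subspace S" and inv: "\<And>x. x \<in> S \<Longrightarrow> f x \<in> S"
  shows "\<exists>B \<mu>. finite B \<and> span B = S \<and> pairwise orthogonal B \<and>
            (\<forall>x\<in>B. norm x = 1 \<and> f x = \<mu> x *\<^sub>R x)"
  using S inv
proof (induction "dim S" arbitrary: S rule: less_induct)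
  case less
  show ?case
  proof (cases "S = {0}")
    case True
    then show ?thesis by (intro exI[of _ "{}"]) auto
  next
    case False
    obtain x lam where x: "x \<in> S" "norm x = 1" "f x = lam *\<^sub>R x"
      using symmetric_map_eigenvector_exists[OF f sym less.prems False] by blast
    define T where "T = {y \<in> S. x \<bullet> y = 0}"
    have xx: "x \<bullet> x = 1" using x by (simp add: dot_square_norm)
    have T: "subspace T" unfolding T_def
      using less.prems(1) by (auto simp: subspace_def inner_add_right)
    have invT: "f y \<in> T" if "y \<in> T" for y
      using that less.prems(2)[of y] sym[of x y] x(3) by (auto simp: T_def)
    have "x \<notin> T" using xx by (simp add: T_def)
    then have "T \<subset> S" using x unfolding T_def by blast
    then have "dim T < dim S"
      using T less.prems(1) by (metis dim_psubset span_eq_iff)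
    then obtain B \<mu> where B: "finite B" "span B = T" "pairwise orthogonal B"
        "\<And>z. z \<in> B \<Longrightarrow> norm z = 1 \<and> f z = \<mu> z *\<^sub>R z"
      using less.hyps[OF _ T invT] by metis
    have BT: "B \<subseteq> T" using B(2) span_superset by blast
    have xB: "x \<notin> B" using BT xx by (auto simp: T_def)
    have "span (insert x B) = S"
    proof
      show "span (insert x B) \<subseteq> S"
        using BT x less.prems(1) by (intro span_minimal) (auto simp: T_def)
      show "S \<subseteq> span (insert x B)"
      proof
        fix y assume y: "y \<in> S"
        have "y - (x \<bullet> y) *\<^sub>R x \<in> T" unfolding T_def
          using y x less.prems(1) xx by (simp add: subspace_diff subspace_scale inner_diff_right)
        then show "y \<in> span (insert x B)" by (auto simp: span_insert B(2))
      qed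
    qed
    moreover have "pairwise orthogonal (insert x B)"
      using B(3) BT by (auto simp: pairwise_insert T_def orthogonal_def inner_commute)
    moreover have "\<forall>z\<in>insert x B. norm z = 1 \<and> f z = (\<mu>(x := lam)) z *\<^sub>R z"
      using B(4) x xB by auto
    ultimately show ?thesis using B(1) by (intro exI[of _ "insert x B"] exI[of _ "\<mu>(x := lam)"]) auto
  qed
qed

lemma psd_sym: "psd A \<Longrightarrow> (A *v x) \<bullet> y = x \<bullet> (A *v y)"
  by (metis dot_lmul_matrix vector_transpose_matrix psd_def)

lemma psd_eigenbasis:
  assumes "psd A"
  shows "\<exists>B \<mu>. finite B \<and> span B = UNIV \<and> pairwise orthogonal B \<and>
            (\<forall>x\<in>B. norm x = 1 \<and> A *v x = \<mu> x *\<^sub>R x \<and> 0 \<le> \<mu> x)"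
proof -
  have "\<exists>B \<mu>. finite B \<and> span B = UNIV \<and> pairwise orthogonal B \<and>
            (\<forall>x\<in>B. norm x = 1 \<and> A *v x = \<mu> x *\<^sub>R x)"
    by (intro symmetric_map_eigenbasis psd_sym[OF assms]) auto
  then obtain B \<mu> where B: "finite B" "span B = UNIV" "pairwise orthogonal B"
    "\<forall>x\<in>B. norm x = 1 \<and> A *v x = \<mu> x *\<^sub>R x" by blast
  have "0 \<le> \<mu> x" if "x \<in> B" for x
  proof -
    have "(A *v x) \<bullet> x = \<mu> x" using B(4) that by (simp add: dot_square_norm)
    then show ?thesis using assms unfolding psd_def by metis
  qed
  with B show ?thesis by blast
qed

lemma psd_sqrt_exists:
  assumes "psd A"
  shows "\<exists>S. psd S \<and> S ** S = A"
proof -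
  obtain B \<mu> where B: "finite B" "span B = UNIV" "pairwise orthogonal B"
    and e: "\<forall>x\<in>B. norm x = 1 \<and> A *v x = \<mu> x *\<^sub>R x \<and> 0 \<le> \<mu> x"
    using psd_eigenbasis[OF assms] by blast
  define g where "g y = (\<Sum>x\<in>B. (sqrt (\<mu> x) * (x \<bullet> y)) *\<^sub>R x)" for y
  have lin: "linear g" unfolding g_def
    by (rule linearI) (auto simp: inner_add_right algebra_simps sum.distrib scaleR_sum_right)
  define S where "S = matrix g"
  have Sg: "S *v y = g y" for y unfolding S_def using lin by (simp add: matrix_works)
  have gsym: "g y \<bullet> z = y \<bullet> g z" for y z
    unfolding g_def inner_sum_left inner_sum_right
    by (intro sum.cong) (auto simp: inner_commute)
  have gB: "g x = sqrt (\<mu> x) *\<^sub>R x" if "x \<in> B" for x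
  proof -
    have "g x = (\<Sum>z\<in>B. if z = x then sqrt (\<mu> x) *\<^sub>R x else 0)"
      unfolding g_def
    proof (intro sum.cong refl)
      fix z assume "z \<in> B"
      then show "(sqrt (\<mu> z) * (z \<bullet> x)) *\<^sub>R z = (if z = x then sqrt (\<mu> x) *\<^sub>R x else 0)"
        using B(3) that bspec[OF e that] by (auto simp: pairwise_def orthogonal_def dot_square_norm)
    qed
    then show ?thesis using that B(1) by simp
  qed
  have "transpose S = S"
  proof -
    have "transpose S *v y = S *v y" for y
    proof (rule vector_eq_rdot[THEN iffD1], rule allI)
      fix z
      show "(transpose S *v y) \<bullet> z = (S *v y) \<bullet> z"
        using gsym[of y z] Sg by (simp add: dot_lmul_matrix)
    qed
    then show ?thesis by (simp add: matrix_eq)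
  qed
  moreover have "0 \<le> (S *v y) \<bullet> y" for y
    unfolding Sg g_def inner_sum_left using e
    by (intro sum_nonneg) (auto simp: mult.assoc)
  moreover have "S ** S = A"
  proof -
    have "S *v (S *v y) = A *v y" for y
    proof (rule linear_eq_on[of "\<lambda>y. S *v (S *v y)" "\<lambda>y. A *v y" y B])
      show "linear (\<lambda>y. S *v (S *v y))"
        using linear_compose[OF matrix_vector_mul_linear[of S] matrix_vector_mul_linear[of S]] by (simp add: o_def)
      show "y \<in> span B" using B by simp
      show "S *v (S *v x) = A *v x" if "x \<in> B" for x
        using gB[OF that] bspec[OF e that] lin by (simp add: Sg linear_cmul)
    qed simp
    then show ?thesis by (simp add: matrix_eq matrix_vector_mul_assoc)
  qed
  ultimately show ?thesis unfolding psd_def by blast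
qed

text \<open>
  Both roots have the same square. On an eigenvector \<open>x\<close> of \<open>S\<close> with eigenvalue \<open>\<mu>\<close>, the vector
  \<open>w = T x - \<mu> x\<close> satisfies \<open>T w = - \<mu> w\<close>, which is incompatible with \<open>T \<ge> 0\<close> unless \<open>w = 0\<close> or \<open>\<mu> = 0\<close>.
\<close>

lemma psd_sqrt_unique:
  assumes S: "psd S" and T: "psd T" and eq: "S ** S = T ** T"
  shows "S = T"
proof -
  obtain B \<mu> where "finite B" and B: "span B = UNIV" and "pairwise orthogonal B"
    and e: "\<forall>x\<in>B. norm x = 1 \<and> S *v x = \<mu> x *\<^sub>R x \<and> 0 \<le> \<mu> x"
    using psd_eigenbasis[OF S] by blast
  have TT: "T *v (T *v y) = S *v (S *v y)" for y
    by (simp add: matrix_vector_mul_assoc eq)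
  have "T *v x = \<mu> x *\<^sub>R x" if x: "x \<in> B" for x
  proof (cases "\<mu> x = 0")
    case True
    then have "T *v (T *v x) = 0" using TT[of x] bspec[OF e x] by simp
    then have "(T *v x) \<bullet> (T *v x) = 0" using psd_sym[OF T, of x "T *v x"] by simp
    then show ?thesis using True by simp
  next
    case False
    define w where "w = T *v x - \<mu> x *\<^sub>R x"
    have "T *v w = - (\<mu> x *\<^sub>R w)"
      unfolding w_def using TT[of x] bspec[OF e x]
      by (simp add: matrix_vector_mult_diff_distrib matrix_vector_mult_scaleR algebra_simps)
    then have "(T *v w) \<bullet> w = - (\<mu> x * (w \<bullet> w))" by simp
    moreover have "0 \<le> (T *v w) \<bullet> w" using T unfolding psd_def by blast
    moreover have "0 \<le> w \<bullet> w" "\<mu> x > 0" using bspec[OF e x] False by auto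
    ultimately have "w \<bullet> w = 0"
      by (simp add: mult_le_0_iff)
    then show ?thesis unfolding w_def by simp
  qed
  then have "S *v y = T *v y" for y
    by (intro linear_eq_on[of "(*v) S" "(*v) T" y B]) (use B e in auto)
  then show ?thesis by (simp add: matrix_eq)
qed

lemma psd_sqrt:
  assumes "psd A"
  shows "psd (psd_sqrt A)" "psd_sqrt A ** psd_sqrt A = A"
proof -
  have "\<exists>!S. psd S \<and> S ** S = A"
  proof (rule ex_ex1I[OF psd_sqrt_exists[OF assms]])
    fix S T assume "psd S \<and> S ** S = A" "psd T \<and> T ** T = A"
    then show "S = T" by (intro psd_sqrt_unique[of S T]) simp_all
  qed
  from theI'[OF this] show "psd (psd_sqrt A)" "psd_sqrt A ** psd_sqrt A = A"
    unfolding psd_sqrt_def by blast+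
qed

lemma psd_sqrt_inner:
  assumes "psd A"
  shows "(A *v \<xi>) \<bullet> \<eta> = (psd_sqrt A *v \<xi>) \<bullet> (psd_sqrt A *v \<eta>)"
proof -
  have "(A *v \<xi>) \<bullet> \<eta> = (psd_sqrt A *v (psd_sqrt A *v \<xi>)) \<bullet> \<eta>"
    by (simp add: matrix_vector_mul_assoc psd_sqrt(2)[OF assms])
  then show ?thesis by (simp add: psd_sym[OF psd_sqrt(1)[OF assms]])
qed

lemma norm_psd_sqrt:
  assumes "psd A"
  shows "(norm (psd_sqrt A *v \<xi>))\<^sup>2 = (A *v \<xi>) \<bullet> \<xi>"
  by (simp add: psd_sqrt_inner[OF assms] dot_square_norm)

section \<open>Almost everywhere differentiability of Lipschitz functions\<close>

lemma emeasure_interval_measure_Ioo: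
  assumes mono: "\<And>x y. x \<le> y \<Longrightarrow> F x \<le> F y" and cont: "continuous_on UNIV F" and "a \<le> b"
  shows "emeasure (interval_measure F) {a<..<b} = ennreal (F b - F a)"
proof (cases "a = b")
  case False
  then have ab: "a < b" using assms by simp
  have rc: "continuous (at_right x) F" for x
    using cont by (rule continuous_at_imp_continuous_at_within[OF continuous_on_interior]) simp
  have "{a<..b} = {a<..<b} \<union> {b..b}" using ab by auto
  moreover have "emeasure (interval_measure F) ({a<..<b} \<union> {b..b})
      = emeasure (interval_measure F) {a<..<b} + emeasure (interval_measure F) {b..b}"
    by (intro plus_emeasure[symmetric]) auto
  moreover have "emeasure (interval_measure F) {b..b} = F b - F b"
    using mono continuous_on_subset[OF cont] by (intro emeasure_interval_measure_Icc) auto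
  moreover have "emeasure (interval_measure F) {a<..b} = F b - F a"
    using mono rc ab by (intro emeasure_interval_measure_Ioc) auto
  ultimately show ?thesis by simp
qed simp

text \<open>
  The Stieltjes measure of a monotone 1-Lipschitz function is dominated by Lebesgue measure, and its
  Radon-Nikodym derivative is the integrand.
\<close>

lemma monotone_lipschitz_indefinite_integral:
  fixes F :: "real \<Rightarrow> real"
  assumes mono: "\<And>x y. x \<le> y \<Longrightarrow> F x \<le> F y" and lip: "\<And>x y. x \<le> y \<Longrightarrow> F y - F x \<le> y - x"
  obtains g :: "real \<Rightarrow> real" where "\<And>a b. g integrable_on {a..b}"
    "\<And>a b. a \<le> b \<Longrightarrow> F b - F a = integral {a..b} g"
proof -
  have "1-lipschitz_on UNIV F"
  proof (rule lipschitz_onI)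
    fix x y
    show "dist (F x) (F y) \<le> 1 * dist x y"
      using mono[of x y] mono[of y x] lip[of x y] lip[of y x] by (cases "x \<le> y") (simp_all add: dist_real_def)
  qed simp
  then have cont: "continuous_on UNIV F" by (rule lipschitz_on_continuous_on)
  have rc: "continuous (at_right x) F" for x
    using cont by (rule continuous_at_imp_continuous_at_within[OF continuous_on_interior]) simp
  define G where "G x = x - F x" for x
  have Gmono: "x \<le> y \<Longrightarrow> G x \<le> G y" for x y unfolding G_def using lip[of x y] by simp
  have Gcont: "continuous_on UNIV G" unfolding G_def using cont by (intro continuous_intros)
  let ?\<mu> = "interval_measure F" and ?\<nu> = "interval_measure G"
  \<comment> \<open>Adding the measures of two functions with sum \<open>x\<close> gives Lebesgue measure, so each is dominated by it.\<close>
  define \<rho> where "\<rho> = measure_of UNIV (sets borel) (\<lambda>A. emeasure ?\<mu> A + emeasure ?\<nu> A)"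
  have sets_\<rho>: "sets \<rho> = sets borel" unfolding \<rho>_def
    by (metis sets.sets_measure_of_eq space_borel)
  have em_\<rho>: "emeasure \<rho> A = emeasure ?\<mu> A + emeasure ?\<nu> A" if "A \<in> sets borel" for A
  proof (rule emeasure_measure_of[OF \<rho>_def])
    show "countably_additive (sets \<rho>) (\<lambda>A. emeasure ?\<mu> A + emeasure ?\<nu> A)"
      unfolding countably_additive_def sets_\<rho>
      by (auto simp: suminf_add[symmetric] suminf_emeasure)
  qed (use that sets_\<rho> in \<open>auto simp: positive_def\<close>)
  have "lborel = \<rho>"
  proof (rule lborel_eqI)
    fix l u :: real assume "\<And>b. b \<in> Basis \<Longrightarrow> l \<bullet> b \<le> u \<bullet> b"
    then have lu: "l \<le> u" by simp
    have "emeasure \<rho> (box l u) = ennreal (F u - F l) + ennreal (G u - G l)"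
      using lu mono Gmono cont Gcont
      by (simp add: em_\<rho> box_real emeasure_interval_measure_Ioo)
    also have "\<dots> = ennreal (u - l)"
      using lu mono Gmono by (subst ennreal_plus[symmetric]) (auto simp: G_def)
    finally show "emeasure \<rho> (box l u) = (\<Prod>b\<in>Basis. (u - l) \<bullet> b)" by simp
  qed (simp add: sets_\<rho>)
  then have "emeasure ?\<mu> A \<le> emeasure lborel A" if "A \<in> sets borel" for A
    using em_\<rho>[OF that] by simp
  then have ac: "absolutely_continuous lborel ?\<mu>"
    unfolding absolutely_continuous_def null_sets_def by fastforce
  define g where "g x = enn2real (RN_deriv lborel ?\<mu> x)" for x
  have sf: "sigma_finite_measure ?\<mu>" using mono rc by (rule sigma_finite_interval_measure)
  have fin: "AE x in lborel. RN_deriv lborel ?\<mu> x \<noteq> \<infinity>"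
    by (rule sigma_finite_measure.RN_deriv_finite[OF sigma_finite_lborel sf ac]) simp
  have dens: "density lborel (RN_deriv lborel ?\<mu>) = ?\<mu>"
    by (rule sigma_finite_measure.density_RN_deriv[OF sigma_finite_lborel ac]) simp
  have gm[measurable]: "g \<in> borel_measurable borel"
    using borel_measurable_RN_deriv[of lborel ?\<mu>] unfolding g_def by simp
  have hb: "has_bochner_integral lborel (\<lambda>x. indicator {a..b} x *\<^sub>R g x) (F b - F a)" if ab: "a \<le> b" for a b
  proof (rule has_bochner_integral_nn_integral)
    show "(\<lambda>x. indicator {a..b} x *\<^sub>R g x) \<in> borel_measurable lborel" by measurable
    show "AE x in lborel. 0 \<le> indicator {a..b} x *\<^sub>R g x" by (simp add: g_def)
    have "(\<integral>\<^sup>+x. ennreal (indicator {a..b} x *\<^sub>R g x) \<partial>lborel) = (\<integral>\<^sup>+x. RN_deriv lborel ?\<mu> x * indicator {a..b} x \<partial>lborel)"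
      using fin by (intro nn_integral_cong_AE) (auto simp: g_def indicator_def ennreal_enn2real_if elim!: eventually_mono)
    also have "\<dots> = emeasure (density lborel (RN_deriv lborel ?\<mu>)) {a..b}"
      by (rule emeasure_density[symmetric]) auto
    also have "\<dots> = ennreal (F b - F a)"
      unfolding dens using mono ab continuous_on_subset[OF cont] by (intro emeasure_interval_measure_Icc) auto
    finally show "(\<integral>\<^sup>+x. ennreal (indicator {a..b} x *\<^sub>R g x) \<partial>lborel) = ennreal (F b - F a)" .
  qed (use mono ab in simp)
  have int: "set_integrable lborel {a..b} g" for a b
    using hb[of a b] unfolding set_integrable_def
    by (cases "a \<le> b") (auto intro: integrable.intros)
  show thesis
  proof (rule that)
    show "g integrable_on {a..b}" for a b using set_borel_integral_eq_integral(1)[OF int] .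
    show "F b - F a = integral {a..b} g" if "a \<le> b" for a b
      using set_borel_integral_eq_integral(2)[OF int, of a b] has_bochner_integral_integral_eq[OF hb[OF that]]
      unfolding set_lebesgue_integral_def by simp
  qed
qed

text \<open>
  The Lebesgue differentiation theorem gives right derivatives a.e.; applied to the reflected function
  it gives left derivatives, and the two agree because both equal the integrand.
\<close>

lemma indefinite_integral_DERIV_ae:
  fixes F g :: "real \<Rightarrow> real"
  assumes int: "\<And>a b. g integrable_on {a..b}"
    and F: "\<And>a b. a \<le> b \<Longrightarrow> F b - F a = integral {a..b} g"
  obtains N where "negligible N" "\<And>x. x \<notin> N \<Longrightarrow> (F has_real_derivative g x) (at x)"
proof -
  obtain N1 where N1: "negligible N1" and
    r: "\<And>x e. x \<notin> N1 \<Longrightarrow> 0 < e \<Longrightarrow>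
      \<exists>d>0. \<forall>h. 0 < h \<and> h < d \<longrightarrow> norm (integral (cbox x (x + h *\<^sub>R One)) g /\<^sub>R h ^ DIM(real) - g x) < e"
    using integrable_ccontinuous_explicit[OF int[folded box_real(2)]] by blast
  have int': "(\<lambda>x. g (- x)) integrable_on {a..b}" for a b
    using int[of "-b" "-a"] Henstock_Kurzweil_Integration.integrable_reflect_real[where f = g and a = "- b" and b = "- a"] by simp
  obtain N2 where N2: "negligible N2" and
    l: "\<And>x e. x \<notin> N2 \<Longrightarrow> 0 < e \<Longrightarrow>
      \<exists>d>0. \<forall>h. 0 < h \<and> h < d \<longrightarrow> norm (integral (cbox x (x + h *\<^sub>R One)) (\<lambda>x. g (- x)) /\<^sub>R h ^ DIM(real) - g (- x)) < e"
    using integrable_ccontinuous_explicit[OF int'[folded box_real(2)]] by blast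
  define N where "N = N1 \<union> uminus ` N2"
  have "negligible N" unfolding N_def
    using N1 N2 by (intro negligible_Un negligible_differentiable_image_negligible)
      (auto intro!: derivative_intros)
  moreover have "(F has_real_derivative g x) (at x)" if x: "x \<notin> N" for x
    unfolding DERIV_def
  proof (rule LIM_I)
    fix e :: real assume e: "0 < e"
    have x1: "x \<notin> N1" and x2: "- x \<notin> N2" using x unfolding N_def by (auto intro: image_eqI[of _ uminus "- x"])
    obtain d1 where d1: "d1 > 0" "\<And>h. 0 < h \<Longrightarrow> h < d1 \<Longrightarrow> \<bar>integral {x..x+h} g / h - g x\<bar> < e"
      using r[OF x1 e] by (auto simp: divide_inverse mult.commute)
    obtain d2 where d2: "d2 > 0" "\<And>h. 0 < h \<Longrightarrow> h < d2 \<Longrightarrow> \<bar>integral {-x..-x+h} (\<lambda>x. g (- x)) / h - g x\<bar> < e"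
      using l[OF x2 e] by (auto simp: divide_inverse mult.commute)
    have "norm ((F (x + h) - F x) / h - g x) < e" if h: "h \<noteq> 0" "norm (h - 0) < min d1 d2" for h
    proof (cases "h > 0")
      case True
      then show ?thesis using d1(2)[of h] h F[of x "x + h"] by simp
    next
      case False
      then have hn: "- h > 0" using h by simp
      have "integral {-x..-x + - h} (\<lambda>x. g (- x)) = integral {x + h..x} g"
        using Henstock_Kurzweil_Integration.integral_reflect_real[where f = g and a = "x + h" and b = x] by simp
      also have "\<dots> = F x - F (x + h)" using F[of "x + h" x] hn by simp
      finally show ?thesis using d2(2)[OF hn] h hn
        by (simp add: minus_divide_left[symmetric] divide_simps algebra_simps)
    qed
    then show "\<exists>s>0. \<forall>h. h \<noteq> 0 \<and> norm (h - 0) < s \<longrightarrow> norm ((F (x + h) - F x) / h - g x) < e"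
      using d1(1) d2(1) by (intro exI[of _ "min d1 d2"]) auto
  qed
  ultimately show thesis using that by blast
qed

text \<open>
  Rescaling and adding the identity turns \<open>f\<close> into a monotone 1-Lipschitz function.
\<close>

theorem lipschitz_differentiable_ae:
  fixes f :: "real \<Rightarrow> real"
  assumes "L-lipschitz_on UNIV f"
  shows "negligible {x. \<not> (\<exists>D. (f has_real_derivative D) (at x))}"
proof -
  define M where "M = L + 1"
  have M: "M > 0" unfolding M_def using lipschitz_on_nonneg[OF assms] by simp
  define \<phi> where "\<phi> x = f x / M" for x
  define F where "F x = (\<phi> x + x) / 2" for x
  have b: "\<bar>f y - f x\<bar> \<le> M * (y - x)" if "x \<le> y" for x y
  proof -
    have "\<bar>f y - f x\<bar> \<le> L * (y - x)"
      using lipschitz_onD[OF assms, of y x] that by (simp add: dist_real_def)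
    also have "\<dots> \<le> M * (y - x)" unfolding M_def using that by (intro mult_right_mono) auto
    finally show ?thesis .
  qed
  have b': "\<bar>\<phi> y - \<phi> x\<bar> \<le> y - x" if "x \<le> y" for x y
    using b[OF that] M unfolding \<phi>_def by (simp add: diff_divide_distrib[symmetric] abs_divide field_simps)
  obtain g where g: "\<And>a b. g integrable_on {a..b}" "\<And>a b. a \<le> b \<Longrightarrow> F b - F a = integral {a..b} g"
  proof (rule monotone_lipschitz_indefinite_integral[of F])
    show "F x \<le> F y" if "x \<le> y" for x y using b'[OF that] by (simp add: F_def abs_le_iff)
    show "F y - F x \<le> y - x" if "x \<le> y" for x y using b'[OF that] by (simp add: F_def abs_le_iff field_simps)
  qed blast
  obtain N where N: "negligible N" "\<And>x. x \<notin> N \<Longrightarrow> (F has_real_derivative g x) (at x)"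
    using indefinite_integral_DERIV_ae[OF g] by blast
  have "(f has_real_derivative M * (2 * g x - 1)) (at x)" if "x \<notin> N" for x
  proof -
    have "((\<lambda>x. M * (2 * F x - x)) has_real_derivative M * (2 * g x - 1)) (at x)"
      using N(2)[OF that] by (auto intro!: derivative_eq_intros)
    moreover have "(\<lambda>x. M * (2 * F x - x)) = f" using M by (auto simp: F_def \<phi>_def field_simps)
    ultimately show ?thesis by simp
  qed
  then show ?thesis by (intro negligible_subset[OF N(1)]) auto
qed

text \<open>
  Differentiability of the restriction of \<open>f\<close> to the line through \<open>x\<close> with direction \<open>e\<close>.
\<close>

definition line_differentiable :: "('a::euclidean_space \<Rightarrow> real) \<Rightarrow> 'a \<Rightarrow> 'a \<Rightarrow> bool" where
  "line_differentiable f e x \<longleftrightarrow> (\<exists>D. ((\<lambda>t. f (x + t *\<^sub>R e)) has_real_derivative D) (at 0))"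

text \<open>
  A description of the differentiability set through difference quotients only, from which its
  measurability can be read off.
\<close>

lemma line_differentiable_iff_Cauchy:
  fixes f :: "'a::euclidean_space \<Rightarrow> real"
  defines "q \<equiv> \<lambda>x e t. (f (x + t *\<^sub>R e) - f x) / t"
  shows "line_differentiable f e x \<longleftrightarrow> (\<forall>k::nat. \<exists>m::nat. \<forall>s t. s \<noteq> 0 \<longrightarrow> t \<noteq> 0 \<longrightarrow>
      \<bar>s\<bar> < 1 / Suc m \<longrightarrow> \<bar>t\<bar> < 1 / Suc m \<longrightarrow> \<bar>q x e s - q x e t\<bar> \<le> 1 / Suc k)" (is "_ \<longleftrightarrow> ?C")
proof
  assume "line_differentiable f e x"
  then obtain D where D: "((\<lambda>t. q x e t) \<longlongrightarrow> D) (at 0)"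
    unfolding line_differentiable_def DERIV_def q_def by auto
  show ?C
  proof
    fix k :: nat
    define r where "r = 1 / real (Suc k)"
    have "\<forall>\<^sub>F t in at 0. dist (q x e t) D < r / 2"
      using D by (rule tendstoD) (simp add: r_def)
    then obtain d where d: "d > 0" "\<And>t. t \<noteq> 0 \<Longrightarrow> \<bar>t\<bar> < d \<Longrightarrow> \<bar>q x e t - D\<bar> < r / 2"
      by (auto simp: eventually_at dist_real_def)
    obtain m where m: "1 / Suc m < d" using nat_approx_posE[OF d(1)] by metis
    have "\<bar>q x e s - q x e t\<bar> \<le> 1 / Suc k" if "s \<noteq> 0" "t \<noteq> 0" "\<bar>s\<bar> < 1 / Suc m" "\<bar>t\<bar> < 1 / Suc m" for s t
    proof -
      have "\<bar>q x e s - D\<bar> < r / 2" "\<bar>q x e t - D\<bar> < r / 2"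
        using d(2)[of s] d(2)[of t] that m by linarith+
      then have "\<bar>q x e s - q x e t\<bar> \<le> r" by linarith
      then show ?thesis by (simp add: r_def)
    qed
    then show "\<exists>m::nat. \<forall>s t. s \<noteq> 0 \<longrightarrow> t \<noteq> 0 \<longrightarrow>
      \<bar>s\<bar> < 1 / Suc m \<longrightarrow> \<bar>t\<bar> < 1 / Suc m \<longrightarrow> \<bar>q x e s - q x e t\<bar> \<le> 1 / Suc k" by blast
  qed
next
  assume C: ?C
  define X where "X n = q x e (1 / Suc n)" for n :: nat
  have close: "\<exists>m. \<forall>t. t \<noteq> 0 \<longrightarrow> \<bar>t\<bar> < 1 / Suc m \<longrightarrow> (\<forall>n>m. \<bar>q x e t - X n\<bar> \<le> 1 / Suc k)" for k
  proof -
    obtain m where m: "\<And>s t. s \<noteq> 0 \<Longrightarrow> t \<noteq> 0 \<Longrightarrow> \<bar>s\<bar> < 1 / Suc m \<Longrightarrow> \<bar>t\<bar> < 1 / Suc m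
        \<Longrightarrow> \<bar>q x e s - q x e t\<bar> \<le> 1 / Suc k"
      using C[rule_format, of k] by blast
    have "\<bar>q x e t - X n\<bar> \<le> 1 / Suc k" if "t \<noteq> 0" "\<bar>t\<bar> < 1 / Suc m" "n > m" for t n
      unfolding X_def using that by (intro m) (auto simp: frac_less2)
    then show ?thesis by blast
  qed
  have "Cauchy X"
  proof (rule CauchyI')
    fix r :: real assume "0 < r"
    then obtain k where k: "1 / Suc k < r" using nat_approx_posE by metis
    obtain m where m: "\<And>t n. t \<noteq> 0 \<Longrightarrow> \<bar>t\<bar> < 1 / Suc m \<Longrightarrow> n > m \<Longrightarrow> \<bar>q x e t - X n\<bar> \<le> 1 / Suc k"
      using close[of k] by blast
    have "dist (X i) (X n) < r" if "i \<ge> Suc m" "n > i" for i n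
    proof -
      have "\<bar>q x e (1 / Suc i) - X n\<bar> \<le> 1 / Suc k"
        using that by (intro m) (auto simp: frac_less2)
      then show ?thesis using k by (simp add: X_def dist_real_def)
    qed
    then show "\<exists>M. \<forall>i\<ge>M. \<forall>n>i. dist (X i) (X n) < r" by blast
  qed
  then obtain D where D: "X \<longlonglongrightarrow> D" using Cauchy_convergent convergent_def by blast
  have "((\<lambda>t. q x e t) \<longlongrightarrow> D) (at 0)"
  proof (rule LIM_I)
    fix r :: real assume "0 < r"
    then obtain k where k: "1 / Suc k < r" using nat_approx_posE by metis
    obtain m where m: "\<And>t n. t \<noteq> 0 \<Longrightarrow> \<bar>t\<bar> < 1 / Suc m \<Longrightarrow> n > m \<Longrightarrow> \<bar>q x e t - X n\<bar> \<le> 1 / Suc k"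
      using close[of k] by blast
    have "norm (q x e t - D) < r" if t: "t \<noteq> 0" "norm (t - 0) < 1 / Suc m" for t
    proof -
      have "(\<lambda>n. \<bar>q x e t - X n\<bar>) \<longlonglongrightarrow> \<bar>q x e t - D\<bar>" using D by (intro tendsto_intros)
      moreover have "\<forall>\<^sub>F n in sequentially. \<bar>q x e t - X n\<bar> \<le> 1 / Suc k"
        using eventually_gt_at_top[of m] by eventually_elim (use m t in auto)
      ultimately have "\<bar>q x e t - D\<bar> \<le> 1 / Suc k"
        by (intro tendsto_upperbound) auto
      then show ?thesis using k by simp
    qed
    then show "\<exists>s>0. \<forall>t. t \<noteq> 0 \<and> norm (t - 0) < s \<longrightarrow> norm (q x e t - D) < r"
      by (intro exI[of _ "1 / Suc m"]) auto
  qed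
  then show "line_differentiable f e x"
    unfolding line_differentiable_def DERIV_def q_def by auto
qed

lemma line_differentiable_borel:
  fixes f :: "'a::euclidean_space \<Rightarrow> real"
  assumes cont: "continuous_on UNIV f"
  shows "{x. line_differentiable f e x} \<in> sets borel"
proof -
  define q where "q x t = (f (x + t *\<^sub>R e) - f x) / t" for x t
  have qc: "continuous_on UNIV (\<lambda>x. q x t)" for t
    unfolding q_def divide_inverse by (intro continuous_intros continuous_on_compose2[OF cont]) auto
  have "closed {x. \<forall>s t. s \<noteq> 0 \<longrightarrow> t \<noteq> 0 \<longrightarrow>
      \<bar>s\<bar> < 1 / real (Suc m) \<longrightarrow> \<bar>t\<bar> < 1 / real (Suc m) \<longrightarrow> \<bar>q x s - q x t\<bar> \<le> 1 / Suc k}" for m k :: nat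
    by (intro closed_Collect_all closed_Collect_imp open_Collect_const closed_Collect_le continuous_intros qc)
  then have "(\<Inter>k. \<Union>m. {x. \<forall>s t. s \<noteq> 0 \<longrightarrow> t \<noteq> 0 \<longrightarrow>
      \<bar>s\<bar> < 1 / real (Suc m) \<longrightarrow> \<bar>t\<bar> < 1 / real (Suc m) \<longrightarrow> \<bar>q x s - q x t\<bar> \<le> 1 / Suc k}) \<in> sets borel"
    by (intro sets.countable_INT' sets.countable_UN' borel_closed) auto
  also have "(\<Inter>k. \<Union>m. {x. \<forall>s t. s \<noteq> 0 \<longrightarrow> t \<noteq> 0 \<longrightarrow>
      \<bar>s\<bar> < 1 / real (Suc m) \<longrightarrow> \<bar>t\<bar> < 1 / real (Suc m) \<longrightarrow> \<bar>q x s - q x t\<bar> \<le> 1 / Suc k})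
      = {x. line_differentiable f e x}"
    unfolding line_differentiable_iff_Cauchy q_def by blast
  finally show ?thesis .
qed

text \<open>
  By translation invariance \<open>\<integral>\<^sub>0\<^sup>1 |N - t e| dt = |N|\<close>, while Fubini's theorem evaluates the left-hand
  side by integrating over the lines in direction \<open>e\<close> first, which gives \<open>0\<close>.
\<close>

lemma null_if_null_on_lines:
  fixes N :: "'a::euclidean_space set"
  assumes N[measurable]: "N \<in> sets borel" and line: "\<And>x. negligible {t::real. x + t *\<^sub>R e \<in> N}"
  shows "emeasure lborel N = 0"
proof -
  let ?I = "\<lambda>t::real. \<lambda>x::'a. indicator {0..1} t * indicator N (x + t *\<^sub>R e) :: ennreal"
  have "(\<integral>\<^sup>+t. ?I t x \<partial>lborel) = 0" for x
  proof -
    have "(\<lambda>t. x + t *\<^sub>R e) -` N \<inter> space lborel \<in> sets lborel"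
      by (intro measurable_sets[where A = borel]) auto
    then have m: "{t. x + t *\<^sub>R e \<in> N} \<in> sets lborel" by (simp add: vimage_def)
    then have "{t. x + t *\<^sub>R e \<in> N} \<in> null_sets lborel"
      using line[of x] by (simp add: null_sets_def negligible_iff_null_sets emeasure_completion)
    then have "AE t in lborel. t \<notin> {t. x + t *\<^sub>R e \<in> N}" by (rule AE_not_in)
    then have "AE t in lborel. ?I t x = 0" by (rule eventually_mono) (auto simp: indicator_def)
    then have "(\<integral>\<^sup>+t. ?I t x \<partial>lborel) = (\<integral>\<^sup>+t. 0 \<partial>(lborel::real measure))" by (rule nn_integral_cong_AE)
    then show ?thesis by simp
  qed
  then have "0 = (\<integral>\<^sup>+x. (\<integral>\<^sup>+t. ?I t x \<partial>lborel) \<partial>lborel)" by simp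
  also have "\<dots> = (\<integral>\<^sup>+t. (\<integral>\<^sup>+x. ?I t x \<partial>lborel) \<partial>lborel)"
  proof -
    have "pair_sigma_finite (lborel :: real measure) (lborel :: 'a measure)"
      by (intro pair_sigma_finite.intro sigma_finite_lborel)
    note F = pair_sigma_finite.Fubini'[OF this]
    have "(\<lambda>(t, x). ?I t x) \<in> borel_measurable (lborel \<Otimes>\<^sub>M lborel)" by measurable
    from F[OF this] show ?thesis by simp
  qed
  also have "\<dots> = (\<integral>\<^sup>+t. indicator {0..1} t * emeasure lborel N \<partial>(lborel::real measure))"
  proof (intro nn_integral_cong)
    fix t :: real
    have "(\<integral>\<^sup>+x. indicator N (x + t *\<^sub>R e) \<partial>lborel) = (\<integral>\<^sup>+x. indicator N (t *\<^sub>R e + x) \<partial>lborel)"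
      by (simp add: add.commute)
    also have "\<dots> = (\<integral>\<^sup>+y. indicator N y \<partial>distr lborel borel ((+) (t *\<^sub>R e)))"
      by (subst nn_integral_distr) auto
    also have "\<dots> = emeasure lborel N" by (simp add: lborel_distr_plus)
    finally show "(\<integral>\<^sup>+x. ?I t x \<partial>lborel) = indicator {0..1} t * emeasure lborel N"
      by (simp add: nn_integral_cmult)
  qed
  also have "\<dots> = emeasure lborel N" by (simp add: nn_integral_multc)
  finally show ?thesis by simp
qed

lemma lipschitz_line_differentiable_ae:
  fixes f :: "'a::euclidean_space \<Rightarrow> real"
  assumes lip: "L-lipschitz_on UNIV f"
  shows "AE x in lborel. line_differentiable f e x"
proof -
  let ?N = "{x. \<not> line_differentiable f e x}"
  have "{x. line_differentiable f e x} \<in> sets borel"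
    using lip by (intro line_differentiable_borel lipschitz_on_continuous_on)
  then have N: "?N \<in> sets borel"
    by (simp add: Collect_neg_eq borel_comp)
  have "negligible {t::real. x + t *\<^sub>R e \<in> ?N}" for x
  proof -
    have lip1: "(L * norm e)-lipschitz_on UNIV (\<lambda>t. f (x + t *\<^sub>R e))"
    proof (rule lipschitz_onI)
      fix s t :: real
      have "dist (f (x + s *\<^sub>R e)) (f (x + t *\<^sub>R e)) \<le> L * dist (x + s *\<^sub>R e) (x + t *\<^sub>R e)"
        using lip by (intro lipschitz_onD) auto
      also have "dist (x + s *\<^sub>R e) (x + t *\<^sub>R e) = norm e * dist s t"
        by (simp add: dist_norm scaleR_diff_left[symmetric] dist_real_def)
      finally show "dist (f (x + s *\<^sub>R e)) (f (x + t *\<^sub>R e)) \<le> L * norm e * dist s t" by (simp add: mult.assoc)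
    qed (simp add: lipschitz_on_nonneg[OF lip])
    have "line_differentiable f e (x + t *\<^sub>R e)"
      if "((\<lambda>t. f (x + t *\<^sub>R e)) has_real_derivative D) (at t)" for t D
    proof -
      have "((\<lambda>s. f (x + (t + s) *\<^sub>R e)) has_real_derivative D) (at 0)"
        using that DERIV_shift[of "\<lambda>t. f (x + t *\<^sub>R e)" D 0 t] by (simp add: add.commute)
      then show ?thesis unfolding line_differentiable_def by (auto simp: scaleR_add_left add.assoc)
    qed
    then show ?thesis
      by (intro negligible_subset[OF lipschitz_differentiable_ae[OF lip1]]) auto
  qed
  from null_if_null_on_lines[OF N this] N have "?N \<in> null_sets lborel" by (simp add: null_sets_def)
  then show ?thesis by (auto intro: AE_I')
qed

lemma AE_lebesgue_on_if_AE_lborel: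
  assumes "AE x in lborel. P x" "S \<in> sets lebesgue"
  shows "AE x in lebesgue_on S. P x"
proof -
  have "AE x in lebesgue. P x" using assms(1) by (rule AE_completion)
  then show ?thesis using assms(2) by (subst AE_restrict_space_iff) (auto elim: eventually_mono)
qed

lemma borel_measurable_lebesgue_on:
  assumes "f \<in> borel_measurable borel"
  shows "f \<in> borel_measurable (lebesgue_on S)"
  using assms by (intro measurable_restrict_space1 measurable_completion) simp

text \<open>
  All partial derivatives exist at \<open>x\<close>, with values given by \<open>D\<close>. Unlike \<^term>\<open>grad\<close>, this does not
  confuse a derivative with the default value of \<^term>\<open>deriv\<close>.
\<close>

definition has_grad :: "(real ^ 'n \<Rightarrow> real) \<Rightarrow> real ^ 'n \<Rightarrow> real ^ 'n \<Rightarrow> bool" where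
  "has_grad \<phi> D x \<longleftrightarrow> (\<forall>i. ((\<lambda>t. \<phi> (x + t *\<^sub>R axis i 1)) has_real_derivative D $ i) (at 0))"

lemma grad_eqI: "has_grad \<phi> D x \<Longrightarrow> grad \<phi> x = D"
  unfolding has_grad_def grad_def by (simp add: vec_eq_iff DERIV_imp_deriv)

lemma has_grad_combination:
  "has_grad u D x \<Longrightarrow> has_grad w E x \<Longrightarrow> has_grad (\<lambda>x. a * u x + w x) (a *\<^sub>R D + E) x"
  unfolding has_grad_def by (auto intro!: derivative_eq_intros)

lemma has_grad_compose:
  assumes F: "(F has_real_derivative F') (at (u x))" and u: "has_grad u D x"
  shows "has_grad (\<lambda>x. F (u x)) (F' *\<^sub>R D) x"
  unfolding has_grad_def
proof
  fix i
  have "((\<lambda>t. F (u (x + t *\<^sub>R axis i 1))) has_real_derivative F' * D $ i) (at 0)"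
    using u F unfolding has_grad_def
    by (intro DERIV_chain2[where f = F and g = "\<lambda>t. u (x + t *\<^sub>R axis i 1)"]) auto
  then show "((\<lambda>t. F (u (x + t *\<^sub>R axis i 1))) has_real_derivative (F' *\<^sub>R D) $ i) (at 0)" by simp
qed

lemma lipschitz_has_grad_ae:
  assumes "L-lipschitz_on UNIV \<phi>"
  shows "AE x in lborel. has_grad \<phi> (grad \<phi> x) x"
proof -
  have "AE x in lborel. \<forall>i\<in>UNIV. line_differentiable \<phi> (axis i 1) x"
    using assms by (intro AE_finite_allI lipschitz_line_differentiable_ae) auto
  then show ?thesis
  proof (rule eventually_mono)
    fix x assume "\<forall>i\<in>UNIV. line_differentiable \<phi> (axis i 1) x"
    then have "\<forall>i. \<exists>D. ((\<lambda>t. \<phi> (x + t *\<^sub>R axis i 1)) has_real_derivative D) (at 0)"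
      unfolding line_differentiable_def by blast
    then obtain D where "\<And>i. ((\<lambda>t. \<phi> (x + t *\<^sub>R axis i 1)) has_real_derivative D i) (at 0)" by metis
    then have "has_grad \<phi> (\<chi> i. D i) x" unfolding has_grad_def by simp
    then show "has_grad \<phi> (grad \<phi> x) x" using grad_eqI by metis
  qed
qed

text \<open>
  Where a partial derivative exists it is a limit of difference quotients, and elsewhere \<^term>\<open>deriv\<close>
  returns one fixed value; the set that separates the two cases is Borel.
\<close>

lemma grad_borel_measurable:
  fixes \<phi> :: "real ^ 'n \<Rightarrow> real"
  assumes cont: "continuous_on UNIV \<phi>"
  shows "grad \<phi> \<in> borel_measurable borel"
proof -
  have comp: "(\<lambda>x. grad \<phi> x $ i) \<in> borel_measurable borel" for i
  proof -
    let ?e = "axis i 1 :: real ^ 'n"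
    let ?G = "{x. line_differentiable \<phi> ?e x}"
    define q where "q n x = (\<phi> (x + (1 / real (Suc n)) *\<^sub>R ?e) - \<phi> x) / (1 / real (Suc n))" for n x
    have qm: "q n \<in> borel_measurable borel" for n
      unfolding q_def divide_inverse
      by (intro borel_measurable_continuous_onI continuous_intros continuous_on_compose2[OF cont]) auto
    have "grad \<phi> x $ i = (if x \<in> ?G then lim (\<lambda>n. q n x) else (SOME D. False))" for x
    proof (cases "x \<in> ?G")
      case True
      then obtain D where D: "((\<lambda>t. \<phi> (x + t *\<^sub>R ?e)) has_real_derivative D) (at 0)"
        unfolding line_differentiable_def by blast
      then have "((\<lambda>h. (\<phi> (x + h *\<^sub>R ?e) - \<phi> x) / h) \<longlongrightarrow> D) (at 0)" by (simp add: DERIV_def)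
      moreover have "filterlim (\<lambda>n. 1 / real (Suc n)) (at 0) sequentially"
        using lim_1_over_n[THEN LIMSEQ_Suc] by (auto simp: filterlim_at)
      ultimately have "(\<lambda>n. q n x) \<longlonglongrightarrow> D" unfolding q_def by (rule filterlim_compose)
      then show ?thesis using True D by (simp add: grad_def DERIV_imp_deriv limI)
    next
      case False
      then show ?thesis by (simp add: grad_def deriv_def line_differentiable_def)
    qed
    moreover have "(\<lambda>x. if x \<in> ?G then lim (\<lambda>n. q n x) else (SOME D. False)) \<in> borel_measurable borel"
      using line_differentiable_borel[OF cont, of ?e] qm by (intro measurable_If_set borel_measurable_lim_metric) auto
    ultimately show ?thesis by presburger
  qed
  show ?thesis
    unfolding borel_measurable_euclidean_space[of "grad \<phi>"]
    using comp by (auto simp: Basis_vec_def inner_axis)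
qed

lemma norm_has_grad_le:
  fixes \<phi> :: "real ^ 'n \<Rightarrow> real"
  assumes lip: "L-lipschitz_on UNIV \<phi>" and D: "has_grad \<phi> D x"
  shows "norm D \<le> real CARD('n) * L"
proof -
  have "\<bar>D $ i\<bar> \<le> L" for i
  proof (rule tendsto_upperbound)
    show "((\<lambda>h. \<bar>(\<phi> (x + h *\<^sub>R axis i 1) - \<phi> x) / h\<bar>) \<longlongrightarrow> \<bar>D $ i\<bar>) (at 0)"
      using D unfolding has_grad_def DERIV_def by (intro tendsto_rabs) simp
    show "\<forall>\<^sub>F h in at 0. \<bar>(\<phi> (x + h *\<^sub>R axis i 1) - \<phi> x) / h\<bar> \<le> L"
    proof (rule eventually_at_filter[THEN iffD2], rule always_eventually, intro allI impI)
      fix h :: real assume h: "h \<noteq> 0"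
      have "\<bar>\<phi> (x + h *\<^sub>R axis i 1) - \<phi> x\<bar> \<le> L * \<bar>h\<bar>"
        using lipschitz_onD[OF lip, of "x + h *\<^sub>R axis i 1" x] by (simp add: dist_norm)
      then show "\<bar>(\<phi> (x + h *\<^sub>R axis i 1) - \<phi> x) / h\<bar> \<le> L" using h by (simp add: field_simps)
    qed
  qed simp
  then have "(\<Sum>i\<in>UNIV. \<bar>D $ i\<bar>) \<le> real CARD('n) * L"
    using sum_bounded_above[of UNIV "\<lambda>i. \<bar>D $ i\<bar>" L] by simp
  then show ?thesis using norm_le_l1_cart[of D] by linarith
qed

section \<open>Lipschitz functions with compact support\<close>

lemma Lip0_I:
  assumes "L-lipschitz_on UNIV \<phi>" "\<psi> \<in> Lip0 \<Omega>" "\<And>x. \<phi> x \<noteq> 0 \<Longrightarrow> \<psi> x \<noteq> 0"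
  shows "\<phi> \<in> Lip0 \<Omega>"
proof -
  have "closure {x. \<phi> x \<noteq> 0} \<subseteq> closure {x. \<psi> x \<noteq> 0}" using assms(3) by (intro closure_mono) auto
  moreover have "compact (closure {x. \<phi> x \<noteq> 0})"
  proof -
    have "bounded (closure {x. \<psi> x \<noteq> 0})"
      using assms(2) unfolding Lip0_def by (auto intro: compact_imp_bounded)
    then show ?thesis using calculation by (simp add: compact_eq_bounded_closed bounded_subset)
  qed
  ultimately show ?thesis using assms(1,2) unfolding Lip0_def by blast
qed

lemma Lip0_zero: "(\<lambda>x. 0) \<in> Lip0 \<Omega>"
  unfolding Lip0_def by (auto intro!: exI[of _ 0] lipschitz_onI)

lemma Lip0_combination:
  assumes u: "u \<in> Lip0 \<Omega>" and w: "w \<in> Lip0 \<Omega>"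
  shows "(\<lambda>x. a * u x + w x) \<in> Lip0 \<Omega>"
proof -
  obtain K L where K: "K-lipschitz_on UNIV u" and L: "L-lipschitz_on UNIV w"
    using u w unfolding Lip0_def by blast
  have lip: "(\<bar>a\<bar> * K + L)-lipschitz_on UNIV (\<lambda>x. a * u x + w x)"
    using lipschitz_on_add[OF lipschitz_on_cmult_real[OF K] L] by simp
  have "{x. a * u x + w x \<noteq> 0} \<subseteq> {x. u x \<noteq> 0} \<union> {x. w x \<noteq> 0}" by auto
  then have "closure {x. a * u x + w x \<noteq> 0} \<subseteq> closure ({x. u x \<noteq> 0} \<union> {x. w x \<noteq> 0})"
    by (rule closure_mono)
  then have sub: "closure {x. a * u x + w x \<noteq> 0} \<subseteq> closure {x. u x \<noteq> 0} \<union> closure {x. w x \<noteq> 0}"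
    by (simp add: closure_Un)
  have "bounded (closure {x. u x \<noteq> 0} \<union> closure {x. w x \<noteq> 0})"
    using u w unfolding Lip0_def by (auto intro: compact_imp_bounded)
  then have "bounded (closure {x. a * u x + w x \<noteq> 0})" using sub by (rule bounded_subset)
  then have "compact (closure {x. a * u x + w x \<noteq> 0})" by (simp add: compact_eq_bounded_closed)
  then show ?thesis using lip sub u w unfolding Lip0_def by blast
qed

lemma Lip0_lipschitz: "\<phi> \<in> Lip0 \<Omega> \<Longrightarrow> \<exists>L. L-lipschitz_on UNIV \<phi>"
  unfolding Lip0_def by blast

lemma Lip0_continuous: "\<phi> \<in> Lip0 \<Omega> \<Longrightarrow> continuous_on UNIV \<phi>"
  using Lip0_lipschitz lipschitz_on_continuous_on by blast

lemma Lip0_bounded: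
  assumes "\<phi> \<in> Lip0 \<Omega>"
  shows "\<exists>M\<ge>0. \<forall>x. \<bar>\<phi> x\<bar> \<le> M"
proof -
  let ?K = "closure {x. \<phi> x \<noteq> 0}"
  have "compact (\<phi> ` ?K)"
    using assms Lip0_continuous[OF assms] unfolding Lip0_def
    by (auto intro!: compact_continuous_image elim: continuous_on_subset)
  then obtain M where M: "\<And>x. x \<in> ?K \<Longrightarrow> \<bar>\<phi> x\<bar> \<le> M"
    using compact_imp_bounded bounded_iff by (metis imageI real_norm_def)
  have "\<bar>\<phi> x\<bar> \<le> max 0 M" for x
  proof (cases "\<phi> x = 0")
    case False
    then have "x \<in> ?K" using closure_subset[of "{x. \<phi> x \<noteq> 0}"] by auto
    then show ?thesis using M[of x] by simp
  qed simp
  then show ?thesis by (intro exI[of _ "max 0 M"]) auto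
qed

lemma Lip0_compose:
  assumes u: "u \<in> Lip0 \<Omega>" and F: "\<And>s. (F has_real_derivative F' s) (at s)"
    and F': "continuous_on UNIV F'" and F0: "F 0 = 0"
  shows "(\<lambda>x. F (u x)) \<in> Lip0 \<Omega>"
proof -
  obtain M where M: "0 \<le> M" "\<And>x. \<bar>u x\<bar> \<le> M" using Lip0_bounded[OF u] by blast
  obtain L where L: "L-lipschitz_on UNIV u" using Lip0_lipschitz[OF u] by blast
  have "compact (F' ` {-M..M})"
    by (intro compact_continuous_image continuous_on_subset[OF F']) auto
  then obtain B where B: "\<And>s. s \<in> {-M..M} \<Longrightarrow> \<bar>F' s\<bar> \<le> B"
    using compact_imp_bounded bounded_iff by (metis imageI real_norm_def)
  have B0: "0 \<le> B" using B[of 0] M(1) by force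
  have "(B * L)-lipschitz_on UNIV (\<lambda>x. F (u x))"
  proof (rule lipschitz_onI)
    fix x y
    have "norm (F (u x) - F (u y)) \<le> B * norm (u x - u y)"
    proof (rule field_differentiable_bound[of "{-M..M}"])
      show "(F has_field_derivative F' z) (at z within {-M..M})" for z
        using F by (rule has_field_derivative_at_within)
    qed (use B M in \<open>auto simp: abs_le_iff minus_le_iff\<close>)
    also have "\<dots> \<le> B * (L * dist x y)"
      using lipschitz_onD[OF L, of x y] B0 by (intro mult_left_mono) (auto simp: dist_norm)
    finally show "dist (F (u x)) (F (u y)) \<le> B * L * dist x y" by (simp add: dist_norm mult.assoc)
  qed (use B0 lipschitz_on_nonneg[OF L] in simp)
  then show ?thesis using u by (rule Lip0_I) (use F0 in auto)
qed

lemma grad_combination_ae: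
  assumes "u \<in> Lip0 \<Omega>" "w \<in> Lip0 \<Omega>"
  shows "AE x in lborel. grad (\<lambda>x. a * u x + w x) x = a *\<^sub>R grad u x + grad w x"
proof -
  obtain K L where K: "K-lipschitz_on UNIV u" and L: "L-lipschitz_on UNIV w"
    using assms Lip0_lipschitz by metis
  show ?thesis using lipschitz_has_grad_ae[OF K] lipschitz_has_grad_ae[OF L]
    by eventually_elim (intro grad_eqI has_grad_combination)
qed

lemma grad_compose_ae:
  assumes u: "u \<in> Lip0 \<Omega>" and F: "\<And>s. (F has_real_derivative F' s) (at s)"
  shows "AE x in lborel. grad (\<lambda>x. F (u x)) x = F' (u x) *\<^sub>R grad u x"
proof -
  obtain K where K: "K-lipschitz_on UNIV u" using u Lip0_lipschitz by metis
  show ?thesis using lipschitz_has_grad_ae[OF K]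
    by eventually_elim (intro grad_eqI has_grad_compose F)
qed

lemma grad_bounded_ae:
  assumes "u \<in> Lip0 \<Omega>"
  shows "\<exists>M. AE x in lborel. norm (grad u x) \<le> M"
proof -
  obtain K where K: "K-lipschitz_on UNIV u" using assms Lip0_lipschitz by metis
  show ?thesis using lipschitz_has_grad_ae[OF K] norm_has_grad_le[OF K] by (blast intro: eventually_mono)
qed

section \<open>Continuation of solvability in a semi-inner product space\<close>

text \<open>
  The operation \<open>comb a u w\<close> stands for \<open>a u + w\<close>. The form may vanish on nonzero elements and the space
  may be incomplete; solvability is therefore phrased approximately, with an error that is small in the
  dual norm.
\<close>

locale semi_inner_space =
  fixes D :: "'a set" and comb :: "real \<Rightarrow> 'a \<Rightarrow> 'a \<Rightarrow> 'a" and ip :: "'a \<Rightarrow> 'a \<Rightarrow> real"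
  assumes D_nonempty: "D \<noteq> {}"
    and comb_D: "u \<in> D \<Longrightarrow> w \<in> D \<Longrightarrow> comb a u w \<in> D"
    and ip_comb: "u \<in> D \<Longrightarrow> w \<in> D \<Longrightarrow> z \<in> D \<Longrightarrow> ip (comb a u w) z = a * ip u z + ip w z"
    and ip_commute: "u \<in> D \<Longrightarrow> w \<in> D \<Longrightarrow> ip u w = ip w u"
    and ip_ge_0: "u \<in> D \<Longrightarrow> 0 \<le> ip u u"
begin

definition N :: "'a \<Rightarrow> real" where
  "N u = sqrt (ip u u)"

definition functional :: "('a \<Rightarrow> real) \<Rightarrow> real \<Rightarrow> bool" where
  "functional F C \<longleftrightarrow> (\<forall>u\<in>D. \<bar>F u\<bar> \<le> C * N u) \<and>
     (\<forall>u\<in>D. \<forall>w\<in>D. \<forall>a. F (comb a u w) = a * F u + F w)"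

definition form :: "('a \<Rightarrow> 'a \<Rightarrow> real) \<Rightarrow> real \<Rightarrow> bool" where
  "form B K \<longleftrightarrow> (\<forall>u\<in>D. \<forall>z\<in>D. \<bar>B u z\<bar> \<le> K * N u * N z) \<and>
     (\<forall>u\<in>D. \<forall>w\<in>D. \<forall>z\<in>D. \<forall>a. B (comb a u w) z = a * B u z + B w z \<and>
        B z (comb a u w) = a * B z u + B z w)"

definition solvable :: "('a \<Rightarrow> 'a \<Rightarrow> real) \<Rightarrow> bool" where
  "solvable B \<longleftrightarrow> (\<forall>F C \<eta>. functional F C \<longrightarrow> 0 < \<eta> \<longrightarrow>
     (\<exists>u\<in>D. \<forall>z\<in>D. \<bar>B u z - F z\<bar> \<le> \<eta> * N z))"

text \<open>
  The lower bound \<open>\<kappa> N u \<le> sup {|B u z| : N z \<le> 1}\<close>.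
\<close>

definition bounded_below :: "('a \<Rightarrow> 'a \<Rightarrow> real) \<Rightarrow> real \<Rightarrow> bool" where
  "bounded_below B \<kappa> \<longleftrightarrow> (\<forall>u\<in>D. \<forall>\<delta>\<ge>0. (\<forall>z\<in>D. \<bar>B u z\<bar> \<le> \<delta> * N z) \<longrightarrow> \<kappa> * N u \<le> \<delta>)"

lemma bounded_below_cong:
  assumes "\<And>u z. u \<in> D \<Longrightarrow> z \<in> D \<Longrightarrow> B u z = B' u z"
  shows "bounded_below B \<kappa> = bounded_below B' \<kappa>"
proof -
  have "(\<forall>z\<in>D. \<bar>B u z\<bar> \<le> \<delta> * N z) = (\<forall>z\<in>D. \<bar>B' u z\<bar> \<le> \<delta> * N z)" if "u \<in> D" for u \<delta>
    using assms[OF that] by (intro ball_cong) auto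
  then show ?thesis unfolding bounded_below_def by (intro ball_cong) auto
qed

lemma solvable_cong:
  assumes "\<And>u z. u \<in> D \<Longrightarrow> z \<in> D \<Longrightarrow> B u z = B' u z"
  shows "solvable B = solvable B'"
proof -
  have "(\<exists>u\<in>D. \<forall>z\<in>D. \<bar>B u z - F z\<bar> \<le> \<eta> * N z) = (\<exists>u\<in>D. \<forall>z\<in>D. \<bar>B' u z - F z\<bar> \<le> \<eta> * N z)" for F \<eta>
    using assms by (intro bex_cong ball_cong) auto
  then show ?thesis unfolding solvable_def by simp
qed

lemma N_ge_0: "u \<in> D \<Longrightarrow> 0 \<le> N u"
  by (simp add: N_def ip_ge_0)

lemma N_power2: "u \<in> D \<Longrightarrow> (N u)\<^sup>2 = ip u u"
  by (simp add: N_def ip_ge_0)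

lemma ip_comb_right: "u \<in> D \<Longrightarrow> w \<in> D \<Longrightarrow> z \<in> D \<Longrightarrow> ip z (comb a u w) = a * ip z u + ip z w"
  using ip_comb[of u w z a] by (simp add: ip_commute comb_D)

lemma ip_comb_self:
  assumes "u \<in> D" "w \<in> D"
  shows "ip (comb a u w) (comb a u w) = a\<^sup>2 * ip u u + 2 * a * ip w u + ip w w"
  using assms by (simp add: ip_comb ip_comb_right comb_D ip_commute[of u w] power2_eq_square algebra_simps)

lemma Cauchy_Schwarz:
  assumes u: "u \<in> D" and w: "w \<in> D"
  shows "\<bar>ip u w\<bar> \<le> N u * N w"
proof -
  have q: "0 \<le> a\<^sup>2 * ip u u + 2 * a * ip w u + ip w w" for a
    using ip_ge_0[of "comb a u w"] ip_comb_self[OF u w, of a] comb_D[OF u w] by simp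
  have "(ip w u)\<^sup>2 \<le> ip u u * ip w w"
  proof (cases "ip u u = 0")
    case True
    have "ip w u = 0"
    proof (rule ccontr)
      assume n: "ip w u \<noteq> 0"
      show False using q[of "- (ip w w + 1) / ip w u"] n True ip_ge_0[OF w] by simp
    qed
    then show ?thesis using True by simp
  next
    case False
    then have pos: "ip u u > 0" using ip_ge_0[OF u] by simp
    have "0 \<le> (- ip w u / ip u u)\<^sup>2 * ip u u + 2 * (- ip w u / ip u u) * ip w u + ip w w" by (rule q)
    also have "\<dots> = ip w w - (ip w u)\<^sup>2 / ip u u"
      using pos by (simp add: power2_eq_square field_simps)
    finally show ?thesis using pos by (simp add: field_simps)
  qed
  then have "sqrt ((ip w u)\<^sup>2) \<le> sqrt (ip u u * ip w w)" by (rule real_sqrt_le_mono)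
  then show ?thesis by (simp add: N_def real_sqrt_mult ip_commute[OF u w])
qed

lemma N_triangle:
  assumes u: "u \<in> D" and w: "w \<in> D"
  shows "N (comb a u w) \<le> \<bar>a\<bar> * N u + N w"
proof -
  have "(N (comb a u w))\<^sup>2 = a\<^sup>2 * (N u)\<^sup>2 + 2 * a * ip w u + (N w)\<^sup>2"
    using ip_comb_self[OF u w] by (simp add: N_power2 u w comb_D)
  also have "2 * a * ip w u \<le> 2 * \<bar>a\<bar> * (N w * N u)"
  proof -
    have "a * ip w u \<le> \<bar>a\<bar> * \<bar>ip w u\<bar>" by (metis abs_ge_self abs_mult)
    also have "\<dots> \<le> \<bar>a\<bar> * (N w * N u)" using Cauchy_Schwarz[OF w u] by (intro mult_left_mono) auto
    finally show ?thesis by simp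
  qed
  also have "a\<^sup>2 * (N u)\<^sup>2 + 2 * \<bar>a\<bar> * (N w * N u) + (N w)\<^sup>2 = (\<bar>a\<bar> * N u + N w)\<^sup>2"
    by (simp add: power2_sum power_mult_distrib algebra_simps)
  finally show ?thesis
    by (rule power2_le_imp_le) (auto intro!: add_nonneg_nonneg mult_nonneg_nonneg N_ge_0 u w)
qed

lemma form_ip: "form ip 1"
  unfolding form_def using Cauchy_Schwarz by (simp add: ip_comb ip_comb_right)

lemma form_flip: "form B K \<Longrightarrow> form (\<lambda>u z. B z u) K"
proof -
  assume B: "form B K"
  have "\<bar>B z u\<bar> \<le> K * N u * N z" if "u \<in> D" "z \<in> D" for u z
    using B that unfolding form_def by (metis mult.assoc mult.commute)
  then show ?thesis using B unfolding form_def by blast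
qed

lemma form_add:
  assumes "form B K" "form R L"
  shows "form (\<lambda>u z. B u z + t * R u z) (K + \<bar>t\<bar> * L)"
proof -
  have "\<bar>B u z + t * R u z\<bar> \<le> (K + \<bar>t\<bar> * L) * N u * N z" if "u \<in> D" "z \<in> D" for u z
  proof -
    have "\<bar>B u z + t * R u z\<bar> \<le> \<bar>B u z\<bar> + \<bar>t\<bar> * \<bar>R u z\<bar>"
      by (metis abs_mult abs_triangle_ineq)
    also have "\<dots> \<le> K * N u * N z + \<bar>t\<bar> * (L * N u * N z)"
      using assms that unfolding form_def by (intro add_mono mult_left_mono) auto
    finally show ?thesis by (simp add: algebra_simps)
  qed
  then show ?thesis using assms unfolding form_def by (simp add: algebra_simps)
qed

lemma residual_functional:
  assumes "form B K" "functional F C" "u \<in> D" "\<And>z. z \<in> D \<Longrightarrow> \<bar>B u z - F z\<bar> \<le> c * N z"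
  shows "functional (\<lambda>z. F z - B u z) c"
  using assms unfolding functional_def form_def
  by (auto simp: abs_minus_commute algebra_simps)

text \<open>
  An almost minimiser of \<open>N u\<^sup>2 / 2 - F u\<close> almost represents \<open>F\<close>.
\<close>

lemma approximate_Riesz: "solvable ip"
  unfolding solvable_def
proof (intro allI impI)
  fix F C and \<eta> :: real
  assume F: "functional F C" and \<eta>: "0 < \<eta>"
  define J where "J u = ip u u / 2 - F u" for u
  have "- (C\<^sup>2 / 2) \<le> J u" if "u \<in> D" for u
  proof -
    have "F u \<le> C * N u" using F that unfolding functional_def by force
    moreover have "0 \<le> (N u - C)\<^sup>2" by simp
    then have "2 * (C * N u) \<le> (N u)\<^sup>2 + C\<^sup>2" by (simp add: power2_diff algebra_simps)
    ultimately show ?thesis unfolding J_def using N_power2[OF that] by linarith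
  qed
  then have bdd: "bdd_below (J ` D)" by (intro bdd_belowI2)
  define m where "m = (INF u\<in>D. J u)"
  have m_le: "m \<le> J u" if "u \<in> D" for u unfolding m_def using bdd that by (rule cINF_lower)
  have "\<exists>u\<in>D. J u < m + \<eta>\<^sup>2 / 2"
  proof -
    have "m < m + \<eta>\<^sup>2 / 2" using \<eta> by simp
    then show ?thesis unfolding m_def using cINF_less_iff[OF D_nonempty bdd] by blast
  qed
  then obtain u where u: "u \<in> D" and Ju: "J u < m + \<eta>\<^sup>2 / 2" by blast
  have "\<bar>ip u z - F z\<bar> \<le> \<eta> * N z" if z: "z \<in> D" for z
  proof -
    define r where "r = ip u z - F z"
    have q: "0 \<le> \<eta>\<^sup>2 / 2 + a * r + a\<^sup>2 * ip z z / 2" for a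
    proof -
      have "m \<le> J (comb a z u)" using comb_D[OF z u] by (rule m_le)
      also have "\<dots> = J u + a * r + a\<^sup>2 * ip z z / 2"
        using F z u unfolding J_def functional_def r_def
        by (simp add: ip_comb_self algebra_simps add_divide_distrib)
      finally show ?thesis using Ju by linarith
    qed
    show ?thesis
    proof (cases "ip z z = 0")
      case True
      have "r = 0"
      proof (rule ccontr)
        assume "r \<noteq> 0"
        then have "- (\<eta>\<^sup>2 + 1) / r * r = - (\<eta>\<^sup>2 + 1)" by simp
        then show False using q[of "- (\<eta>\<^sup>2 + 1) / r"] True zero_le_power2[of \<eta>] by simp
      qed
      then show ?thesis using \<eta> N_ge_0[OF z] r_def by simp
    next
      case False
      then have pos: "ip z z > 0" using ip_ge_0[OF z] by simp
      have "0 \<le> \<eta>\<^sup>2 / 2 + (- r / ip z z) * r + (- r / ip z z)\<^sup>2 * ip z z / 2" by (rule q)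
      also have "\<dots> = \<eta>\<^sup>2 / 2 - r\<^sup>2 / ip z z / 2"
        using pos by (simp add: power2_eq_square field_simps)
      finally have "r\<^sup>2 \<le> \<eta>\<^sup>2 * ip z z" using pos by (simp add: field_simps)
      then have "r\<^sup>2 \<le> (\<eta> * N z)\<^sup>2" by (simp add: power_mult_distrib N_power2 z)
      then have "\<bar>r\<bar> \<le> \<eta> * N z"
        using \<eta> N_ge_0[OF z] by (auto intro: power2_le_imp_le[of "\<bar>r\<bar>"])
      then show ?thesis by (simp add: r_def)
    qed
  qed
  with u show "\<exists>u\<in>D. \<forall>z\<in>D. \<bar>ip u z - F z\<bar> \<le> \<eta> * N z" by blast
qed

text \<open>
  Solve with \<open>B\<close> for the residual of the perturbed equation. The correction is controlled by the lower
  bound, so that each such step at least halves the residual.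
\<close>

lemma solvable_perturbation:
  assumes B: "form B K" "solvable B" "bounded_below B \<kappa>" "0 < \<kappa>"
    and R: "form R L" and small: "\<bar>t\<bar> * L \<le> \<kappa> / 4"
  shows "solvable (\<lambda>u z. B u z + t * R u z)"
  unfolding solvable_def
proof (intro allI impI)
  fix F C and \<eta> :: real
  assume F: "functional F C" and \<eta>: "0 < \<eta>"
  let ?B = "\<lambda>u z. B u z + t * R u z"
  have fB: "form ?B (K + \<bar>t\<bar> * L)" using B(1) R by (rule form_add)
  define c where "c n = (\<bar>C\<bar> + 1) / 2 ^ n" for n :: nat
  have c_pos: "c n > 0" for n unfolding c_def by simp
  have step: "\<exists>u\<in>D. \<forall>z\<in>D. \<bar>?B u z - F z\<bar> \<le> c n * N z" for n
  proof (induction n)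
    case 0
    obtain u\<^sub>0 where u\<^sub>0: "u\<^sub>0 \<in> D" using D_nonempty by blast
    let ?o = "comb (-1) u\<^sub>0 u\<^sub>0"
    have "\<bar>?B ?o z - F z\<bar> \<le> c 0 * N z" if z: "z \<in> D" for z
    proof -
      have "?B ?o z = 0" using B(1) R u\<^sub>0 z unfolding form_def by simp
      moreover have "\<bar>F z\<bar> \<le> C * N z" using F z unfolding functional_def by blast
      moreover have "C * N z \<le> c 0 * N z" unfolding c_def using N_ge_0[OF z]
        by (intro mult_right_mono) auto
      ultimately show ?thesis by simp
    qed
    then show ?case using comb_D[OF u\<^sub>0 u\<^sub>0] by blast
  next
    case (Suc n)
    then obtain u where u: "u \<in> D" and res: "\<And>z. z \<in> D \<Longrightarrow> \<bar>?B u z - F z\<bar> \<le> c n * N z" by blast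
    have F': "functional (\<lambda>z. F z - ?B u z) (c n)"
      using fB F u res by (rule residual_functional)
    have c8: "0 < c n / 8" using c_pos[of n] by simp
    obtain w where w: "w \<in> D" and wz: "\<And>z. z \<in> D \<Longrightarrow> \<bar>B w z - (F z - ?B u z)\<bar> \<le> c n / 8 * N z"
      using B(2)[unfolded solvable_def, rule_format, OF F' c8] by blast
    have "\<bar>B w z\<bar> \<le> (9 * c n / 8) * N z" if z: "z \<in> D" for z
      using abs_triangle_ineq[of "F z - ?B u z" "B w z - (F z - ?B u z)"] res[OF z] wz[OF z] by linarith
    then have Nw: "\<kappa> * N w \<le> 9 * c n / 8"
      using B(3)[unfolded bounded_below_def, rule_format, OF w, of "9 * c n / 8"] c_pos[of n] by simp
    have "\<bar>?B (comb 1 u w) z - F z\<bar> \<le> c (Suc n) * N z" if z: "z \<in> D" for z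
    proof -
      have "?B (comb 1 u w) z = ?B u z + B w z + t * R w z"
        using B(1) R u w z unfolding form_def by (simp add: algebra_simps)
      then have "\<bar>?B (comb 1 u w) z - F z\<bar> \<le> \<bar>B w z - (F z - ?B u z)\<bar> + \<bar>t * R w z\<bar>" by linarith
      also have "\<dots> \<le> c n / 8 * N z + \<bar>t\<bar> * (L * N w * N z)"
        using wz[OF z] R w z unfolding form_def by (intro add_mono) (auto simp: abs_mult intro: mult_left_mono)
      also have "\<bar>t\<bar> * (L * N w * N z) \<le> \<kappa> / 4 * (N w * N z)"
        using mult_right_mono[OF small, of "N w * N z"] N_ge_0[OF w] N_ge_0[OF z]
        by (simp add: mult.assoc)
      also have "\<dots> = (\<kappa> * N w) / 4 * N z" by simp
      also have "\<dots> \<le> (9 * c n / 8) / 4 * N z"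
        using Nw N_ge_0[OF z] by (intro mult_right_mono divide_right_mono) auto
      also have "c n / 8 * N z + (9 * c n / 8) / 4 * N z = 13 / 32 * (c n * N z)"
        by (simp add: algebra_simps)
      also have "\<dots> \<le> 1 / 2 * (c n * N z)"
        using c_pos[of n] N_ge_0[OF z] by (intro mult_right_mono) auto
      also have "\<dots> = c (Suc n) * N z" unfolding c_def by simp
      finally show ?thesis by simp
    qed
    then show ?case using comb_D[OF u w] by blast
  qed
  obtain n where n: "(\<bar>C\<bar> + 1) / \<eta> < 2 ^ n" using real_arch_pow[of 2] by auto
  then have "c n \<le> \<eta>" unfolding c_def using \<eta> by (simp add: field_simps)
  obtain u where u: "u \<in> D" and r: "\<And>z. z \<in> D \<Longrightarrow> \<bar>?B u z - F z\<bar> \<le> c n * N z"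
    using step[of n] by blast
  have "\<bar>?B u z - F z\<bar> \<le> \<eta> * N z" if z: "z \<in> D" for z
    using r[OF z] mult_right_mono[OF \<open>c n \<le> \<eta>\<close> N_ge_0[OF z]] by linarith
  with u show "\<exists>u\<in>D. \<forall>z\<in>D. \<bar>?B u z - F z\<bar> \<le> \<eta> * N z" by blast
qed

text \<open>
  The step size allowed by \<open>solvable_perturbation\<close> depends on \<open>\<kappa>\<close> and \<open>L\<close> only, so finitely many steps
  lead from \<open>t = 0\<close> to \<open>t = 1\<close>.
\<close>

lemma solvable_continuation:
  assumes R: "form R L" and \<kappa>: "0 < \<kappa>"
    and below: "\<And>t. 0 \<le> t \<Longrightarrow> t \<le> 1 \<Longrightarrow> bounded_below (\<lambda>u z. ip u z + t * R u z) \<kappa>"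
  shows "solvable (\<lambda>u z. ip u z + R u z)"
proof -
  obtain n :: nat where n: "4 * \<bar>L\<bar> / \<kappa> < n" using reals_Archimedean2 by blast
  have "0 \<le> 4 * \<bar>L\<bar> / \<kappa>" using \<kappa> by simp
  then have n0: "0 < real n" using n by linarith
  have "solvable (\<lambda>u z. ip u z + (real k / real n) * R u z)" if "k \<le> n" for k
    using that
  proof (induction k)
    case 0
    then show ?case using approximate_Riesz by simp
  next
    case (Suc k)
    have "solvable (\<lambda>u z. (ip u z + (real k / real n) * R u z) + (1 / real n) * R u z)"
    proof (rule solvable_perturbation[OF form_add[OF form_ip R] _ _ \<kappa> R])
      show "solvable (\<lambda>u z. ip u z + (real k / real n) * R u z)" using Suc by simp
      show "bounded_below (\<lambda>u z. ip u z + (real k / real n) * R u z) \<kappa>"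
        using Suc.prems by (intro below) (auto simp: divide_simps)
      have "\<bar>L\<bar> / n \<le> \<kappa> / 4" using n n0 \<kappa> by (simp add: field_simps)
      moreover have "L / n \<le> \<bar>L\<bar> / n" using n0 by (simp add: divide_right_mono)
      ultimately show "\<bar>1 / real n\<bar> * L \<le> \<kappa> / 4" by simp
    qed
    moreover have "(\<lambda>u z. (ip u z + (real k / real n) * R u z) + (1 / real n) * R u z)
        = (\<lambda>u z. ip u z + (real (Suc k) / real n) * R u z)"
      using n0 by (simp add: fun_eq_iff field_simps)
    ultimately show ?case by simp
  qed
  from this[of n] show ?thesis using n0 by simp
qed

text \<open>
  Duality: solve the adjoint equation with right-hand side \<open>ip u\<close>; the solution \<open>w\<close> has norm at most about
  \<open>N u / \<kappa>\<close>, and testing with it gives \<open>N u\<^sup>2 \<approx> B u w \<le> \<delta> N w\<close>.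
\<close>

lemma bounded_below_of_adjoint:
  assumes B: "form B K" and s: "solvable (\<lambda>u z. B z u)" and b: "bounded_below (\<lambda>u z. B z u) \<kappa>"
    and \<kappa>: "0 < \<kappa>"
  shows "bounded_below B \<kappa>"
  unfolding bounded_below_def
proof (intro ballI allI impI)
  fix u and \<delta> :: real
  assume u: "u \<in> D" and \<delta>: "0 \<le> \<delta>" and le: "\<forall>z\<in>D. \<bar>B u z\<bar> \<le> \<delta> * N z"
  have F: "functional (\<lambda>z. ip u z) (N u)"
    unfolding functional_def by (intro conjI ballI allI Cauchy_Schwarz ip_comb_right u)
  have *: "\<kappa> * (N u)\<^sup>2 \<le> \<delta> * N u + \<eta> * (\<delta> + \<kappa> * N u)" if \<eta>: "0 < \<eta>" for \<eta>
  proof -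
    obtain w where w: "w \<in> D" and wz: "\<And>z. z \<in> D \<Longrightarrow> \<bar>B z w - ip u z\<bar> \<le> \<eta> * N z"
      using s[unfolded solvable_def, rule_format, OF F \<eta>] by blast
    have "\<bar>B z w\<bar> \<le> (N u + \<eta>) * N z" if z: "z \<in> D" for z
      using wz[OF z] Cauchy_Schwarz[OF u z] by (simp add: algebra_simps)
    then have Nw: "\<kappa> * N w \<le> N u + \<eta>"
      using b w \<eta> N_ge_0[OF u] unfolding bounded_below_def by auto
    have "(N u)\<^sup>2 \<le> \<bar>B u w\<bar> + \<eta> * N u" using wz[OF u] N_power2[OF u] by linarith
    also have "\<bar>B u w\<bar> \<le> \<delta> * N w" using le w by blast
    finally have "\<kappa> * (N u)\<^sup>2 \<le> \<kappa> * (\<delta> * N w + \<eta> * N u)"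
      using \<kappa> by (intro mult_left_mono) auto
    also have "\<dots> = \<delta> * (\<kappa> * N w) + \<eta> * (\<kappa> * N u)" by (simp add: algebra_simps)
    also have "\<dots> \<le> \<delta> * (N u + \<eta>) + \<eta> * (\<kappa> * N u)"
      using Nw \<delta> by (intro add_right_mono mult_left_mono)
    finally show ?thesis by (simp add: algebra_simps)
  qed
  have "\<kappa> * (N u)\<^sup>2 \<le> \<delta> * N u"
  proof (rule field_le_epsilon)
    fix e :: real assume e: "0 < e"
    define M where "M = \<delta> + \<kappa> * N u + 1"
    have M: "M > 0" unfolding M_def using \<delta> \<kappa> N_ge_0[OF u] by (simp add: add_nonneg_pos)
    have "\<kappa> * (N u)\<^sup>2 \<le> \<delta> * N u + (e / M) * (\<delta> + \<kappa> * N u)" using e M by (intro *) simp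
    also have "\<dots> \<le> \<delta> * N u + (e / M) * M"
      using e M by (intro add_left_mono mult_left_mono) (auto simp: M_def)
    finally show "\<kappa> * (N u)\<^sup>2 \<le> \<delta> * N u + e" using M by simp
  qed
  then show "\<kappa> * N u \<le> \<delta>"
    using N_ge_0[OF u] \<delta> \<kappa>
    by (cases "N u = 0") (auto simp: power2_eq_square mult.assoc[symmetric])
qed

text \<open>
  Continuation for the adjoint forms makes them solvable for each \<open>t\<close>, hence the forms themselves are
  bounded below with the same constant, and continuation applies to them in turn.
\<close>

theorem solvable_of_adjoint_bounded_below:
  assumes R: "form R L" and \<kappa>: "0 < \<kappa>"
    and below: "\<And>t. 0 \<le> t \<Longrightarrow> t \<le> 1 \<Longrightarrow> bounded_below (\<lambda>u z. ip z u + t * R z u) \<kappa>"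
  shows "solvable (\<lambda>u z. ip u z + R u z)" and "bounded_below (\<lambda>u z. ip u z + R u z) \<kappa>"
proof -
  have cong: "bounded_below (\<lambda>u z. ip z u + t * R z u) \<kappa> = bounded_below (\<lambda>u z. ip u z + t * R z u) \<kappa>" for t
    by (rule bounded_below_cong) (simp add: ip_commute)
  have cong2: "solvable (\<lambda>u z. ip z u + t * R z u) = solvable (\<lambda>u z. ip u z + t * R z u)" for t
    by (rule solvable_cong) (simp add: ip_commute)
  have bb: "bounded_below (\<lambda>u z. ip u z + t * R u z) \<kappa>" if t: "0 \<le> t" "t \<le> 1" for t
  proof (rule bounded_below_of_adjoint[OF form_add[OF form_ip R] _ below[OF t] \<kappa>])
    have zero: "form (\<lambda>u z. 0) 0" unfolding form_def by simp
    have L: "form (\<lambda>u z. t * R z u) (\<bar>t\<bar> * L)"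
      using form_add[OF zero form_flip[OF R], of t] by simp
    have "solvable (\<lambda>u z. ip u z + t * R z u)"
    proof (rule solvable_continuation[OF L \<kappa>])
      fix s :: real assume s: "0 \<le> s" "s \<le> 1"
      have "bounded_below (\<lambda>u z. ip z u + (s * t) * R z u) \<kappa>"
        using s t by (intro below) (auto simp: mult_le_one)
      then show "bounded_below (\<lambda>u z. ip u z + s * (t * R z u)) \<kappa>"
        unfolding cong by (simp add: mult.assoc)
    qed
    then show "solvable (\<lambda>u z. ip z u + t * R z u)" unfolding cong2 .
  qed
  show "solvable (\<lambda>u z. ip u z + R u z)" using R \<kappa> bb by (rule solvable_continuation)
  show "bounded_below (\<lambda>u z. ip u z + R u z) \<kappa>" using bb[of 1] by simp
qed

end

section \<open>Square integrable sections of a field of quadratic forms\<close>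

text \<open>
  A measurable field of semi-inner products \<open>\<beta> x\<close>. Both \<open>L\<^sup>2(v)\<close>, with \<open>\<beta> x s t = s t v(x)\<close>, and \<open>QL\<^sup>2\<close>, with
  \<open>\<beta> x \<xi> \<eta> = Q(x) \<xi> \<bullet> \<eta>\<close>, are the spaces of square integrable sections of such a field.
\<close>

locale form_field =
  fixes M :: "'x measure" and \<beta> :: "'x \<Rightarrow> 'e::euclidean_space \<Rightarrow> 'e \<Rightarrow> real"
  assumes form_measurable: "\<And>f g. f \<in> borel_measurable M \<Longrightarrow> g \<in> borel_measurable M \<Longrightarrow>
        (\<lambda>x. \<beta> x (f x) (g x)) \<in> borel_measurable M"
    and form_bilinear: "\<And>x. x \<in> space M \<Longrightarrow> bounded_bilinear (\<beta> x)"
    and form_sym: "\<And>x \<xi> \<eta>. x \<in> space M \<Longrightarrow> \<beta> x \<xi> \<eta> = \<beta> x \<eta> \<xi>"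
    and form_nonneg: "\<And>x \<xi>. x \<in> space M \<Longrightarrow> 0 \<le> \<beta> x \<xi> \<xi>"
begin

definition E :: "('x \<Rightarrow> 'e) set" where
  "E = {f \<in> borel_measurable M. integrable M (\<lambda>x. \<beta> x (f x) (f x))}"

definition nrm :: "'x \<Rightarrow> 'e \<Rightarrow> real" where
  "nrm x \<xi> = sqrt (\<beta> x \<xi> \<xi>)"

lemma pointwise: "x \<in> space M \<Longrightarrow> semi_inner_space UNIV (\<lambda>a \<xi> \<eta>. a *\<^sub>R \<xi> + \<eta>) (\<beta> x)"
  using form_bilinear form_sym form_nonneg
  by unfold_locales
    (auto simp: bounded_bilinear.add_left bounded_bilinear.scaleR_left)

lemma nrm_semi: "x \<in> space M \<Longrightarrow> semi_inner_space.N (\<beta> x) \<xi> = nrm x \<xi>"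
  using semi_inner_space.N_def[OF pointwise] by (simp add: nrm_def)

lemma nrm_ge_0: "x \<in> space M \<Longrightarrow> 0 \<le> nrm x \<xi>"
  by (simp add: nrm_def form_nonneg)

lemma nrm_power2: "x \<in> space M \<Longrightarrow> (nrm x \<xi>)\<^sup>2 = \<beta> x \<xi> \<xi>"
  by (simp add: nrm_def form_nonneg)

lemma form_Cauchy_Schwarz: "x \<in> space M \<Longrightarrow> \<bar>\<beta> x \<xi> \<eta>\<bar> \<le> nrm x \<xi> * nrm x \<eta>"
  using semi_inner_space.Cauchy_Schwarz[OF pointwise, of x \<xi> \<eta>] by (simp add: nrm_semi)

lemma nrm_measurable: "f \<in> borel_measurable M \<Longrightarrow> (\<lambda>x. nrm x (f x)) \<in> borel_measurable M"
  unfolding nrm_def using form_measurable by simp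

lemma E_measurable: "f \<in> E \<Longrightarrow> f \<in> borel_measurable M"
  by (simp add: E_def)

lemma E_integrable: "f \<in> E \<Longrightarrow> integrable M (\<lambda>x. \<beta> x (f x) (f x))"
  by (simp add: E_def)

lemma E_integrable_nrm: "f \<in> E \<Longrightarrow> integrable M (\<lambda>x. (nrm x (f x))\<^sup>2)"
  using E_integrable[of f] by (simp add: nrm_power2 cong: Bochner_Integration.integrable_cong)

lemma form_integrable:
  assumes "f \<in> E" "g \<in> E"
  shows "integrable M (\<lambda>x. \<beta> x (f x) (g x))"
proof (rule Bochner_Integration.integrable_bound)
  show "integrable M (\<lambda>x. (nrm x (f x))\<^sup>2 + (nrm x (g x))\<^sup>2)"
    using assms E_integrable_nrm by simp
  show "(\<lambda>x. \<beta> x (f x) (g x)) \<in> borel_measurable M"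
    using assms E_measurable form_measurable by blast
  have "\<bar>\<beta> x (f x) (g x)\<bar> \<le> (nrm x (f x))\<^sup>2 + (nrm x (g x))\<^sup>2" if "x \<in> space M" for x
  proof -
    have "0 \<le> (nrm x (f x) - nrm x (g x))\<^sup>2 + (nrm x (f x))\<^sup>2 + (nrm x (g x))\<^sup>2" by simp
    then have "2 * (nrm x (f x) * nrm x (g x)) \<le> 2 * ((nrm x (f x))\<^sup>2 + (nrm x (g x))\<^sup>2)"
      by (simp add: power2_diff)
    then have "nrm x (f x) * nrm x (g x) \<le> (nrm x (f x))\<^sup>2 + (nrm x (g x))\<^sup>2" by simp
    with form_Cauchy_Schwarz[OF that] show ?thesis by (rule order.trans)
  qed
  then show "AE x in M. norm (\<beta> x (f x) (g x)) \<le> norm ((nrm x (f x))\<^sup>2 + (nrm x (g x))\<^sup>2)"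
    by (intro AE_I2) simp
qed

lemma form_combination:
  "x \<in> space M \<Longrightarrow> \<beta> x (a *\<^sub>R \<xi> + \<eta>) \<zeta> = a * \<beta> x \<xi> \<zeta> + \<beta> x \<eta> \<zeta>"
  using semi_inner_space.ip_comb[OF pointwise] by simp

lemma form_combination_self:
  "x \<in> space M \<Longrightarrow> \<beta> x (a *\<^sub>R \<xi> + \<eta>) (a *\<^sub>R \<xi> + \<eta>) = a\<^sup>2 * \<beta> x \<xi> \<xi> + 2 * a * \<beta> x \<eta> \<xi> + \<beta> x \<eta> \<eta>"
  using semi_inner_space.ip_comb_self[OF pointwise] by simp

lemma E_combination:
  assumes f: "f \<in> E" and g: "g \<in> E"
  shows "(\<lambda>x. a *\<^sub>R f x + g x) \<in> E"
proof -
  have "integrable M (\<lambda>x. a\<^sup>2 * \<beta> x (f x) (f x) + 2 * a * \<beta> x (g x) (f x) + \<beta> x (g x) (g x))"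
    using form_integrable f g by simp
  then have "integrable M (\<lambda>x. \<beta> x (a *\<^sub>R f x + g x) (a *\<^sub>R f x + g x))"
    by (simp add: form_combination_self cong: Bochner_Integration.integrable_cong)
  then show ?thesis using f g by (auto simp: E_def)
qed

definition ip :: "('x \<Rightarrow> 'e) \<Rightarrow> ('x \<Rightarrow> 'e) \<Rightarrow> real" where
  "ip f g = (LINT x|M. \<beta> x (f x) (g x))"

sublocale L2: semi_inner_space E "\<lambda>a f g x. a *\<^sub>R f x + g x" ip
proof
  have "(\<lambda>x. 0) \<in> E"
    by (auto simp: E_def bounded_bilinear.zero_left[OF form_bilinear] cong: Bochner_Integration.integrable_cong)
  then show "E \<noteq> {}" by blast
  show "(\<lambda>x. a *\<^sub>R f x + g x) \<in> E" if "f \<in> E" "g \<in> E" for f g a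
    using that by (rule E_combination)
  show "ip (\<lambda>x. a *\<^sub>R f x + g x) h = a * ip f h + ip g h" if "f \<in> E" "g \<in> E" "h \<in> E" for f g h a
  proof -
    have "ip (\<lambda>x. a *\<^sub>R f x + g x) h = (LINT x|M. a * \<beta> x (f x) (h x) + \<beta> x (g x) (h x))"
      unfolding ip_def by (intro Bochner_Integration.integral_cong) (auto simp: form_combination)
    then show ?thesis using form_integrable that by (simp add: ip_def)
  qed
  show "ip f g = ip g f" for f g
    unfolding ip_def using form_sym by (intro Bochner_Integration.integral_cong) auto
  show "0 \<le> ip f f" for f
    unfolding ip_def using form_nonneg by (intro integral_nonneg_AE AE_I2) auto
qed

lemma N_eq: "L2.N f = sqrt (LINT x|M. (nrm x (f x))\<^sup>2)"
  unfolding L2.N_def ip_def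
  by (intro arg_cong[where f = sqrt] Bochner_Integration.integral_cong) (auto simp: nrm_power2)

lemma N_power2_eq: "(L2.N f)\<^sup>2 = (LINT x|M. (nrm x (f x))\<^sup>2)"
  unfolding N_eq by simp

lemma nn_integral_nrm:
  assumes "f \<in> E"
  shows "(\<integral>\<^sup>+x. ennreal ((nrm x (f x))\<^sup>2) \<partial>M) = ennreal ((L2.N f)\<^sup>2)"
  unfolding N_power2_eq using E_integrable_nrm[OF assms] by (intro nn_integral_eq_integral) auto

text \<open>
  The Riesz-Fischer argument for a rapidly Cauchy sequence. Nondegeneracy of the forms converts
  summability of \<open>nrm x\<close> into convergence of the values; Fatou's lemma yields the rate.
\<close>

lemma complete:
  fixes f :: "nat \<Rightarrow> 'x \<Rightarrow> 'e"
  assumes fE: "\<And>j. f j \<in> E"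
    and Cauchy: "\<And>j k. j \<le> k \<Longrightarrow> L2.N (\<lambda>x. f k x - f j x) \<le> (1 / 4) ^ j"
    and nondegenerate: "AE x in M. \<exists>C. \<forall>\<xi>. norm \<xi> \<le> C * nrm x \<xi>"
  obtains g where "g \<in> E" "\<And>j. L2.N (\<lambda>x. f j x - g x) \<le> (1 / 4) ^ j"
proof -
  define w where "w j x = f (Suc j) x - f j x" for j x
  have diffE: "(\<lambda>x. f k x - f j x) \<in> E" for j k
    using E_combination[OF fE fE, of "-1" j k] by simp
  have wE: "w j \<in> E" for j unfolding w_def by (rule diffE)
  have wN: "L2.N (w j) \<le> (1 / 4) ^ j" for j
    using Cauchy[of j "Suc j"] unfolding w_def[abs_def] by simp
  have wm: "(\<lambda>x. (nrm x (w j x))\<^sup>2) \<in> borel_measurable M" for j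
    using nrm_measurable[OF E_measurable[OF wE]] by simp
  \<comment> \<open>Since \<open>\<integral> nrm (w j)\<^sup>2 \<le> 16\<^sup>-\<^sup>j\<close>, the weights \<open>4\<^sup>j\<close> still give a finite sum, which forces geometric decay a.e.\<close>
  have "(\<integral>\<^sup>+x. (\<Sum>j. ennreal (4 ^ j * (nrm x (w j x))\<^sup>2)) \<partial>M)
      = (\<Sum>j. \<integral>\<^sup>+x. ennreal (4 ^ j * (nrm x (w j x))\<^sup>2) \<partial>M)"
    using wm by (intro nn_integral_suminf) auto
  also have "\<dots> \<le> (\<Sum>j. ennreal ((1 / 4) ^ j))"
  proof (intro suminf_le summableI)
    fix j
    have "(\<integral>\<^sup>+x. ennreal (4 ^ j * (nrm x (w j x))\<^sup>2) \<partial>M) = ennreal (4 ^ j) * ennreal ((L2.N (w j))\<^sup>2)"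
      using wm by (simp add: ennreal_mult nn_integral_cmult nn_integral_nrm[OF wE, symmetric])
    also have "\<dots> = ennreal (4 ^ j * (L2.N (w j))\<^sup>2)" by (simp add: ennreal_mult)
    also have "\<dots> \<le> ennreal (4 ^ j * ((1 / 4) ^ j)\<^sup>2)"
      using wN L2.N_ge_0[OF wE] by (intro ennreal_leI mult_left_mono power_mono) auto
    also have "4 ^ j * ((1 / 4 :: real) ^ j)\<^sup>2 = (1 / 4) ^ j"
      by (simp add: power2_eq_square power_divide)
    finally show "(\<integral>\<^sup>+x. ennreal (4 ^ j * (nrm x (w j x))\<^sup>2) \<partial>M) \<le> ennreal ((1 / 4) ^ j)" .
  qed
  also have "\<dots> = ennreal (\<Sum>j. (1 / 4) ^ j)"
    by (intro suminf_ennreal2) (auto intro: summable_geometric)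
  finally have "(\<integral>\<^sup>+x. (\<Sum>j. ennreal (4 ^ j * (nrm x (w j x))\<^sup>2)) \<partial>M) \<noteq> \<infinity>"
    by (auto simp: top_unique)
  then have fin: "AE x in M. (\<Sum>j. ennreal (4 ^ j * (nrm x (w j x))\<^sup>2)) \<noteq> \<infinity>"
    using wm by (intro nn_integral_PInf_AE) auto
  have conv: "AE x in M. convergent (\<lambda>j. f j x)"
    using fin nondegenerate AE_space
  proof eventually_elim
    fix x assume sum: "(\<Sum>j. ennreal (4 ^ j * (nrm x (w j x))\<^sup>2)) \<noteq> \<infinity>"
      and "\<exists>C. \<forall>\<xi>. norm \<xi> \<le> C * nrm x \<xi>" and x: "x \<in> space M"
    then obtain C where C: "\<And>\<xi>. norm \<xi> \<le> C * nrm x \<xi>" by blast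
    define T where "T j = ennreal (4 ^ j * (nrm x (w j x))\<^sup>2)" for j
    define S where "S = enn2real (suminf T)"
    have S: "suminf T = ennreal S" using sum unfolding S_def T_def by (simp add: less_top)
    have "4 ^ j * (nrm x (w j x))\<^sup>2 \<le> S" for j
    proof -
      have "T j \<le> suminf T" using sum_le_suminf[OF summableI, of "{j}" T] by simp
      then show ?thesis unfolding S unfolding T_def by (subst (asm) ennreal_le_iff) (simp_all add: S_def)
    qed
    moreover have "(2 ^ j)\<^sup>2 = (4 :: real) ^ j" for j :: nat
      by (simp add: power2_eq_square flip: power_mult_distrib)
    ultimately have "(2 ^ j * nrm x (w j x))\<^sup>2 \<le> S" for j
      by (simp add: power_mult_distrib)
    then have "2 ^ j * nrm x (w j x) \<le> sqrt S" for j by (rule real_le_rsqrt)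
    then have nw: "nrm x (w j x) \<le> sqrt S * (1 / 2) ^ j" for j
      by (simp add: power_divide field_simps)
    have "summable (\<lambda>j. w j x)"
    proof (rule summable_comparison_test')
      show "summable (\<lambda>j. \<bar>C\<bar> * (sqrt S * (1 / 2) ^ j))"
        by (intro summable_mult summable_geometric) simp
      show "norm (w j x) \<le> \<bar>C\<bar> * (sqrt S * (1 / 2) ^ j)" if "j \<ge> 0" for j
      proof -
        have "norm (w j x) \<le> C * nrm x (w j x)" by (rule C)
        also have "\<dots> \<le> \<bar>C\<bar> * nrm x (w j x)" using nrm_ge_0[OF x] by (intro mult_right_mono) auto
        also have "\<dots> \<le> \<bar>C\<bar> * (sqrt S * (1 / 2) ^ j)" using nw by (intro mult_left_mono) auto
        finally show ?thesis .
      qed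
    qed
    then have "convergent (\<lambda>n. \<Sum>j<n. w j x)" by (simp add: summable_iff_convergent)
    moreover have "(\<Sum>j<n. w j x) = f n x - f 0 x" for n
      by (induction n) (auto simp: w_def)
    ultimately have "convergent (\<lambda>n. f n x - f 0 x)" by simp
    then have "convergent (\<lambda>n. (f n x - f 0 x) + f 0 x)" by (intro convergent_add convergent_const)
    then show "convergent (\<lambda>j. f j x)" by simp
  qed
  define g where "g x = lim (\<lambda>j. f j x)" for x
  have gm: "g \<in> borel_measurable M"
    unfolding g_def using E_measurable[OF fE] by (intro borel_measurable_lim_metric) auto
  have bound: "(\<integral>\<^sup>+x. ennreal ((nrm x (f j x - g x))\<^sup>2) \<partial>M) \<le> ennreal (((1 / 4) ^ j)\<^sup>2)" for j
  proof -
    have "(\<integral>\<^sup>+x. ennreal ((nrm x (f j x - g x))\<^sup>2) \<partial>M)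
        = (\<integral>\<^sup>+x. liminf (\<lambda>k. ennreal ((nrm x (f k x - f j x))\<^sup>2)) \<partial>M)"
    proof (rule nn_integral_cong_AE)
      show "AE x in M. ennreal ((nrm x (f j x - g x))\<^sup>2) = liminf (\<lambda>k. ennreal ((nrm x (f k x - f j x))\<^sup>2))"
        using conv AE_space
      proof eventually_elim
        fix x assume "convergent (\<lambda>j. f j x)" and x: "x \<in> space M"
        then have lim: "(\<lambda>k. f k x) \<longlonglongrightarrow> g x" unfolding g_def by (simp add: convergent_LIMSEQ_iff)
        interpret bounded_bilinear "\<beta> x" by (rule form_bilinear[OF x])
        have "(\<lambda>k. (nrm x (f k x - f j x))\<^sup>2) \<longlonglongrightarrow> (nrm x (g x - f j x))\<^sup>2"
          unfolding nrm_power2[OF x] by (intro tendsto tendsto_diff lim tendsto_const)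
        moreover have "nrm x (g x - f j x) = nrm x (f j x - g x)"
          unfolding nrm_def by (simp add: diff_left diff_right)
        ultimately have "(\<lambda>k. ennreal ((nrm x (f k x - f j x))\<^sup>2)) \<longlonglongrightarrow> ennreal ((nrm x (f j x - g x))\<^sup>2)"
          by (intro tendsto_ennrealI) simp
        then show "ennreal ((nrm x (f j x - g x))\<^sup>2) = liminf (\<lambda>k. ennreal ((nrm x (f k x - f j x))\<^sup>2))"
          by (intro lim_imp_Liminf[symmetric]) simp_all
      qed
    qed
    also have "\<dots> \<le> liminf (\<lambda>k. \<integral>\<^sup>+x. ennreal ((nrm x (f k x - f j x))\<^sup>2) \<partial>M)"
      using nrm_measurable[OF E_measurable[OF diffE]] by (intro nn_integral_liminf) auto
    also have "\<dots> = liminf (\<lambda>k. ennreal ((L2.N (\<lambda>x. f k x - f j x))\<^sup>2))"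
      by (simp add: nn_integral_nrm[OF diffE])
    also have "\<dots> \<le> ennreal (((1 / 4) ^ j)\<^sup>2)"
    proof (rule Liminf_le[OF sequentially_bot])
      show "\<forall>\<^sub>F k in sequentially. ennreal ((L2.N (\<lambda>x. f k x - f j x))\<^sup>2) \<le> ennreal (((1 / 4) ^ j)\<^sup>2)"
        using eventually_ge_at_top[of j]
        by eventually_elim (intro ennreal_leI power_mono Cauchy L2.N_ge_0 diffE)
    qed
    finally show ?thesis .
  qed
  have dm: "(\<lambda>x. nrm x (f j x - g x)) \<in> borel_measurable M" for j
    using E_measurable[OF fE] gm by (intro nrm_measurable) auto
  have int: "integrable M (\<lambda>x. (nrm x (f j x - g x))\<^sup>2)" for j
    using dm bound[of j] by (intro integrableI_bounded) (auto simp: top_unique less_top[symmetric] intro: le_less_trans)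
  have dE: "(\<lambda>x. f j x - g x) \<in> E" for j
  proof -
    have "integrable M (\<lambda>x. \<beta> x (f j x - g x) (f j x - g x))"
      using int[of j] by (simp add: nrm_power2 cong: Bochner_Integration.integrable_cong)
    then show ?thesis using E_measurable[OF fE] gm by (auto simp: E_def)
  qed
  show thesis
  proof (rule that)
    show "g \<in> E" using E_combination[OF dE fE, of "-1" 0 0] by simp
    fix j
    have "ennreal ((L2.N (\<lambda>x. f j x - g x))\<^sup>2) \<le> ennreal (((1 / 4) ^ j)\<^sup>2)"
      using bound[of j] by (simp add: nn_integral_nrm[OF dE])
    then have "(L2.N (\<lambda>x. f j x - g x))\<^sup>2 \<le> ((1 / 4) ^ j)\<^sup>2" by (subst (asm) ennreal_le_iff) simp_all
    then show "L2.N (\<lambda>x. f j x - g x) \<le> (1 / 4) ^ j" by (rule power2_le_imp_le) simp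
  qed
qed

lemma E_diff: "f \<in> E \<Longrightarrow> g \<in> E \<Longrightarrow> (\<lambda>x. f x - g x) \<in> E"
  using E_combination[of g f "-1"] by simp

lemma N_diff_triangle:
  assumes "f \<in> E" "g \<in> E" "h \<in> E"
  shows "L2.N (\<lambda>x. f x - h x) \<le> L2.N (\<lambda>x. f x - g x) + L2.N (\<lambda>x. g x - h x)"
  using L2.N_triangle[OF E_diff[OF assms(1,2)] E_diff[OF assms(2,3)], of 1] by simp

lemma N_diff_commute: "L2.N (\<lambda>x. f x - g x) = L2.N (\<lambda>x. g x - f x)"
proof -
  have "nrm x (f x - g x) = nrm x (g x - f x)" if "x \<in> space M" for x
    using bounded_bilinear.diff_left[OF form_bilinear[OF that]] bounded_bilinear.diff_right[OF form_bilinear[OF that]]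
    by (simp add: nrm_def)
  then show ?thesis
    unfolding N_eq by (intro arg_cong[where f = sqrt] Bochner_Integration.integral_cong) auto
qed

lemma N_cong_AE:
  assumes "AE x in M. f x = g x" "f \<in> E" "g \<in> E"
  shows "L2.N f = L2.N g"
  unfolding N_eq
proof (intro arg_cong[where f = sqrt] integral_cong_AE)
  show "(\<lambda>x. (nrm x (f x))\<^sup>2) \<in> borel_measurable M" "(\<lambda>x. (nrm x (g x))\<^sup>2) \<in> borel_measurable M"
    using E_integrable_nrm assms(2,3) by (simp_all add: borel_measurable_integrable)
  show "AE x in M. (nrm x (f x))\<^sup>2 = (nrm x (g x))\<^sup>2" using assms(1) by eventually_elim simp
qed

lemma N_eq_0_imp_AE:
  assumes f: "f \<in> E" and N: "L2.N f = 0"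
    and nondegenerate: "AE x in M. \<exists>C. \<forall>\<xi>. norm \<xi> \<le> C * nrm x \<xi>"
  shows "AE x in M. f x = 0"
proof -
  have "(LINT x|M. (nrm x (f x))\<^sup>2) = 0" using N N_power2_eq[of f] by simp
  then have "AE x in M. (nrm x (f x))\<^sup>2 = 0"
    using E_integrable_nrm[OF f] by (subst (asm) integral_nonneg_eq_0_iff_AE) auto
  then show ?thesis using nondegenerate
  proof eventually_elim
    fix x assume *: "(nrm x (f x))\<^sup>2 = 0" "\<exists>C. \<forall>\<xi>. norm \<xi> \<le> C * nrm x \<xi>"
    then obtain C where "norm (f x) \<le> C * nrm x (f x)" by blast
    then show "f x = 0" using *(1) by simp
  qed
qed

end

lemma form_field_times: "form_field M (\<lambda>x s t. s * t :: real)"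
  by (rule form_field.intro) (auto intro: bounded_bilinear_mult)

text \<open>
  Stated for an integrand that is merely dominated by \<open>f g\<close>, as the drift terms are.
\<close>

lemma integral_Cauchy_Schwarz:
  fixes f g h :: "'x \<Rightarrow> real"
  assumes f: "f \<in> borel_measurable M" "integrable M (\<lambda>x. (f x)\<^sup>2)"
    and g: "g \<in> borel_measurable M" "integrable M (\<lambda>x. (g x)\<^sup>2)"
    and h: "h \<in> borel_measurable M" "AE x in M. \<bar>h x\<bar> \<le> f x * g x"
  shows "integrable M h" and "\<bar>LINT x|M. h x\<bar> \<le> sqrt (LINT x|M. (f x)\<^sup>2) * sqrt (LINT x|M. (g x)\<^sup>2)"
proof -
  interpret form_field M "\<lambda>x s t. s * t :: real" by (rule form_field_times)
  have fE: "f \<in> E" and gE: "g \<in> E" using f g by (auto simp: E_def power2_eq_square)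
  have i: "integrable M (\<lambda>x. f x * g x)" using form_integrable[OF fE gE] .
  show ih: "integrable M h"
    using i h(1) by (rule Bochner_Integration.integrable_bound) (use h(2) in \<open>auto elim!: eventually_mono\<close>)
  have "\<bar>LINT x|M. h x\<bar> \<le> (LINT x|M. \<bar>h x\<bar>)" by (rule integral_abs_bound)
  also have "\<dots> \<le> (LINT x|M. f x * g x)" using ih i h(2) by (intro integral_mono_AE) auto
  also have "\<dots> \<le> L2.N f * L2.N g" using L2.Cauchy_Schwarz[OF fE gE] by (simp add: ip_def)
  finally show "\<bar>LINT x|M. h x\<bar> \<le> sqrt (LINT x|M. (f x)\<^sup>2) * sqrt (LINT x|M. (g x)\<^sup>2)"
    by (simp add: L2.N_def ip_def power2_eq_square)
qed

section \<open>Auxiliary inequalities\<close>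

lemma bounded_bilinear_matrix_form: "bounded_bilinear (\<lambda>\<xi> \<eta> :: real ^ 'n. (A *v \<xi>) \<bullet> \<eta>)"
proof -
  have "bounded_linear ((*v) A)" by (rule matrix_vector_mul_bounded_linear)
  then show ?thesis
    using bounded_bilinear.comp1[OF bounded_bilinear_inner] by blast
qed

lemma matrix_form_measurable:
  fixes Q :: "'x \<Rightarrow> real ^ 'n ^ 'n"
  assumes Q: "\<And>i j. (\<lambda>x. Q x $ i $ j) \<in> borel_measurable M"
    and f: "f \<in> borel_measurable M" and g: "g \<in> borel_measurable M"
  shows "(\<lambda>x. (Q x *v f x) \<bullet> g x) \<in> borel_measurable M"
proof -
  have comp: "(\<lambda>x. h x $ i) \<in> borel_measurable M" if "h \<in> borel_measurable M" for h :: "'x \<Rightarrow> real ^ 'n" and i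
  proof -
    have "(\<lambda>x. h x \<bullet> axis i 1) \<in> borel_measurable M" using that by simp
    then show ?thesis by (simp add: inner_axis)
  qed
  have "(\<lambda>x. \<Sum>i\<in>UNIV. (\<Sum>j\<in>UNIV. Q x $ i $ j * f x $ j) * g x $ i) \<in> borel_measurable M"
    using Q comp[OF f] comp[OF g] by (intro borel_measurable_sum borel_measurable_times) auto
  then show ?thesis by (simp add: inner_vec_def matrix_vector_mult_def)
qed

lemma matrix_form_le_op_norm: "(A *v \<xi>) \<bullet> \<xi> \<le> op_norm A * (norm \<xi>)\<^sup>2"
proof -
  have "(A *v \<xi>) \<bullet> \<xi> \<le> norm (A *v \<xi>) * norm \<xi>" by (rule norm_cauchy_schwarz)
  also have "\<dots> \<le> (op_norm A * norm \<xi>) * norm \<xi>"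
    unfolding op_norm_def by (intro mult_right_mono onorm matrix_vector_mul_bounded_linear) simp
  finally show ?thesis by (simp add: power2_eq_square mult.assoc)
qed

text \<open>
  An invertible \<open>A\<close> has an invertible square root; \<open>C\<close> is the norm of its inverse.
\<close>

lemma invertible_psd_norm_le:
  fixes A :: "real ^ 'n ^ 'n"
  assumes "psd A" "invertible A"
  shows "\<exists>C. \<forall>\<xi>. norm \<xi> \<le> C * norm (psd_sqrt A *v \<xi>)"
proof -
  obtain B where "B ** A = mat 1" using assms(2) unfolding invertible_def by blast
  then have id: "(B ** psd_sqrt A) *v (psd_sqrt A *v \<xi>) = \<xi>" for \<xi>
    using psd_sqrt(2)[OF assms(1)] by (simp add: matrix_vector_mul_assoc flip: matrix_mul_assoc)
  have "norm \<xi> \<le> onorm ((*v) (B ** psd_sqrt A)) * norm (psd_sqrt A *v \<xi>)" for \<xi>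
    using onorm[OF matrix_vector_mul_bounded_linear, of "B ** psd_sqrt A" "psd_sqrt A *v \<xi>"] id[of \<xi>] by simp
  then show ?thesis by blast
qed

text \<open>
  Used to scale by numbers slightly larger than a norm that might vanish.
\<close>

lemma le_mult_of_lt_approx:
  fixes x a b K :: real
  assumes "\<And>\<alpha> \<beta>. a < \<alpha> \<Longrightarrow> b < \<beta> \<Longrightarrow> x \<le> \<alpha> * \<beta> * K"
  shows "x \<le> a * b * K"
proof (rule tendsto_lowerbound)
  have "((\<lambda>t. (a + t) * (b + t) * K) \<longlongrightarrow> (a + 0) * (b + 0) * K) (at_right 0)"
    by (intro tendsto_intros)
  then show "((\<lambda>t. (a + t) * (b + t) * K) \<longlongrightarrow> a * b * K) (at_right 0)" by simp
  show "\<forall>\<^sub>F t in at_right 0. x \<le> (a + t) * (b + t) * K"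
    by (rule eventually_at_right_less[THEN eventually_mono]) (auto intro: assms)
qed simp

text \<open>
  Young's inequality with exponents \<open>\<sigma>'\<close> and \<open>\<sigma>\<close>, where \<open>\<sigma>' < q / 2\<close>. With it the moments in
  the Sobolev inequality control the zeroth order term.
\<close>

lemma Young_three_factors:
  fixes \<delta> s t :: real
  assumes \<sigma>: "\<sigma> > 1" and q: "q > 2 * (\<sigma> / (\<sigma> - 1))" and nonneg: "0 \<le> \<delta>" "0 \<le> s" "0 \<le> t"
  shows "\<delta> * s * t \<le> \<delta> powr (q / 2) + 1 + s powr (2 * \<sigma>) + t powr (2 * \<sigma>)"
proof -
  define m where "m = max s t"
  define \<sigma>' where "\<sigma>' = \<sigma> / (\<sigma> - 1)"
  have m0: "0 \<le> m" using nonneg by (simp add: m_def)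
  have \<sigma>': "\<sigma>' > 1" "1 / \<sigma>' + 1 / \<sigma> = 1" "\<sigma>' \<le> q / 2"
    using \<sigma> q by (auto simp: \<sigma>'_def field_simps)
  have "\<delta> * s * t \<le> \<delta> * (m * m)"
    using nonneg m0 by (auto simp: mult.assoc m_def intro!: mult_left_mono mult_mono)
  also have "\<dots> = \<delta> * m\<^sup>2" by (simp add: power2_eq_square)
  also have "\<dots> \<le> \<delta> powr \<sigma>' / \<sigma>' + m\<^sup>2 powr \<sigma> / \<sigma>"
    using \<sigma>' \<sigma> nonneg by (intro Youngs_inequality) auto
  also have "\<dots> \<le> \<delta> powr \<sigma>' / 1 + m\<^sup>2 powr \<sigma> / 1"
    using \<sigma>' \<sigma> by (intro add_mono divide_left_mono) auto
  also have "\<delta> powr \<sigma>' / 1 \<le> \<delta> powr (q / 2) + 1"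
  proof (cases "\<delta> \<le> 1")
    case True
    then have "\<delta> powr \<sigma>' \<le> 1 powr \<sigma>'" using nonneg \<sigma>' by (intro powr_mono2) auto
    then show ?thesis by (simp add: add_increasing)
  next
    case False
    then have "\<delta> powr \<sigma>' \<le> \<delta> powr (q / 2)" using \<sigma>'(3) by (intro powr_mono) auto
    then show ?thesis by simp
  qed
  also have "m\<^sup>2 powr \<sigma> / 1 = m powr (2 * \<sigma>)" using m0 by (simp add: powr_powr flip: powr_numeral)
  also have "\<dots> \<le> s powr (2 * \<sigma>) + t powr (2 * \<sigma>)" by (simp add: m_def max_def)
  finally show ?thesis by simp
qed

lemma le_if_geometric_bound:
  fixes x K :: real
  assumes "\<And>j. j \<ge> n \<Longrightarrow> x \<le> y + K * (1 / 4) ^ j"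
  shows "x \<le> y"
proof (rule LIMSEQ_le_const[of "\<lambda>j. y + K * (1 / 4) ^ j"])
  have "(\<lambda>j. y + K * (1 / 4) ^ j) \<longlonglongrightarrow> y + K * 0"
    by (intro tendsto_intros LIMSEQ_power_zero) simp
  then show "(\<lambda>j. y + K * (1 / 4) ^ j) \<longlonglongrightarrow> y" by simp
  show "\<exists>N. \<forall>j\<ge>N. x \<le> y + K * (1 / 4) ^ j" using assms by blast
qed

section \<open>The function spaces of the degenerate problem\<close>

text \<open>
  The hypotheses on the coefficients of the operator, with the Sobolev constant and the constant of
  the bound for \<open>Q\<close> made explicit. Inside, the qualifiers \<open>V\<close>, \<open>G\<close> and \<open>D\<close> refer to \<open>L\<^sup>2(v)\<close>, to \<open>QL\<^sup>2\<close>, and to the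
  test functions with the norm \<open>D.N \<phi>\<close> of the gradient in \<open>QL\<^sup>2\<close>.
\<close>

locale degenerate_problem =
  fixes \<Omega> :: "(real ^ 'n) set" and v d :: "real ^ 'n \<Rightarrow> real" and Q :: "real ^ 'n \<Rightarrow> real ^ 'n ^ 'n"
    and b c :: "real ^ 'n \<Rightarrow> real ^ 'n" and \<sigma> q C k :: real
  assumes open_\<Omega>: "open \<Omega>"
    and weight_v: "weight \<Omega> v" and integrable_v: "integrable (lebesgue_on \<Omega>) v"
    and matrix_Q: "matrix_function \<Omega> Q"
    and Q_le: "AE x in lebesgue_on \<Omega>. op_norm (Q x) \<le> k * v x"
    and \<sigma>: "\<sigma> > 1" and C_pos: "C > 0"
    and Sobolev: "\<And>\<phi>. \<phi> \<in> Lip0 \<Omega> \<Longrightarrow> wLp_norm (2 * \<sigma>) v \<Omega> \<phi> \<le> C * QL2_norm Q \<Omega> (grad \<phi>)"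
    and d2: "d \<in> wLp 2 v \<Omega>" and q: "q > 2 * (\<sigma> / (\<sigma> - 1))" and dq: "d \<in> wLp (q / 2) v \<Omega>"
    and b_measurable: "b \<in> borel_measurable (lebesgue_on \<Omega>)" and b_subunit: "degenerate_subunit \<Omega> v Q b"
    and c_measurable: "c \<in> borel_measurable (lebesgue_on \<Omega>)" and c_subunit: "degenerate_subunit \<Omega> v Q c"
    and nonpositivity: "\<And>\<phi>. \<phi> \<in> QLip0 Q v \<Omega> \<Longrightarrow> (\<And>x. 0 \<le> \<phi> x) \<Longrightarrow>
           (LINT x|lebesgue_on \<Omega>. (d x * \<phi> x - c x \<bullet> grad \<phi> x) * v x) \<le> 0"
begin

abbreviation M :: "(real ^ 'n) measure" where "M \<equiv> lebesgue_on \<Omega>"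

lemma v_measurable [measurable]: "v \<in> borel_measurable M"
  using weight_v by (simp add: weight_def)

lemma v_nonneg: "x \<in> \<Omega> \<Longrightarrow> 0 \<le> v x"
  using weight_v by (simp add: weight_def)

lemma Q_psd: "x \<in> \<Omega> \<Longrightarrow> psd (Q x)"
  using matrix_Q by (simp add: matrix_function_def)

lemma \<Omega>_lebesgue: "\<Omega> \<in> sets lebesgue"
  using open_\<Omega> by (simp add: borel_open)

sublocale V: form_field M "\<lambda>x s t. s * t * v x"
proof (rule form_field.intro)
  show "bounded_bilinear (\<lambda>s t. s * t * v x)" for x
    using bounded_bilinear.flip[OF bounded_bilinear.comp1[OF bounded_bilinear_mult bounded_linear_mult_left[of "v x"]]]
    by (simp add: mult.commute mult.left_commute)
qed (auto simp: v_nonneg mult.commute)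

sublocale G: form_field M "\<lambda>x \<xi> \<eta>. (Q x *v \<xi>) \<bullet> \<eta>"
proof (rule form_field.intro)
  show "(\<lambda>x. (Q x *v f x) \<bullet> g x) \<in> borel_measurable M"
    if "f \<in> borel_measurable M" "g \<in> borel_measurable M" for f g
    using that matrix_Q by (intro matrix_form_measurable) (auto simp: matrix_function_def)
  show "(Q x *v \<xi>) \<bullet> \<eta> = (Q x *v \<eta>) \<bullet> \<xi>" if "x \<in> space M" for x \<xi> \<eta>
    using psd_sym[OF Q_psd, of x \<xi> \<eta>] that by (simp add: inner_commute)
qed (use Q_psd in \<open>auto simp: bounded_bilinear_matrix_form psd_def\<close>)

lemma V_nrm: "x \<in> \<Omega> \<Longrightarrow> V.nrm x s = \<bar>s\<bar> * sqrt (v x)"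
  by (simp add: V.nrm_def real_sqrt_mult)

lemma G_nrm: "x \<in> \<Omega> \<Longrightarrow> G.nrm x \<xi> = norm (psd_sqrt (Q x) *v \<xi>)"
  by (simp add: G.nrm_def flip: norm_psd_sqrt[OF Q_psd])

lemma wLp_eq: "wLp 2 v \<Omega> = V.E"
  by (auto simp: wLp_def V.E_def power2_eq_square)

lemma wLp_norm_eq: "wLp_norm 2 v \<Omega> u = V.L2.N u"
proof -
  have "0 \<le> (LINT x|M. (\<bar>u x\<bar>)\<^sup>2 * v x)"
    using v_nonneg by (intro integral_nonneg_AE AE_I2) auto
  then show ?thesis
    by (simp add: wLp_norm_def V.L2.N_def V.ip_def powr_half_sqrt power2_eq_square)
qed

lemma QL2_eq: "QL2 Q \<Omega> = G.E"
proof -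
  have "integrable M (\<lambda>x. (norm (psd_sqrt (Q x) *v g x))\<^sup>2) = integrable M (\<lambda>x. (Q x *v g x) \<bullet> g x)" for g
    by (rule Bochner_Integration.integrable_cong) (auto simp: norm_psd_sqrt[OF Q_psd])
  then show ?thesis unfolding QL2_def G.E_def by blast
qed

lemma QL2_norm_eq: "QL2_norm Q \<Omega> g = G.L2.N g"
  unfolding QL2_norm_def G.L2.N_def G.ip_def
  by (intro arg_cong[where f = sqrt] Bochner_Integration.integral_cong) (auto simp: norm_psd_sqrt[OF Q_psd])

lemma AE_M: "AE x in lborel. P x \<Longrightarrow> AE x in M. P x"
  by (rule AE_lebesgue_on_if_AE_lborel[OF _ \<Omega>_lebesgue])

lemma Lip0_measurable: "\<phi> \<in> Lip0 \<Omega> \<Longrightarrow> \<phi> \<in> borel_measurable M"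
  by (intro borel_measurable_lebesgue_on borel_measurable_continuous_onI Lip0_continuous)

lemma grad_measurable: "\<phi> \<in> Lip0 \<Omega> \<Longrightarrow> grad \<phi> \<in> borel_measurable M"
  by (intro borel_measurable_lebesgue_on grad_borel_measurable Lip0_continuous)

lemma bounded_mult_integrable:
  fixes h m :: "real ^ 'n \<Rightarrow> real"
  assumes "integrable M h" "m \<in> borel_measurable M" "\<And>x. x \<in> \<Omega> \<Longrightarrow> \<bar>m x\<bar> \<le> B"
  shows "integrable M (\<lambda>x. m x * h x)"
proof (rule Bochner_Integration.integrable_bound)
  show "integrable M (\<lambda>x. B * h x)" using assms(1) by simp
  show "(\<lambda>x. m x * h x) \<in> borel_measurable M" using assms(1,2) by auto
  have "norm (m x * h x) \<le> norm (B * h x)" if "x \<in> \<Omega>" for x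
    unfolding norm_mult using assms(3)[OF that] by (intro mult_right_mono) auto
  then show "AE x in M. norm (m x * h x) \<le> norm (B * h x)" by (intro AE_I2) simp
qed

lemma Lip0_mult_E:
  assumes \<phi>: "\<phi> \<in> Lip0 \<Omega>" and u: "u \<in> V.E"
  shows "(\<lambda>x. u x * \<phi> x) \<in> V.E"
proof -
  obtain B where B: "\<And>x. \<bar>\<phi> x\<bar> \<le> B" using Lip0_bounded[OF \<phi>] by blast
  have "integrable M (\<lambda>x. (\<phi> x)\<^sup>2 * (u x * u x * v x))"
  proof (rule bounded_mult_integrable)
    show "\<bar>(\<phi> x)\<^sup>2\<bar> \<le> B\<^sup>2" for x using power_mono[OF B[of x], of 2] by simp
    show "integrable M (\<lambda>x. u x * u x * v x)" using V.E_integrable[OF u] .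
    show "(\<lambda>x. (\<phi> x)\<^sup>2) \<in> borel_measurable M" using Lip0_measurable[OF \<phi>] by simp
  qed
  then have "integrable M (\<lambda>x. (u x * \<phi> x) * (u x * \<phi> x) * v x)"
    by (simp add: power2_eq_square mult_ac)
  then show ?thesis using Lip0_measurable[OF \<phi>] V.E_measurable[OF u] by (simp add: V.E_def)
qed

lemma const_1_E: "(\<lambda>x. 1) \<in> V.E"
  using integrable_v by (simp add: V.E_def)

lemma Lip0_E: "\<phi> \<in> Lip0 \<Omega> \<Longrightarrow> \<phi> \<in> V.E"
  using Lip0_mult_E[OF _ const_1_E] by simp

text \<open>
  The gradient of a Lipschitz function is bounded and \<open>|Q|\<close> is dominated by the integrable weight.
\<close>

lemma grad_E:
  assumes \<phi>: "\<phi> \<in> Lip0 \<Omega>"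
  shows "grad \<phi> \<in> G.E"
proof -
  from grad_bounded_ae[OF \<phi>] obtain B where B: "AE x in lborel. norm (grad \<phi> x) \<le> B" ..
  have "integrable M (\<lambda>x. (Q x *v grad \<phi> x) \<bullet> grad \<phi> x)"
  proof (rule Bochner_Integration.integrable_bound)
    show "integrable M (\<lambda>x. k * B\<^sup>2 * v x)" using integrable_v by simp
    show "(\<lambda>x. (Q x *v grad \<phi> x) \<bullet> grad \<phi> x) \<in> borel_measurable M"
      using grad_measurable[OF \<phi>] by (intro G.form_measurable)
    show "AE x in M. norm ((Q x *v grad \<phi> x) \<bullet> grad \<phi> x) \<le> norm (k * B\<^sup>2 * v x)"
      using AE_M[OF B] Q_le AE_space
    proof eventually_elim
      fix x assume *: "norm (grad \<phi> x) \<le> B" "op_norm (Q x) \<le> k * v x" "x \<in> space M"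
      have "0 \<le> op_norm (Q x)"
        unfolding op_norm_def by (intro onorm_pos_le matrix_vector_mul_bounded_linear)
      then have "(Q x *v grad \<phi> x) \<bullet> grad \<phi> x \<le> (k * v x) * B\<^sup>2"
        using matrix_form_le_op_norm[of "Q x" "grad \<phi> x"] *
        by (elim order.trans) (intro mult_mono power_mono, auto)
      moreover have "0 \<le> (Q x *v grad \<phi> x) \<bullet> grad \<phi> x" using *(3) by (rule G.form_nonneg)
      ultimately show "norm ((Q x *v grad \<phi> x) \<bullet> grad \<phi> x) \<le> norm (k * B\<^sup>2 * v x)"
        by (simp add: mult_ac)
    qed
  qed
  then show ?thesis using grad_measurable[OF \<phi>] by (simp add: G.E_def)
qed

lemma QLip0_eq: "QLip0 Q v \<Omega> = Lip0 \<Omega>"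
  unfolding QLip0_def wLp_eq QL2_eq using Lip0_E grad_E by blast

lemma G_ip_cong_AE:
  assumes "AE x in M. f x = f' x" "f \<in> G.E" "f' \<in> G.E" "g \<in> G.E"
  shows "G.ip f g = G.ip f' g"
  unfolding G.ip_def
proof (rule integral_cong_AE)
  show "(\<lambda>x. (Q x *v f x) \<bullet> g x) \<in> borel_measurable M" "(\<lambda>x. (Q x *v f' x) \<bullet> g x) \<in> borel_measurable M"
    using assms(2-4) by (auto intro: G.form_measurable G.E_measurable)
  show "AE x in M. (Q x *v f x) \<bullet> g x = (Q x *v f' x) \<bullet> g x"
    using assms(1) by eventually_elim simp
qed

lemma grad_combination_M:
  "u \<in> Lip0 \<Omega> \<Longrightarrow> w \<in> Lip0 \<Omega> \<Longrightarrow> AE x in M. grad (\<lambda>x. a * u x + w x) x = a *\<^sub>R grad u x + grad w x"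
  by (rule AE_M, rule grad_combination_ae)

sublocale D: semi_inner_space "Lip0 \<Omega>" "\<lambda>a u w x. a * u x + w x" "\<lambda>u w. G.ip (grad u) (grad w)"
proof
  show "Lip0 \<Omega> \<noteq> {}" using Lip0_zero by blast
  show "(\<lambda>x. a * u x + w x) \<in> Lip0 \<Omega>" if "u \<in> Lip0 \<Omega>" "w \<in> Lip0 \<Omega>" for u w a
    using that by (rule Lip0_combination)
  show "G.ip (grad (\<lambda>x. a * u x + w x)) (grad z) = a * G.ip (grad u) (grad z) + G.ip (grad w) (grad z)"
    if "u \<in> Lip0 \<Omega>" "w \<in> Lip0 \<Omega>" "z \<in> Lip0 \<Omega>" for u w z a
  proof -
    have "G.ip (grad (\<lambda>x. a * u x + w x)) (grad z) = G.ip (\<lambda>x. a *\<^sub>R grad u x + grad w x) (grad z)"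
      using that by (intro G_ip_cong_AE grad_combination_M grad_E Lip0_combination G.L2.comb_D)
    then show ?thesis using that by (simp add: G.L2.ip_comb grad_E)
  qed
  show "G.ip (grad u) (grad w) = G.ip (grad w) (grad u)" if "u \<in> Lip0 \<Omega>" "w \<in> Lip0 \<Omega>" for u w
    using that by (intro G.L2.ip_commute grad_E)
  show "0 \<le> G.ip (grad u) (grad u)" if "u \<in> Lip0 \<Omega>" for u
    using that by (intro G.L2.ip_ge_0 grad_E)
qed

lemma D_N_eq: "D.N u = G.L2.N (grad u)"
  by (simp add: D.N_def G.L2.N_def)

definition total_weight :: real where "total_weight = (LINT x|M. v x)"

lemma total_weight_nonneg: "0 \<le> total_weight"
  unfolding total_weight_def using v_nonneg by (intro integral_nonneg_AE AE_I2) auto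

lemma powr_integrable:
  assumes \<phi>: "\<phi> \<in> Lip0 \<Omega>" and p: "0 \<le> p"
  shows "integrable M (\<lambda>x. \<bar>\<phi> x\<bar> powr p * v x)"
proof -
  obtain B where B: "\<And>x. \<bar>\<phi> x\<bar> \<le> B" using Lip0_bounded[OF \<phi>] by blast
  show ?thesis
  proof (rule bounded_mult_integrable[OF integrable_v])
    show "\<bar>\<bar>\<phi> x\<bar> powr p\<bar> \<le> B powr p" for x using B p by (auto intro!: powr_mono2)
  qed (use Lip0_measurable[OF \<phi>] in measurable)
qed

text \<open>
  The Sobolev inequality in scaled form, convenient for Young-type arguments.
\<close>

lemma Sobolev_moment:
  assumes \<phi>: "\<phi> \<in> Lip0 \<Omega>" and \<alpha>: "0 < \<alpha>" "C * D.N \<phi> \<le> \<alpha>"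
  shows "integrable M (\<lambda>x. \<bar>\<phi> x / \<alpha>\<bar> powr (2 * \<sigma>) * v x)"
    and "(LINT x|M. \<bar>\<phi> x / \<alpha>\<bar> powr (2 * \<sigma>) * v x) \<le> 1"
proof -
  define I where "I = (LINT x|M. \<bar>\<phi> x\<bar> powr (2 * \<sigma>) * v x)"
  have eq: "\<bar>\<phi> x / \<alpha>\<bar> powr (2 * \<sigma>) * v x = (\<bar>\<phi> x\<bar> powr (2 * \<sigma>) * v x) / \<alpha> powr (2 * \<sigma>)" for x
    using \<alpha> by (simp add: powr_divide)
  show "integrable M (\<lambda>x. \<bar>\<phi> x / \<alpha>\<bar> powr (2 * \<sigma>) * v x)"
    unfolding eq using powr_integrable[OF \<phi>] \<sigma> by simp
  have I0: "0 \<le> I" unfolding I_def using v_nonneg by (intro integral_nonneg_AE AE_I2) auto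
  have "I powr (1 / (2 * \<sigma>)) \<le> \<alpha>"
    using Sobolev[OF \<phi>] \<alpha> by (simp add: wLp_norm_def I_def QL2_norm_eq D_N_eq)
  then have "(I powr (1 / (2 * \<sigma>))) powr (2 * \<sigma>) \<le> \<alpha> powr (2 * \<sigma>)"
    using \<sigma> by (intro powr_mono2) auto
  then have "I \<le> \<alpha> powr (2 * \<sigma>)" using \<sigma> I0 by (simp add: powr_powr)
  then show "(LINT x|M. \<bar>\<phi> x / \<alpha>\<bar> powr (2 * \<sigma>) * v x) \<le> 1"
    unfolding eq using \<alpha> by (simp add: I_def[symmetric])
qed

definition poincare_const :: real where "poincare_const = C * sqrt (total_weight + 1)"

lemma poincare_const_nonneg: "0 \<le> poincare_const"
  unfolding poincare_const_def using C_pos total_weight_nonneg by simp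

text \<open>
  On the finite measure \<open>v dx\<close> the \<open>L\<^sup>2\<close> norm is controlled by the \<open>L\<^sup>2\<^sup>\<sigma>\<close> norm; the elementary bound
  \<open>y\<^sup>2 \<le> 1 + y\<^sup>2\<^sup>\<sigma>\<close> suffices after scaling.
\<close>

lemma Poincare:
  assumes \<phi>: "\<phi> \<in> Lip0 \<Omega>"
  shows "V.L2.N \<phi> \<le> poincare_const * D.N \<phi>"
proof -
  have "V.L2.N \<phi> \<le> \<alpha> * sqrt (total_weight + 1)" if \<alpha>: "C * D.N \<phi> < \<alpha>" for \<alpha>
  proof -
    have "0 \<le> C * D.N \<phi>" using C_pos D.N_ge_0[OF \<phi>] by simp
    then have pos: "0 < \<alpha>" using \<alpha> by linarith
    note S = Sobolev_moment[OF \<phi> pos less_imp_le[OF \<alpha>]]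
    have "(V.L2.N \<phi>)\<^sup>2 = (LINT x|M. \<phi> x * \<phi> x * v x)"
      by (simp add: V.L2.N_power2 Lip0_E[OF \<phi>] V.ip_def)
    also have "\<dots> \<le> (LINT x|M. \<alpha>\<^sup>2 * (v x + \<bar>\<phi> x / \<alpha>\<bar> powr (2 * \<sigma>) * v x))"
    proof (rule integral_mono_AE)
      show "integrable M (\<lambda>x. \<phi> x * \<phi> x * v x)" using V.E_integrable[OF Lip0_E[OF \<phi>]] .
      show "integrable M (\<lambda>x. \<alpha>\<^sup>2 * (v x + \<bar>\<phi> x / \<alpha>\<bar> powr (2 * \<sigma>) * v x))" using S(1) integrable_v by simp
      show "AE x in M. \<phi> x * \<phi> x * v x \<le> \<alpha>\<^sup>2 * (v x + \<bar>\<phi> x / \<alpha>\<bar> powr (2 * \<sigma>) * v x)"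
      proof (rule AE_I2)
        fix x assume x: "x \<in> space M"
        define y where "y = \<bar>\<phi> x / \<alpha>\<bar>"
        have "y\<^sup>2 \<le> 1 + y powr (2 * \<sigma>)"
        proof (cases "y \<le> 1")
          case True
          then have "y\<^sup>2 \<le> 1" by (simp add: y_def power_le_one)
          then show ?thesis by (simp add: add_increasing2)
        next
          case False
          then have "y powr 2 \<le> y powr (2 * \<sigma>)" using \<sigma> by (intro powr_mono) auto
          then show ?thesis using False by simp
        qed
        then have "\<alpha>\<^sup>2 * y\<^sup>2 * v x \<le> \<alpha>\<^sup>2 * (1 + y powr (2 * \<sigma>)) * v x"
          using x v_nonneg by (intro mult_right_mono mult_left_mono) auto
        moreover have "\<alpha>\<^sup>2 * y\<^sup>2 = \<phi> x * \<phi> x" using pos by (simp add: y_def power_divide power2_eq_square)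
        ultimately show "\<phi> x * \<phi> x * v x \<le> \<alpha>\<^sup>2 * (v x + \<bar>\<phi> x / \<alpha>\<bar> powr (2 * \<sigma>) * v x)"
          by (simp add: y_def algebra_simps)
      qed
    qed
    also have "\<dots> = \<alpha>\<^sup>2 * (total_weight + (LINT x|M. \<bar>\<phi> x / \<alpha>\<bar> powr (2 * \<sigma>) * v x))"
      using S(1) integrable_v by (simp add: total_weight_def)
    also have "\<dots> \<le> \<alpha>\<^sup>2 * (total_weight + 1)" using S(2) by (intro mult_left_mono) auto
    also have "\<dots> = (\<alpha> * sqrt (total_weight + 1))\<^sup>2"
      using total_weight_nonneg by (simp add: power_mult_distrib)
    finally show ?thesis
      by (rule power2_le_imp_le) (use pos total_weight_nonneg in auto)
  qed
  then have *: "V.L2.N \<phi> \<le> \<alpha> * sqrt (total_weight + 1)" if "C * D.N \<phi> < \<alpha>" for \<alpha>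
    using that by blast
  have "V.L2.N \<phi> \<le> (C * D.N \<phi>) * 1 * sqrt (total_weight + 1)"
  proof (rule le_mult_of_lt_approx)
    fix \<alpha> \<beta> :: real assume h: "C * D.N \<phi> < \<alpha>" "1 < \<beta>"
    have "0 \<le> C * D.N \<phi>" using C_pos D.N_ge_0[OF \<phi>] by simp
    then have pos: "0 \<le> \<alpha>" using h(1) by linarith
    have "V.L2.N \<phi> \<le> \<alpha> * sqrt (total_weight + 1)" by (rule *[OF h(1)])
    also have "\<dots> \<le> \<alpha> * \<beta> * sqrt (total_weight + 1)"
      using pos h(2) total_weight_nonneg by (intro mult_right_mono) (auto simp: mult_le_cancel_left1)
    finally show "V.L2.N \<phi> \<le> \<alpha> * \<beta> * sqrt (total_weight + 1)" .
  qed
  then show ?thesis by (simp add: poincare_const_def mult_ac)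
qed

section \<open>The first and zeroth order terms\<close>

definition drift :: "(real ^ 'n \<Rightarrow> real ^ 'n) \<Rightarrow> (real ^ 'n \<Rightarrow> real) \<Rightarrow> (real ^ 'n \<Rightarrow> real ^ 'n) \<Rightarrow> real" where
  "drift w p g = (LINT x|M. p x * (w x \<bullet> g x) * v x)"

lemma subunit_le:
  assumes "degenerate_subunit \<Omega> v Q w"
  shows "AE x in M. \<forall>\<xi>. \<bar>w x \<bullet> \<xi>\<bar> * v x \<le> sqrt (v x) * G.nrm x \<xi>"
  using assms[unfolded degenerate_subunit_def] AE_space
proof eventually_elim
  fix x assume *: "\<forall>\<xi>. (w x \<bullet> \<xi>)\<^sup>2 \<le> inverse (v x) * ((Q x *v \<xi>) \<bullet> \<xi>)" and x: "x \<in> space M"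
  show "\<forall>\<xi>. \<bar>w x \<bullet> \<xi>\<bar> * v x \<le> sqrt (v x) * G.nrm x \<xi>"
  proof
    fix \<xi>
    have v0: "0 \<le> v x" using x v_nonneg by simp
    have "(\<bar>w x \<bullet> \<xi>\<bar> * v x)\<^sup>2 = (w x \<bullet> \<xi>)\<^sup>2 * (v x * v x)" by (simp add: power_mult_distrib power2_eq_square)
    also have "\<dots> \<le> (inverse (v x) * ((Q x *v \<xi>) \<bullet> \<xi>)) * (v x * v x)"
      using * by (intro mult_right_mono) auto
    also have "\<dots> = v x * (G.nrm x \<xi>)\<^sup>2"
      unfolding G.nrm_power2[OF x] using v0 by (cases "v x = 0") auto
    also have "\<dots> = (sqrt (v x) * G.nrm x \<xi>)\<^sup>2" using v0 by (simp add: power_mult_distrib)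
    finally show "\<bar>w x \<bullet> \<xi>\<bar> * v x \<le> sqrt (v x) * G.nrm x \<xi>"
      by (rule power2_le_imp_le) (use v0 G.nrm_ge_0[OF x] in simp)
  qed
qed

lemma drift_pointwise:
  assumes "degenerate_subunit \<Omega> v Q w"
  shows "AE x in M. \<forall>s \<xi>. \<bar>s * (w x \<bullet> \<xi>) * v x\<bar> \<le> V.nrm x s * G.nrm x \<xi>"
  using subunit_le[OF assms] AE_space
proof eventually_elim
  fix x assume *: "\<forall>\<xi>. \<bar>w x \<bullet> \<xi>\<bar> * v x \<le> sqrt (v x) * G.nrm x \<xi>" and x: "x \<in> space M"
  show "\<forall>s \<xi>. \<bar>s * (w x \<bullet> \<xi>) * v x\<bar> \<le> V.nrm x s * G.nrm x \<xi>"
  proof (intro allI)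
    fix s \<xi>
    have xO: "x \<in> \<Omega>" using x by simp
    have "\<bar>s * (w x \<bullet> \<xi>) * v x\<bar> = \<bar>s\<bar> * (\<bar>w x \<bullet> \<xi>\<bar> * v x)"
      using v_nonneg[OF xO] by (simp add: abs_mult)
    also have "\<dots> \<le> \<bar>s\<bar> * (sqrt (v x) * G.nrm x \<xi>)" using * by (intro mult_left_mono) auto
    finally show "\<bar>s * (w x \<bullet> \<xi>) * v x\<bar> \<le> V.nrm x s * G.nrm x \<xi>"
      by (simp only: V_nrm[OF xO] mult.assoc[of "\<bar>s\<bar>"])
  qed
qed

text \<open>
  The subunit condition gives \<open>|w \<bullet> \<xi>| v \<le> sqrt v |sqrt Q \<xi>|\<close>.
\<close>

lemma drift_bound:
  assumes w: "w \<in> borel_measurable M" "degenerate_subunit \<Omega> v Q w" and p: "p \<in> V.E" and g: "g \<in> G.E"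
  shows "integrable M (\<lambda>x. p x * (w x \<bullet> g x) * v x)" and "\<bar>drift w p g\<bar> \<le> V.L2.N p * G.L2.N g"
proof -
  have m: "(\<lambda>x. p x * (w x \<bullet> g x) * v x) \<in> borel_measurable M"
    using w(1) V.E_measurable[OF p] G.E_measurable[OF g] by simp
  have dom: "AE x in M. \<bar>p x * (w x \<bullet> g x) * v x\<bar> \<le> V.nrm x (p x) * G.nrm x (g x)"
    using drift_pointwise[OF w(2)] by eventually_elim simp
  note CS = integral_Cauchy_Schwarz[OF V.nrm_measurable[OF V.E_measurable[OF p]] V.E_integrable_nrm[OF p]
      G.nrm_measurable[OF G.E_measurable[OF g]] G.E_integrable_nrm[OF g] m dom]
  show "integrable M (\<lambda>x. p x * (w x \<bullet> g x) * v x)" by (rule CS(1))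
  show "\<bar>drift w p g\<bar> \<le> V.L2.N p * G.L2.N g"
    using CS(2) by (simp add: drift_def V.N_eq G.N_eq)
qed

lemma drift_combination_left:
  assumes w: "w \<in> borel_measurable M" "degenerate_subunit \<Omega> v Q w"
    and p: "p \<in> V.E" "p' \<in> V.E" and g: "g \<in> G.E"
  shows "drift w (\<lambda>x. a * p x + p' x) g = a * drift w p g + drift w p' g"
proof -
  have "drift w (\<lambda>x. a * p x + p' x) g
      = (LINT x|M. a * (p x * (w x \<bullet> g x) * v x) + p' x * (w x \<bullet> g x) * v x)"
    unfolding drift_def by (simp add: algebra_simps)
  then show ?thesis
    using drift_bound(1)[OF w p(1) g] drift_bound(1)[OF w p(2) g] by (simp add: drift_def)
qed

lemma drift_combination_right:
  assumes w: "w \<in> borel_measurable M" "degenerate_subunit \<Omega> v Q w"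
    and p: "p \<in> V.E" and g: "g \<in> G.E" "g' \<in> G.E"
  shows "drift w p (\<lambda>x. a *\<^sub>R g x + g' x) = a * drift w p g + drift w p g'"
proof -
  have "drift w p (\<lambda>x. a *\<^sub>R g x + g' x)
      = (LINT x|M. a * (p x * (w x \<bullet> g x) * v x) + p x * (w x \<bullet> g' x) * v x)"
    unfolding drift_def by (simp add: algebra_simps inner_add_right)
  then show ?thesis
    using drift_bound(1)[OF w p g(1)] drift_bound(1)[OF w p g(2)] by (simp add: drift_def)
qed

lemma drift_cong_AE:
  assumes w: "w \<in> borel_measurable M" "degenerate_subunit \<Omega> v Q w"
    and p: "p \<in> V.E" and g: "g \<in> G.E" "g' \<in> G.E" and eq: "AE x in M. g x = g' x"
  shows "drift w p g = drift w p g'"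
  unfolding drift_def
proof (rule integral_cong_AE)
  show "(\<lambda>x. p x * (w x \<bullet> g x) * v x) \<in> borel_measurable M" "(\<lambda>x. p x * (w x \<bullet> g' x) * v x) \<in> borel_measurable M"
    using drift_bound(1)[OF w p g(1)] drift_bound(1)[OF w p g(2)] by (simp_all add: borel_measurable_integrable)
  show "AE x in M. p x * (w x \<bullet> g x) * v x = p x * (w x \<bullet> g' x) * v x"
    using eq by eventually_elim simp
qed

lemma drift_grad_combination:
  assumes w: "w \<in> borel_measurable M" "degenerate_subunit \<Omega> v Q w"
    and p: "p \<in> V.E" and \<phi>: "\<phi> \<in> Lip0 \<Omega>" "\<psi> \<in> Lip0 \<Omega>"
  shows "drift w p (grad (\<lambda>x. a * \<phi> x + \<psi> x)) = a * drift w p (grad \<phi>) + drift w p (grad \<psi>)"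
proof -
  have "drift w p (grad (\<lambda>x. a * \<phi> x + \<psi> x)) = drift w p (\<lambda>x. a *\<^sub>R grad \<phi> x + grad \<psi> x)"
    using \<phi> by (intro drift_cong_AE[OF w p] grad_combination_M grad_E Lip0_combination G.L2.comb_D)
  then show ?thesis using drift_combination_right[OF w p grad_E[OF \<phi>(1)] grad_E[OF \<phi>(2)]] by simp
qed

lemma d_E: "d \<in> V.E"
  using d2 by (simp add: wLp_eq)

definition react :: "(real ^ 'n \<Rightarrow> real) \<Rightarrow> (real ^ 'n \<Rightarrow> real) \<Rightarrow> real" where
  "react u \<phi> = (LINT x|M. d x * u x * \<phi> x * v x)"

text \<open>
  With \<open>d \<phi>\<close> in \<open>L\<^sup>2(v)\<close> for a bounded \<open>\<phi>\<close>, the zeroth order term is continuous in \<open>u\<close> on \<open>L\<^sup>2(v)\<close>, for fixed \<open>\<phi>\<close>.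
\<close>

lemma react_eq: "react u \<phi> = V.ip (\<lambda>x. d x * \<phi> x) u"
  unfolding react_def V.ip_def by (intro Bochner_Integration.integral_cong) auto

lemma react_eq': "react u \<phi> = V.ip (\<lambda>x. d x * u x) \<phi>"
  unfolding react_def V.ip_def by (intro Bochner_Integration.integral_cong) auto

lemma react_combination_left:
  assumes "u \<in> V.E" "w \<in> V.E" "\<phi> \<in> Lip0 \<Omega>"
  shows "react (\<lambda>x. a * u x + w x) \<phi> = a * react u \<phi> + react w \<phi>"
  unfolding react_eq using V.L2.ip_comb_right[OF assms(1,2) Lip0_mult_E[OF assms(3) d_E], of a] by simp

lemma react_combination_right:
  assumes "u \<in> Lip0 \<Omega>" "\<phi> \<in> Lip0 \<Omega>" "\<psi> \<in> Lip0 \<Omega>"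
  shows "react u (\<lambda>x. a * \<phi> x + \<psi> x) = a * react u \<phi> + react u \<psi>"
  unfolding react_eq'
  using V.L2.ip_comb_right[OF Lip0_E[OF assms(2)] Lip0_E[OF assms(3)] Lip0_mult_E[OF assms(1) d_E], of a] by simp

definition d_moment :: real where
  "d_moment = (LINT x|M. \<bar>d x\<bar> powr (q / 2) * v x)"

lemma d_moment_nonneg: "0 \<le> d_moment"
  unfolding d_moment_def using v_nonneg by (intro integral_nonneg_AE AE_I2) auto

text \<open>
  In contrast to \<open>react_eq\<close>, this bound is uniform in the test function, at the price of measuring both
  arguments in the stronger norm \<open>D.N\<close>.
\<close>

lemma react_bound:
  assumes u: "u \<in> Lip0 \<Omega>" and \<phi>: "\<phi> \<in> Lip0 \<Omega>"
  shows "\<bar>react u \<phi>\<bar> \<le> (C\<^sup>2 * (d_moment + total_weight + 2)) * D.N u * D.N \<phi>"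
proof -
  let ?K = "d_moment + total_weight + 2"
  have "\<bar>react u \<phi>\<bar> \<le> \<alpha> * \<beta> * ?K" if \<alpha>: "C * D.N u < \<alpha>" and \<beta>: "C * D.N \<phi> < \<beta>" for \<alpha> \<beta>
  proof -
    have "0 \<le> C * D.N u" "0 \<le> C * D.N \<phi>" using C_pos D.N_ge_0[OF u] D.N_ge_0[OF \<phi>] by simp_all
    then have pos: "0 < \<alpha>" "0 < \<beta>" using \<alpha> \<beta> by linarith+
    note Su = Sobolev_moment[OF u pos(1) less_imp_le[OF \<alpha>]]
    note S\<phi> = Sobolev_moment[OF \<phi> pos(2) less_imp_le[OF \<beta>]]
    have di: "integrable M (\<lambda>x. \<bar>d x\<bar> powr (q / 2) * v x)" using dq by (simp add: wLp_def)
    let ?F = "\<lambda>x. \<alpha> * \<beta> * (\<bar>d x\<bar> powr (q / 2) * v x + v x + \<bar>u x / \<alpha>\<bar> powr (2 * \<sigma>) * v x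
        + \<bar>\<phi> x / \<beta>\<bar> powr (2 * \<sigma>) * v x)"
    have ri: "integrable M (\<lambda>x. d x * u x * \<phi> x * v x)"
      using V.form_integrable[OF Lip0_mult_E[OF u d_E] Lip0_E[OF \<phi>]] .
    have "\<bar>react u \<phi>\<bar> \<le> (LINT x|M. \<bar>d x * u x * \<phi> x * v x\<bar>)"
      unfolding react_def by (rule integral_abs_bound)
    also have "\<dots> \<le> (LINT x|M. ?F x)"
    proof (rule integral_mono_AE)
      show "integrable M (\<lambda>x. \<bar>d x * u x * \<phi> x * v x\<bar>)" using ri by simp
      show "integrable M ?F" using di integrable_v Su(1) S\<phi>(1) by simp
      show "AE x in M. \<bar>d x * u x * \<phi> x * v x\<bar> \<le> ?F x"
      proof (rule AE_I2)
        fix x assume "x \<in> space M"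
        then have v0: "0 \<le> v x" using v_nonneg by simp
        define A B where "A = \<bar>u x / \<alpha>\<bar>" and "B = \<bar>\<phi> x / \<beta>\<bar>"
        have "\<bar>d x\<bar> * A * B \<le> \<bar>d x\<bar> powr (q / 2) + 1 + A powr (2 * \<sigma>) + B powr (2 * \<sigma>)"
          by (rule Young_three_factors[OF \<sigma> q]) (auto simp: A_def B_def)
        then have "(\<alpha> * \<beta>) * (\<bar>d x\<bar> * A * B) * v x
            \<le> (\<alpha> * \<beta>) * (\<bar>d x\<bar> powr (q / 2) + 1 + A powr (2 * \<sigma>) + B powr (2 * \<sigma>)) * v x"
          using v0 pos by (intro mult_right_mono mult_left_mono) auto
        also have "\<dots> = ?F x" by (simp add: A_def B_def algebra_simps)
        also have "(\<alpha> * \<beta>) * (\<bar>d x\<bar> * A * B) * v x = \<bar>d x * u x * \<phi> x * v x\<bar>"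
          using pos v0 by (simp add: A_def B_def abs_mult abs_divide)
        finally show "\<bar>d x * u x * \<phi> x * v x\<bar> \<le> ?F x" .
      qed
    qed
    also have "\<dots> = \<alpha> * \<beta> * (d_moment + total_weight + (LINT x|M. \<bar>u x / \<alpha>\<bar> powr (2 * \<sigma>) * v x)
        + (LINT x|M. \<bar>\<phi> x / \<beta>\<bar> powr (2 * \<sigma>) * v x))"
      using di integrable_v Su(1) S\<phi>(1) by (simp add: d_moment_def total_weight_def)
    also have "\<dots> \<le> \<alpha> * \<beta> * ?K"
      using Su(2) S\<phi>(2) pos by (intro mult_left_mono) auto
    finally show ?thesis .
  qed
  then have "\<bar>react u \<phi>\<bar> \<le> (C * D.N u) * (C * D.N \<phi>) * ?K" by (rule le_mult_of_lt_approx)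
  then show ?thesis by (simp add: power2_eq_square mult_ac)
qed

definition lower_order :: "(real ^ 'n \<Rightarrow> real) \<Rightarrow> (real ^ 'n \<Rightarrow> real) \<Rightarrow> real" where
  "lower_order u \<phi> = - drift b \<phi> (grad u) + drift c u (grad \<phi>) - react u \<phi>"

definition lower_order_const :: real where
  "lower_order_const = 2 * poincare_const + C\<^sup>2 * (d_moment + total_weight + 2)"

lemma lower_order_form: "D.form lower_order lower_order_const"
  unfolding D.form_def
proof (intro conjI ballI allI)
  fix u z assume u: "u \<in> Lip0 \<Omega>" and z: "z \<in> Lip0 \<Omega>"
  have "\<bar>drift b z (grad u)\<bar> \<le> poincare_const * D.N z * D.N u"
    using drift_bound(2)[OF b_measurable b_subunit Lip0_E[OF z] grad_E[OF u]]
      mult_right_mono[OF Poincare[OF z] D.N_ge_0[OF u]] by (simp add: D_N_eq)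
  moreover have "\<bar>drift c u (grad z)\<bar> \<le> poincare_const * D.N u * D.N z"
    using drift_bound(2)[OF c_measurable c_subunit Lip0_E[OF u] grad_E[OF z]]
      mult_right_mono[OF Poincare[OF u] D.N_ge_0[OF z]] by (simp add: D_N_eq)
  moreover have "poincare_const * D.N z * D.N u = poincare_const * D.N u * D.N z" by simp
  moreover note react_bound[OF u z]
  ultimately show "\<bar>lower_order u z\<bar> \<le> lower_order_const * D.N u * D.N z"
    unfolding lower_order_def lower_order_const_def by (simp add: distrib_right)
next
  fix u w z a assume u: "u \<in> Lip0 \<Omega>" and w: "w \<in> Lip0 \<Omega>" and z: "z \<in> Lip0 \<Omega>"
  show "lower_order (\<lambda>x. a * u x + w x) z = a * lower_order u z + lower_order w z"
    unfolding lower_order_def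
    using drift_grad_combination[OF b_measurable b_subunit Lip0_E[OF z] u w, of a]
      drift_combination_left[OF c_measurable c_subunit Lip0_E[OF u] Lip0_E[OF w] grad_E[OF z], of a]
      react_combination_left[OF Lip0_E[OF u] Lip0_E[OF w] z, of a]
    by (simp add: algebra_simps)
  show "lower_order z (\<lambda>x. a * u x + w x) = a * lower_order z u + lower_order z w"
    unfolding lower_order_def
    using drift_grad_combination[OF c_measurable c_subunit Lip0_E[OF z] u w, of a]
      drift_combination_left[OF b_measurable b_subunit Lip0_E[OF u] Lip0_E[OF w] grad_E[OF z], of a]
      react_combination_right[OF z u w, of a]
    by (simp add: algebra_simps)
qed

section \<open>Lower bounds for the adjoint form\<close>

lemma compose_bounded:
  fixes h :: "real \<Rightarrow> real"
  assumes u: "u \<in> Lip0 \<Omega>" and h: "continuous_on UNIV h"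
  shows "\<exists>B. \<forall>x. \<bar>h (u x)\<bar> \<le> B"
proof -
  obtain m where m: "\<And>x. \<bar>u x\<bar> \<le> m" using Lip0_bounded[OF u] by blast
  have "compact (h ` {-m..m})"
    by (intro compact_continuous_image continuous_on_subset[OF h]) auto
  then have "bounded (h ` {-m..m})" by (rule compact_imp_bounded)
  then obtain B where B: "\<And>y. y \<in> h ` {-m..m} \<Longrightarrow> norm y \<le> B" by (auto simp: bounded_iff)
  have "\<bar>h (u x)\<bar> \<le> B" for x
  proof -
    have "u x \<in> {-m..m}" using m[of x] by auto
    then show ?thesis using B[of "h (u x)"] by simp
  qed
  then show ?thesis by blast
qed

lemma compose_measurable:
  fixes h :: "real \<Rightarrow> real"
  assumes u: "u \<in> Lip0 \<Omega>" and h: "continuous_on UNIV h"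
  shows "(\<lambda>x. h (u x)) \<in> borel_measurable M"
  using measurable_compose[OF Lip0_measurable[OF u] borel_measurable_continuous_onI[OF h]] .

lemma compose_mult_integrable:
  fixes h f :: "_ \<Rightarrow> real"
  assumes u: "u \<in> Lip0 \<Omega>" and h: "continuous_on UNIV h" and f: "integrable M f"
  shows "integrable M (\<lambda>x. h (u x) * f x)"
proof -
  obtain B where "\<And>x. \<bar>h (u x)\<bar> \<le> B" using compose_bounded[OF u h] by blast
  then show ?thesis using f compose_measurable[OF u h] by (intro bounded_mult_integrable[of f _ B])
qed

lemma compose_scale_grad_E:
  fixes h :: "real \<Rightarrow> real"
  assumes u: "u \<in> Lip0 \<Omega>" and h: "continuous_on UNIV h"
  shows "(\<lambda>x. h (u x) *\<^sub>R grad u x) \<in> G.E"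
proof -
  have "continuous_on UNIV (\<lambda>s. (h s)\<^sup>2)" using h by (intro continuous_intros)
  from compose_mult_integrable[OF u this G.E_integrable[OF grad_E[OF u]]]
  have "integrable M (\<lambda>x. (Q x *v (h (u x) *\<^sub>R grad u x)) \<bullet> (h (u x) *\<^sub>R grad u x))"
    by (simp add: matrix_vector_mult_scaleR power2_eq_square mult.assoc)
  then show ?thesis
    using compose_measurable[OF u h] grad_measurable[OF u] by (simp add: G.E_def)
qed

text \<open>
  Test the adjoint inequality with \<open>H(u)\<close>. The sign condition for \<open>u H(u) \<ge> 0\<close> reads
  \<open>\<integral> d H(u) u v \<le> \<integral> c \<bullet> (H(u) \<nabla>u + u \<nabla>H(u)) v\<close>; its first term cancels against the drift term of the
  adjoint form. What remains is \<open>\<integral> u (b + c) \<bullet> \<nabla>H(u) v\<close>, estimated by \<open>a n \<le> n\<^sup>2/4 + a\<^sup>2\<close>.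
\<close>

lemma energy_inequality:
  fixes H h :: "real \<Rightarrow> real"
  assumes u: "u \<in> Lip0 \<Omega>"
    and H: "\<And>s. (H has_real_derivative h s) (at s)" and h: "continuous_on UNIV h"
    and h0: "\<And>s. 0 \<le> h s" and H0: "H 0 = 0"
    and \<tau>: "0 \<le> \<tau>" "\<tau> \<le> 1"
    and small: "\<And>z. z \<in> Lip0 \<Omega> \<Longrightarrow> \<bar>G.ip (grad z) (grad u) + \<tau> * lower_order z u\<bar> \<le> \<delta> * D.N z"
  shows "(LINT x|M. h (u x) * (G.nrm x (grad u x))\<^sup>2) / 2
      \<le> \<delta> * D.N (\<lambda>x. H (u x)) + 2 * (LINT x|M. h (u x) * ((u x)\<^sup>2 * v x))"
proof -
  define \<phi> where "\<phi> x = H (u x)" for x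
  define \<psi> where "\<psi> x = u x * H (u x)" for x
  define P where "P = (LINT x|M. h (u x) * (G.nrm x (grad u x))\<^sup>2)"
  define S where "S = (LINT x|M. h (u x) * ((u x)\<^sup>2 * v x))"
  have Hc: "continuous_on UNIV H" using H by (meson DERIV_continuous continuous_at_imp_continuous_on)
  have \<phi>: "\<phi> \<in> Lip0 \<Omega>" unfolding \<phi>_def using u H h H0 by (rule Lip0_compose)
  have grad_\<phi>: "AE x in M. grad \<phi> x = h (u x) *\<^sub>R grad u x"
    unfolding \<phi>_def[abs_def] by (rule AE_M, rule grad_compose_ae[OF u H])
  note hE = compose_scale_grad_E[OF u h]
  have Pi: "integrable M (\<lambda>x. h (u x) * (G.nrm x (grad u x))\<^sup>2)"
    by (rule compose_mult_integrable[OF u h G.E_integrable_nrm[OF grad_E[OF u]]])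
  have Si: "integrable M (\<lambda>x. h (u x) * ((u x)\<^sup>2 * v x))"
    using compose_mult_integrable[OF u h V.E_integrable[OF Lip0_E[OF u]]] by (simp add: power2_eq_square)
  have P0: "0 \<le> P" unfolding P_def using h0 by (intro integral_nonneg_AE AE_I2) auto
  have S0: "0 \<le> S" unfolding S_def using h0 v_nonneg by (intro integral_nonneg_AE AE_I2) auto
  have ip_P: "G.ip (grad \<phi>) (grad u) = P"
  proof -
    have "G.ip (grad \<phi>) (grad u) = G.ip (\<lambda>x. h (u x) *\<^sub>R grad u x) (grad u)"
      by (rule G_ip_cong_AE[OF grad_\<phi> grad_E[OF \<phi>] hE grad_E[OF u]])
    also have "\<dots> = P" unfolding G.ip_def P_def
      by (intro Bochner_Integration.integral_cong) (auto simp: matrix_vector_mult_scaleR G.nrm_power2)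
    finally show ?thesis .
  qed
  have drift_le: "\<bar>drift w u (grad \<phi>)\<bar> \<le> P / 4 + S"
    if w: "w \<in> borel_measurable M" "degenerate_subunit \<Omega> v Q w" for w
  proof -
    have "drift w u (grad \<phi>) = drift w u (\<lambda>x. h (u x) *\<^sub>R grad u x)"
      by (rule drift_cong_AE[OF w Lip0_E[OF u] grad_E[OF \<phi>] hE grad_\<phi>])
    also have "\<bar>\<dots>\<bar> \<le> (LINT x|M. \<bar>u x * (w x \<bullet> (h (u x) *\<^sub>R grad u x)) * v x\<bar>)"
      unfolding drift_def by (rule integral_abs_bound)
    also have "\<dots> \<le> (LINT x|M. h (u x) * (G.nrm x (grad u x))\<^sup>2 / 4 + h (u x) * ((u x)\<^sup>2 * v x))"
    proof (rule integral_mono_AE)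
      show "integrable M (\<lambda>x. \<bar>u x * (w x \<bullet> (h (u x) *\<^sub>R grad u x)) * v x\<bar>)"
        using drift_bound(1)[OF w Lip0_E[OF u] hE] by (rule integrable_abs)
      show "integrable M (\<lambda>x. h (u x) * (G.nrm x (grad u x))\<^sup>2 / 4 + h (u x) * ((u x)\<^sup>2 * v x))"
        using Pi Si by simp
      show "AE x in M. \<bar>u x * (w x \<bullet> (h (u x) *\<^sub>R grad u x)) * v x\<bar>
          \<le> h (u x) * (G.nrm x (grad u x))\<^sup>2 / 4 + h (u x) * ((u x)\<^sup>2 * v x)"
        using drift_pointwise[OF w(2)] AE_space
      proof eventually_elim
        fix x assume *: "\<forall>s \<xi>. \<bar>s * (w x \<bullet> \<xi>) * v x\<bar> \<le> V.nrm x s * G.nrm x \<xi>" and x: "x \<in> space M"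
        define a n where "a = V.nrm x (u x)" and "n = G.nrm x (grad u x)"
        have "0 \<le> (n / 2 - a)\<^sup>2" by simp
        then have an: "a * n \<le> n\<^sup>2 / 4 + a\<^sup>2" by (simp add: power2_diff power_divide mult.commute)
        have "\<bar>u x * (w x \<bullet> (h (u x) *\<^sub>R grad u x)) * v x\<bar> = h (u x) * \<bar>u x * (w x \<bullet> grad u x) * v x\<bar>"
          using h0[of "u x"] by (simp add: abs_mult)
        also have "\<dots> \<le> h (u x) * (a * n)"
          unfolding a_def n_def using * h0 by (intro mult_left_mono) auto
        also have "\<dots> \<le> h (u x) * (n\<^sup>2 / 4 + a\<^sup>2)" using an h0 by (intro mult_left_mono)
        also have "a\<^sup>2 = (u x)\<^sup>2 * v x"
          unfolding a_def V.nrm_power2[OF x] by (simp add: power2_eq_square)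
        finally show "\<bar>u x * (w x \<bullet> (h (u x) *\<^sub>R grad u x)) * v x\<bar>
          \<le> h (u x) * (G.nrm x (grad u x))\<^sup>2 / 4 + h (u x) * ((u x)\<^sup>2 * v x)"
          by (simp add: n_def distrib_left)
      qed
    qed
    also have "\<dots> = P / 4 + S" using Pi Si by (simp add: P_def S_def)
    finally show ?thesis .
  qed
  have "react \<phi> u \<le> drift c \<phi> (grad u) + drift c u (grad \<phi>)"
  proof -
    have K: "((\<lambda>s. s * H s) has_real_derivative (H s + s * h s)) (at s)" for s
      using H[of s] by (auto intro!: derivative_eq_intros)
    have Kc: "continuous_on UNIV (\<lambda>s. H s + s * h s)" using Hc h by (intro continuous_intros)
    have \<psi>: "\<psi> \<in> Lip0 \<Omega>" unfolding \<psi>_def[abs_def] using Lip0_compose[OF u K Kc] by simp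
    have grad_\<psi>: "AE x in M. grad \<psi> x = (H (u x) + u x * h (u x)) *\<^sub>R grad u x"
      unfolding \<psi>_def[abs_def] by (rule AE_M, rule grad_compose_ae[OF u K])
    have mono: "H s \<le> H t" if "s \<le> t" for s t
      using that H h0 by (intro DERIV_nonneg_imp_nondecreasing[of s t H]) auto
    have "0 \<le> \<psi> x" for x
      using mono[of 0 "u x"] mono[of "u x" 0] H0 unfolding \<psi>_def
      by (cases "0 \<le> u x") (auto simp: mult_nonpos_nonpos)
    then have "(LINT x|M. (d x * \<psi> x - c x \<bullet> grad \<psi> x) * v x) \<le> 0"
      using \<psi> by (intro nonpositivity) (simp_all add: QLip0_eq)
    moreover have "(LINT x|M. (d x * \<psi> x - c x \<bullet> grad \<psi> x) * v x)
        = (LINT x|M. d x * \<phi> x * u x * v x - (\<phi> x * (c x \<bullet> grad u x) * v x + u x * (c x \<bullet> (h (u x) *\<^sub>R grad u x)) * v x))"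
    proof (rule integral_cong_AE)
      show "(\<lambda>x. (d x * \<psi> x - c x \<bullet> grad \<psi> x) * v x) \<in> borel_measurable M"
        using V.E_measurable[OF d_E] Lip0_measurable[OF \<psi>] grad_measurable[OF \<psi>] c_measurable by simp
      show "(\<lambda>x. d x * \<phi> x * u x * v x - (\<phi> x * (c x \<bullet> grad u x) * v x + u x * (c x \<bullet> (h (u x) *\<^sub>R grad u x)) * v x))
          \<in> borel_measurable M"
        using V.E_measurable[OF d_E] Lip0_measurable[OF \<phi>] Lip0_measurable[OF u] grad_measurable[OF u]
          compose_measurable[OF u h] c_measurable by simp
      show "AE x in M. (d x * \<psi> x - c x \<bullet> grad \<psi> x) * v x
          = d x * \<phi> x * u x * v x - (\<phi> x * (c x \<bullet> grad u x) * v x + u x * (c x \<bullet> (h (u x) *\<^sub>R grad u x)) * v x)"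
        using grad_\<psi> by eventually_elim (simp add: \<psi>_def \<phi>_def algebra_simps)
    qed
    moreover have "\<dots> = react \<phi> u - (drift c \<phi> (grad u) + drift c u (\<lambda>x. h (u x) *\<^sub>R grad u x))"
      using V.form_integrable[OF Lip0_mult_E[OF \<phi> d_E] Lip0_E[OF u]]
        drift_bound(1)[OF c_measurable c_subunit Lip0_E[OF \<phi>] grad_E[OF u]]
        drift_bound(1)[OF c_measurable c_subunit Lip0_E[OF u] hE]
      by (simp add: react_def drift_def)
    moreover have "drift c u (grad \<phi>) = drift c u (\<lambda>x. h (u x) *\<^sub>R grad u x)"
      by (rule drift_cong_AE[OF c_measurable c_subunit Lip0_E[OF u] grad_E[OF \<phi>] hE grad_\<phi>])
    ultimately show ?thesis by simp
  qed
  then have "- (P / 2 + 2 * S) \<le> lower_order \<phi> u"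
    using drift_le[OF b_measurable b_subunit] drift_le[OF c_measurable c_subunit]
    unfolding lower_order_def by (simp add: abs_le_iff)
  then have "\<tau> * (- (P / 2 + 2 * S)) \<le> \<tau> * lower_order \<phi> u" using \<tau>(1) by (intro mult_left_mono)
  moreover have "\<tau> * (P / 2 + 2 * S) \<le> 1 * (P / 2 + 2 * S)"
    using \<tau>(2) P0 S0 by (intro mult_right_mono) auto
  moreover have "P + \<tau> * lower_order \<phi> u \<le> \<delta> * D.N \<phi>"
    using small[OF \<phi>] ip_P by (simp add: abs_le_iff)
  ultimately have "P / 2 \<le> \<delta> * D.N \<phi> + 2 * S" unfolding mult_minus_right mult_1_left by linarith
  then show ?thesis by (simp add: P_def S_def \<phi>_def[abs_def])
qed

lemma N_compose:
  fixes H h :: "real \<Rightarrow> real"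
  assumes u: "u \<in> Lip0 \<Omega>" and H: "\<And>s. (H has_real_derivative h s) (at s)"
    and h: "continuous_on UNIV h" and H0: "H 0 = 0"
  shows "(D.N (\<lambda>x. H (u x)))\<^sup>2 = (LINT x|M. (h (u x))\<^sup>2 * (G.nrm x (grad u x))\<^sup>2)"
    and "integrable M (\<lambda>x. (h (u x))\<^sup>2 * (G.nrm x (grad u x))\<^sup>2)"
proof -
  have \<phi>: "(\<lambda>x. H (u x)) \<in> Lip0 \<Omega>" using u H h H0 by (rule Lip0_compose)
  have g: "AE x in M. grad (\<lambda>x. H (u x)) x = h (u x) *\<^sub>R grad u x"
    by (rule AE_M, rule grad_compose_ae[OF u H])
  note hE = compose_scale_grad_E[OF u h]
  have "(D.N (\<lambda>x. H (u x)))\<^sup>2 = G.ip (grad (\<lambda>x. H (u x))) (grad (\<lambda>x. H (u x)))"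
    by (rule D.N_power2[OF \<phi>])
  also have "\<dots> = G.ip (\<lambda>x. h (u x) *\<^sub>R grad u x) (grad (\<lambda>x. H (u x)))"
    by (rule G_ip_cong_AE[OF g grad_E[OF \<phi>] hE grad_E[OF \<phi>]])
  also have "\<dots> = G.ip (grad (\<lambda>x. H (u x))) (\<lambda>x. h (u x) *\<^sub>R grad u x)"
    by (rule G.L2.ip_commute[OF hE grad_E[OF \<phi>]])
  also have "\<dots> = G.ip (\<lambda>x. h (u x) *\<^sub>R grad u x) (\<lambda>x. h (u x) *\<^sub>R grad u x)"
    by (rule G_ip_cong_AE[OF g grad_E[OF \<phi>] hE hE])
  also have "\<dots> = (LINT x|M. (h (u x))\<^sup>2 * (G.nrm x (grad u x))\<^sup>2)"
    unfolding G.ip_def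
    by (intro Bochner_Integration.integral_cong)
      (auto simp: matrix_vector_mult_scaleR G.nrm_power2 power2_eq_square[of "h _"])
  finally show "(D.N (\<lambda>x. H (u x)))\<^sup>2 = (LINT x|M. (h (u x))\<^sup>2 * (G.nrm x (grad u x))\<^sup>2)" .
  have "continuous_on UNIV (\<lambda>s. (h s)\<^sup>2)" using h by (intro continuous_intros)
  from compose_mult_integrable[OF u this G.E_integrable_nrm[OF grad_E[OF u]]]
  show "integrable M (\<lambda>x. (h (u x))\<^sup>2 * (G.nrm x (grad u x))\<^sup>2)" .
qed

lemma D_N_power2_integral: "u \<in> Lip0 \<Omega> \<Longrightarrow> (D.N u)\<^sup>2 = (LINT x|M. (G.nrm x (grad u x))\<^sup>2)"
  unfolding D_N_eq by (rule G.N_power2_eq)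

lemma V_N_power2: "u \<in> V.E \<Longrightarrow> (V.L2.N u)\<^sup>2 = (LINT x|M. (u x)\<^sup>2 * v x)"
  using V.L2.N_power2[of u] by (simp add: V.ip_def power2_eq_square)

lemma V_integrable: "u \<in> V.E \<Longrightarrow> integrable M (\<lambda>x. (u x)\<^sup>2 * v x)"
  using V.E_integrable by (simp add: power2_eq_square)

text \<open>
  Garding's inequality: the energy inequality for \<open>H(s) = s\<close>.
\<close>

lemma adjoint_L2_bound:
  assumes u: "u \<in> Lip0 \<Omega>" and Nu: "D.N u = 1" and \<tau>: "0 \<le> \<tau>" "\<tau> \<le> 1"
    and small: "\<And>z. z \<in> Lip0 \<Omega> \<Longrightarrow> \<bar>G.ip (grad z) (grad u) + \<tau> * lower_order z u\<bar> \<le> \<delta> * D.N z"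
  shows "1 / 2 \<le> \<delta> + 2 * (LINT x|M. (u x)\<^sup>2 * v x)"
proof -
  have "(LINT x|M. 1 * (G.nrm x (grad u x))\<^sup>2) / 2
      \<le> \<delta> * D.N (\<lambda>x. u x) + 2 * (LINT x|M. 1 * ((u x)\<^sup>2 * v x))"
    using \<tau> small by (intro energy_inequality[OF u, of "\<lambda>s. s" "\<lambda>s. 1"]) auto
  then show ?thesis using D_N_power2_integral[OF u] Nu by simp
qed

text \<open>
  The energy inequality for \<open>H(s) = arctan (s/\<epsilon>) / \<epsilon>\<close>, for which \<open>H'(s) = 1 / (\<epsilon>\<^sup>2 + s\<^sup>2)\<close>. It dominates a quarter of
  the squared derivative of \<open>ln (1 + (s/\<epsilon>)\<^sup>2)\<close>, and the bound obtained does not depend on \<open>u\<close> or \<open>\<epsilon>\<close>.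
\<close>

lemma adjoint_log_bound:
  assumes u: "u \<in> Lip0 \<Omega>" and Nu: "D.N u = 1" and \<tau>: "0 \<le> \<tau>" "\<tau> \<le> 1"
    and small: "\<And>z. z \<in> Lip0 \<Omega> \<Longrightarrow> \<bar>G.ip (grad z) (grad u) + \<tau> * lower_order z u\<bar> \<le> \<delta> * D.N z"
    and \<epsilon>: "0 < \<epsilon>" and \<delta>: "0 \<le> \<delta>" "\<delta> \<le> \<epsilon>\<^sup>2"
  defines "L \<equiv> \<lambda>x. ln (1 + (u x / \<epsilon>)\<^sup>2)"
  shows "L \<in> Lip0 \<Omega>" and "(LINT x|M. (L x)\<^sup>2 * v x) \<le> poincare_const\<^sup>2 * (8 * (1 + 2 * total_weight))"
proof -
  define h where "h s = 1 / (\<epsilon>\<^sup>2 + s\<^sup>2)" for s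
  define A where "A = (LINT x|M. h (u x) * (G.nrm x (grad u x))\<^sup>2)"
  have den: "0 < \<epsilon>\<^sup>2 + s\<^sup>2" for s using \<epsilon> by (simp add: add_pos_nonneg)
  have h0: "0 \<le> h s" for s using den[of s] by (simp add: h_def)
  have h_le: "h s \<le> 1 / \<epsilon>\<^sup>2" for s unfolding h_def using \<epsilon> by (intro divide_left_mono) (auto simp: add_pos_nonneg)
  have hc: "continuous_on UNIV h" unfolding h_def using den
    by (intro continuous_intros) (auto simp: less_imp_neq[symmetric] dest: less_imp_neq)
  have H: "((\<lambda>s. arctan (s / \<epsilon>) / \<epsilon>) has_real_derivative h s) (at s)" for s
  proof -
    have "((\<lambda>s. arctan (s / \<epsilon>) / \<epsilon>) has_real_derivative (inverse (1 + (s / \<epsilon>)\<^sup>2) * (1 / \<epsilon>)) / \<epsilon>) (at s)"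
      using \<epsilon> by (auto intro!: derivative_eq_intros)
    also have "(inverse (1 + (s / \<epsilon>)\<^sup>2) * (1 / \<epsilon>)) / \<epsilon> = h s"
    proof -
      have "1 + (s / \<epsilon>)\<^sup>2 = (\<epsilon>\<^sup>2 + s\<^sup>2) / \<epsilon>\<^sup>2" using \<epsilon> by (simp add: power_divide add_divide_distrib)
      then show ?thesis unfolding h_def using \<epsilon> by (simp add: power2_eq_square)
    qed
    finally show ?thesis .
  qed
  have "A / 2 \<le> \<delta> * D.N (\<lambda>x. arctan (u x / \<epsilon>) / \<epsilon>) + 2 * (LINT x|M. h (u x) * ((u x)\<^sup>2 * v x))"
    unfolding A_def using h0 \<tau> small by (intro energy_inequality[OF u H hc]) auto
  moreover have "(LINT x|M. h (u x) * ((u x)\<^sup>2 * v x)) \<le> total_weight"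
    unfolding total_weight_def
  proof (rule integral_mono_AE[OF compose_mult_integrable[OF u hc V_integrable[OF Lip0_E[OF u]]] integrable_v AE_I2])
    fix x assume "x \<in> space M"
    then have "0 \<le> v x" using v_nonneg by simp
    moreover have "h (u x) * (u x)\<^sup>2 \<le> 1" unfolding h_def using den[of "u x"] by simp
    ultimately show "h (u x) * ((u x)\<^sup>2 * v x) \<le> v x"
      using mult_right_mono[of "h (u x) * (u x)\<^sup>2" 1 "v x"] by (simp add: mult.assoc)
  qed
  moreover have "D.N (\<lambda>x. arctan (u x / \<epsilon>) / \<epsilon>) \<le> 1 / \<epsilon>\<^sup>2"
  proof (rule power2_le_imp_le)
    have "(D.N (\<lambda>x. arctan (u x / \<epsilon>) / \<epsilon>))\<^sup>2 = (LINT x|M. (h (u x))\<^sup>2 * (G.nrm x (grad u x))\<^sup>2)"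
      by (rule N_compose(1)[OF u H hc]) simp
    also have "\<dots> \<le> (LINT x|M. (1 / \<epsilon>\<^sup>2)\<^sup>2 * (G.nrm x (grad u x))\<^sup>2)"
    proof (rule integral_mono_AE)
      show "integrable M (\<lambda>x. (h (u x))\<^sup>2 * (G.nrm x (grad u x))\<^sup>2)"
        by (rule N_compose(2)[OF u H hc]) simp
      show "integrable M (\<lambda>x. (1 / \<epsilon>\<^sup>2)\<^sup>2 * (G.nrm x (grad u x))\<^sup>2)"
        using G.E_integrable_nrm[OF grad_E[OF u]] by simp
      show "AE x in M. (h (u x))\<^sup>2 * (G.nrm x (grad u x))\<^sup>2 \<le> (1 / \<epsilon>\<^sup>2)\<^sup>2 * (G.nrm x (grad u x))\<^sup>2"
        using h0 h_le by (intro AE_I2 mult_right_mono power_mono) auto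
    qed
    also have "\<dots> = (1 / \<epsilon>\<^sup>2)\<^sup>2 * (D.N u)\<^sup>2" by (simp add: D_N_power2_integral[OF u])
    finally show "(D.N (\<lambda>x. arctan (u x / \<epsilon>) / \<epsilon>))\<^sup>2 \<le> (1 / \<epsilon>\<^sup>2)\<^sup>2" using Nu by simp
  qed simp
  then have "\<delta> * D.N (\<lambda>x. arctan (u x / \<epsilon>) / \<epsilon>) \<le> \<epsilon>\<^sup>2 * (1 / \<epsilon>\<^sup>2)"
    using \<delta> \<epsilon> by (intro mult_mono) (auto intro!: D.N_ge_0 Lip0_compose[OF u H hc])
  then have "\<delta> * D.N (\<lambda>x. arctan (u x / \<epsilon>) / \<epsilon>) \<le> 1" using \<epsilon> by simp
  ultimately have A_le: "A \<le> 2 * (1 + 2 * total_weight)" by simp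
  define l where "l s = 2 * s / (\<epsilon>\<^sup>2 + s\<^sup>2)" for s
  have lc: "continuous_on UNIV l" unfolding l_def using den
    by (intro continuous_intros) (auto simp: less_imp_neq[symmetric] dest: less_imp_neq)
  have LH: "((\<lambda>s. ln (1 + (s / \<epsilon>)\<^sup>2)) has_real_derivative l s) (at s)" for s
  proof -
    have pos: "0 < 1 + (s / \<epsilon>)\<^sup>2" by (simp add: add_pos_nonneg)
    have "((\<lambda>s. ln (1 + (s / \<epsilon>)\<^sup>2)) has_real_derivative (2 * (s / \<epsilon>) * (1 / \<epsilon>)) / (1 + (s / \<epsilon>)\<^sup>2)) (at s)"
      using pos \<epsilon> by (auto intro!: derivative_eq_intros)
    also have "(2 * (s / \<epsilon>) * (1 / \<epsilon>)) / (1 + (s / \<epsilon>)\<^sup>2) = l s"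
    proof -
      have "1 + (s / \<epsilon>)\<^sup>2 = (\<epsilon>\<^sup>2 + s\<^sup>2) / \<epsilon>\<^sup>2" using \<epsilon> by (simp add: power_divide add_divide_distrib)
      then show ?thesis unfolding l_def using \<epsilon> by (simp add: power2_eq_square)
    qed
    finally show ?thesis .
  qed
  show L: "L \<in> Lip0 \<Omega>" unfolding L_def using Lip0_compose[OF u LH lc] by simp
  have "(D.N L)\<^sup>2 = (LINT x|M. (l (u x))\<^sup>2 * (G.nrm x (grad u x))\<^sup>2)"
    unfolding L_def by (rule N_compose(1)[OF u LH lc]) simp
  also have "\<dots> \<le> (LINT x|M. 4 * (h (u x) * (G.nrm x (grad u x))\<^sup>2))"
  proof (rule integral_mono_AE)
    show "integrable M (\<lambda>x. (l (u x))\<^sup>2 * (G.nrm x (grad u x))\<^sup>2)"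
      by (rule N_compose(2)[OF u LH lc]) simp
    show "integrable M (\<lambda>x. 4 * (h (u x) * (G.nrm x (grad u x))\<^sup>2))"
      using compose_mult_integrable[OF u hc G.E_integrable_nrm[OF grad_E[OF u]]] by simp
    have "(l s)\<^sup>2 \<le> 4 * h s" for s
    proof -
      have "(l s)\<^sup>2 = 4 * h s * (s\<^sup>2 / (\<epsilon>\<^sup>2 + s\<^sup>2))"
        by (simp add: l_def h_def power_divide power2_eq_square)
      also have "\<dots> \<le> 4 * h s * 1" using h0[of s] den[of s] by (intro mult_left_mono) auto
      finally show ?thesis by simp
    qed
    then show "AE x in M. (l (u x))\<^sup>2 * (G.nrm x (grad u x))\<^sup>2 \<le> 4 * (h (u x) * (G.nrm x (grad u x))\<^sup>2)"
      unfolding mult.assoc[symmetric] by (intro AE_I2 mult_right_mono) auto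
  qed
  also have "\<dots> = 4 * A" by (simp add: A_def)
  finally have NL: "(D.N L)\<^sup>2 \<le> 8 * (1 + 2 * total_weight)" using A_le by linarith
  have "(LINT x|M. (L x)\<^sup>2 * v x) = (V.L2.N L)\<^sup>2" using V_N_power2[OF Lip0_E[OF L]] by simp
  also have "\<dots> \<le> (poincare_const * D.N L)\<^sup>2"
    using Poincare[OF L] V.L2.N_ge_0[OF Lip0_E[OF L]] by (intro power_mono)
  also have "\<dots> = poincare_const\<^sup>2 * (D.N L)\<^sup>2" by (rule power_mult_distrib)
  also have "\<dots> \<le> poincare_const\<^sup>2 * (8 * (1 + 2 * total_weight))" using NL by (intro mult_left_mono) auto
  finally show "(LINT x|M. (L x)\<^sup>2 * v x) \<le> poincare_const\<^sup>2 * (8 * (1 + 2 * total_weight))" .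
qed

text \<open>
  Splits \<open>y\<^sup>2\<close> according to whether \<open>|y| \<le> s\<close>, or \<open>|y| > s\<close> but \<open>y\<^sup>2 \<le> \<Lambda>\<close>, or \<open>y\<^sup>2 > \<Lambda>\<close>. The middle part is a
  Chebyshev inequality for a function \<open>L\<close> that exceeds \<open>l\<close> where \<open>|y| > s\<close>.
\<close>

lemma square_split:
  fixes y s \<Lambda> l L :: real
  assumes \<Lambda>: "0 < \<Lambda>" and l: "0 < l" and L: "s < \<bar>y\<bar> \<Longrightarrow> l \<le> L" and s: "0 \<le> s"
  shows "y\<^sup>2 \<le> s\<^sup>2 + \<Lambda> / l\<^sup>2 * L\<^sup>2 + \<Lambda> powr (1 - \<sigma>) * \<bar>y\<bar> powr (2 * \<sigma>)"
proof -
  have nn: "0 \<le> \<Lambda> / l\<^sup>2 * L\<^sup>2" "0 \<le> \<Lambda> powr (1 - \<sigma>) * \<bar>y\<bar> powr (2 * \<sigma>)" "0 \<le> s\<^sup>2" using \<Lambda> by auto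
  show ?thesis
  proof (cases "\<bar>y\<bar> \<le> s")
    case True
    then have "y\<^sup>2 \<le> s\<^sup>2" using s by (simp add: abs_le_square_iff[symmetric])
    then show ?thesis using nn by linarith
  next
    case False
    then have lL: "l \<le> L" using L by simp
    show ?thesis
    proof (cases "y\<^sup>2 \<le> \<Lambda>")
      case True
      have "l\<^sup>2 \<le> L\<^sup>2" using lL l by (intro power_mono) auto
      then have "\<Lambda> / l\<^sup>2 * l\<^sup>2 \<le> \<Lambda> / l\<^sup>2 * L\<^sup>2" using \<Lambda> by (intro mult_left_mono) auto
      then have "\<Lambda> \<le> \<Lambda> / l\<^sup>2 * L\<^sup>2" using l by simp
      then show ?thesis using True nn by linarith
    next
      case big: False
      then have y2: "0 < y\<^sup>2" using \<Lambda> by linarith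
      then have "\<bar>y\<bar> powr (2 * \<sigma>) = (y\<^sup>2) powr \<sigma>"
        by (simp add: powr_powr[of "\<bar>y\<bar>" 2, symmetric])
      also have "\<dots> = y\<^sup>2 * (y\<^sup>2) powr (\<sigma> - 1)" using y2 by (simp add: powr_diff)
      finally have eq: "\<bar>y\<bar> powr (2 * \<sigma>) = y\<^sup>2 * (y\<^sup>2) powr (\<sigma> - 1)" .
      have "\<Lambda> powr (\<sigma> - 1) \<le> (y\<^sup>2) powr (\<sigma> - 1)" using big \<Lambda> \<sigma> by (intro powr_mono2) auto
      then have "\<Lambda> powr (1 - \<sigma>) * \<Lambda> powr (\<sigma> - 1) \<le> \<Lambda> powr (1 - \<sigma>) * (y\<^sup>2) powr (\<sigma> - 1)"
        by (intro mult_left_mono) auto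
      then have "1 \<le> \<Lambda> powr (1 - \<sigma>) * (y\<^sup>2) powr (\<sigma> - 1)" using \<Lambda> by (simp flip: powr_add)
      then have "y\<^sup>2 * 1 \<le> y\<^sup>2 * (\<Lambda> powr (1 - \<sigma>) * (y\<^sup>2) powr (\<sigma> - 1))" by (intro mult_left_mono) auto
      then have "y\<^sup>2 \<le> \<Lambda> powr (1 - \<sigma>) * \<bar>y\<bar> powr (2 * \<sigma>)" unfolding eq by (simp add: mult_ac)
      then show ?thesis using nn by linarith
    qed
  qed
qed

text \<open>
  The constants \<open>s\<close>, \<open>\<Lambda>\<close> and \<open>\<epsilon>\<close> are chosen in this order so that each of the three parts of
  \<open>square_split\<close> contributes at most \<open>1/32\<close> to \<open>\<integral> u\<^sup>2 v\<close>. If \<open>\<delta>\<close> were smaller than \<open>\<kappa>\<close>, this would contradict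
  \<open>adjoint_L2_bound\<close>.
\<close>

lemma adjoint_bounded_below_unit:
  "\<exists>\<kappa>>0. \<forall>\<tau> u \<delta>. 0 \<le> \<tau> \<longrightarrow> \<tau> \<le> 1 \<longrightarrow> u \<in> Lip0 \<Omega> \<longrightarrow> D.N u = 1 \<longrightarrow> 0 \<le> \<delta> \<longrightarrow>
     (\<forall>z\<in>Lip0 \<Omega>. \<bar>G.ip (grad z) (grad u) + \<tau> * lower_order z u\<bar> \<le> \<delta> * D.N z) \<longrightarrow> \<kappa> \<le> \<delta>"
proof -
  define s where "s = sqrt (1 / (32 * (total_weight + 1)))"
  define \<Lambda> where "\<Lambda> = (32 * C powr (2 * \<sigma>)) powr (1 / (\<sigma> - 1))"
  \<comment> \<open>The number \<open>l\<close> is the value of \<open>ln (1 + (s/\<epsilon>)\<^sup>2)\<close>; it is prescribed first, and \<open>\<epsilon>\<close> is computed from it.\<close>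
  define W where "W = \<Lambda> * poincare_const\<^sup>2 * (1 + 2 * total_weight)"
  define l where "l = 16 * sqrt W + 1"
  define \<epsilon> where "\<epsilon> = s / sqrt (exp l - 1)"
  have V1: "0 < total_weight + 1" using total_weight_nonneg by simp
  have s: "0 < s" unfolding s_def using V1 by simp
  have s2: "s\<^sup>2 * total_weight \<le> 1 / 32" unfolding s_def using V1 total_weight_nonneg by (simp add: field_simps)
  have \<Lambda>: "0 < \<Lambda>" unfolding \<Lambda>_def using C_pos by simp
  have \<Lambda>': "\<Lambda> powr (1 - \<sigma>) = 1 / (32 * C powr (2 * \<sigma>))"
  proof -
    have "1 / (\<sigma> - 1) * (1 - \<sigma>) = - 1" using \<sigma> by (simp add: field_simps)
    then have "\<Lambda> powr (1 - \<sigma>) = (32 * C powr (2 * \<sigma>)) powr (- 1)"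
      unfolding \<Lambda>_def powr_powr by (simp only:)
    also have "\<dots> = 1 / (32 * C powr (2 * \<sigma>))" using C_pos by (intro powr_neg_one) simp
    finally show ?thesis .
  qed
  have W: "0 \<le> W" unfolding W_def using \<Lambda> total_weight_nonneg by simp
  have l: "0 < l" unfolding l_def using W by (simp add: add_nonneg_pos)
  have lW: "256 * W \<le> l\<^sup>2"
  proof -
    have "256 * W = (16 * sqrt W)\<^sup>2" using W by (simp add: power_mult_distrib)
    also have "\<dots> \<le> l\<^sup>2" unfolding l_def using W by (intro power_mono) auto
    finally show ?thesis .
  qed
  have el: "0 < exp l - 1" using l by simp
  have \<epsilon>: "0 < \<epsilon>" unfolding \<epsilon>_def using s el by simp
  have s\<epsilon>: "(s / \<epsilon>)\<^sup>2 = exp l - 1" unfolding \<epsilon>_def using s el by (simp add: power_divide)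
  define \<kappa> where "\<kappa> = min (1 / 16) (\<epsilon>\<^sup>2)"
  have "\<kappa> \<le> \<delta>" if \<tau>: "0 \<le> \<tau>" "\<tau> \<le> 1" and u: "u \<in> Lip0 \<Omega>" and Nu: "D.N u = 1" and \<delta>: "0 \<le> \<delta>"
    and small: "\<forall>z\<in>Lip0 \<Omega>. \<bar>G.ip (grad z) (grad u) + \<tau> * lower_order z u\<bar> \<le> \<delta> * D.N z" for \<tau> u \<delta>
  proof (rule ccontr)
    assume "\<not> \<kappa> \<le> \<delta>"
    then have d: "\<delta> < 1 / 16" "\<delta> \<le> \<epsilon>\<^sup>2" by (simp_all add: \<kappa>_def)
    define L where "L x = ln (1 + (u x / \<epsilon>)\<^sup>2)" for x
    note LB = adjoint_log_bound[OF u Nu \<tau> bspec[OF small] \<epsilon> \<delta> d(2), folded L_def]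
    note SM = Sobolev_moment[OF u C_pos, unfolded Nu mult_1_right, OF order_refl]
    have "(LINT x|M. (u x)\<^sup>2 * v x)
        \<le> (LINT x|M. s\<^sup>2 * v x + \<Lambda> / l\<^sup>2 * ((L x)\<^sup>2 * v x) + 1 / 32 * (\<bar>u x / C\<bar> powr (2 * \<sigma>) * v x))"
    proof (rule integral_mono_AE)
      show "integrable M (\<lambda>x. (u x)\<^sup>2 * v x)" by (rule V_integrable[OF Lip0_E[OF u]])
      show "integrable M (\<lambda>x. s\<^sup>2 * v x + \<Lambda> / l\<^sup>2 * ((L x)\<^sup>2 * v x) + 1 / 32 * (\<bar>u x / C\<bar> powr (2 * \<sigma>) * v x))"
        using integrable_v V_integrable[OF Lip0_E[OF LB(1)]] SM(1) by simp
      show "AE x in M. (u x)\<^sup>2 * v x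
          \<le> s\<^sup>2 * v x + \<Lambda> / l\<^sup>2 * ((L x)\<^sup>2 * v x) + 1 / 32 * (\<bar>u x / C\<bar> powr (2 * \<sigma>) * v x)"
      proof (rule AE_I2)
        fix x assume "x \<in> space M"
        then have v0: "0 \<le> v x" using v_nonneg by simp
        have "l \<le> L x" if "s < \<bar>u x\<bar>"
        proof -
          have "exp l = 1 + (s / \<epsilon>)\<^sup>2" using s\<epsilon> by simp
          also have "(s / \<epsilon>)\<^sup>2 \<le> (\<bar>u x\<bar> / \<epsilon>)\<^sup>2" using that s \<epsilon> by (intro power_mono divide_right_mono) auto
          also have "(\<bar>u x\<bar> / \<epsilon>)\<^sup>2 = (u x / \<epsilon>)\<^sup>2" by (simp add: power_divide)
          finally have "exp l \<le> 1 + (u x / \<epsilon>)\<^sup>2" by simp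
          then show ?thesis unfolding L_def by (subst ln_ge_iff) (simp_all add: add_pos_nonneg)
        qed
        then have "(u x)\<^sup>2 \<le> s\<^sup>2 + \<Lambda> / l\<^sup>2 * (L x)\<^sup>2 + \<Lambda> powr (1 - \<sigma>) * \<bar>u x\<bar> powr (2 * \<sigma>)"
          using \<Lambda> l s by (intro square_split) auto
        also have "\<Lambda> powr (1 - \<sigma>) * \<bar>u x\<bar> powr (2 * \<sigma>) = 1 / 32 * \<bar>u x / C\<bar> powr (2 * \<sigma>)"
          unfolding \<Lambda>' using C_pos by (simp add: powr_divide)
        finally have "(u x)\<^sup>2 * v x
            \<le> (s\<^sup>2 + \<Lambda> / l\<^sup>2 * (L x)\<^sup>2 + 1 / 32 * \<bar>u x / C\<bar> powr (2 * \<sigma>)) * v x"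
          using v0 by (rule mult_right_mono)
        then show "(u x)\<^sup>2 * v x
          \<le> s\<^sup>2 * v x + \<Lambda> / l\<^sup>2 * ((L x)\<^sup>2 * v x) + 1 / 32 * (\<bar>u x / C\<bar> powr (2 * \<sigma>) * v x)"
          by (simp only: distrib_right mult.assoc)
      qed
    qed
    also have "\<dots> = s\<^sup>2 * total_weight + \<Lambda> / l\<^sup>2 * (LINT x|M. (L x)\<^sup>2 * v x)
        + 1 / 32 * (LINT x|M. \<bar>u x / C\<bar> powr (2 * \<sigma>) * v x)"
      using integrable_v V_integrable[OF Lip0_E[OF LB(1)]] SM(1) by (simp add: total_weight_def)
    also have "\<dots> \<le> 1 / 32 + 1 / 32 + 1 / 32 * 1"
    proof (intro add_mono mult_left_mono s2)
      have "\<Lambda> / l\<^sup>2 * (LINT x|M. (L x)\<^sup>2 * v x) \<le> \<Lambda> / l\<^sup>2 * (poincare_const\<^sup>2 * (8 * (1 + 2 * total_weight)))"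
        using LB(2) \<Lambda> by (intro mult_left_mono) auto
      also have "\<dots> = 8 * W / l\<^sup>2" by (simp add: W_def)
      also have "\<dots> \<le> 1 / 32" using lW l by (simp add: field_simps)
      finally show "\<Lambda> / l\<^sup>2 * (LINT x|M. (L x)\<^sup>2 * v x) \<le> 1 / 32" .
    qed (use SM(2) in auto)
    finally have "(LINT x|M. (u x)\<^sup>2 * v x) \<le> 3 / 32" by simp
    moreover have "1 / 2 \<le> \<delta> + 2 * (LINT x|M. (u x)\<^sup>2 * v x)"
      by (rule adjoint_L2_bound[OF u Nu \<tau> bspec[OF small]])
    ultimately show False using d(1) by simp
  qed
  moreover have "0 < \<kappa>" unfolding \<kappa>_def using \<epsilon> by simp
  ultimately show ?thesis by blast
qed

lemma adjoint_bounded_below: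
  "\<exists>\<kappa>>0. \<forall>\<tau>. 0 \<le> \<tau> \<longrightarrow> \<tau> \<le> 1 \<longrightarrow>
     D.bounded_below (\<lambda>u z. G.ip (grad z) (grad u) + \<tau> * lower_order z u) \<kappa>"
proof -
  obtain \<kappa> where \<kappa>: "0 < \<kappa>" and unit: "\<And>\<tau> u \<delta>. 0 \<le> \<tau> \<Longrightarrow> \<tau> \<le> 1 \<Longrightarrow> u \<in> Lip0 \<Omega> \<Longrightarrow> D.N u = 1 \<Longrightarrow> 0 \<le> \<delta> \<Longrightarrow>
     (\<forall>z\<in>Lip0 \<Omega>. \<bar>G.ip (grad z) (grad u) + \<tau> * lower_order z u\<bar> \<le> \<delta> * D.N z) \<Longrightarrow> \<kappa> \<le> \<delta>"
    using adjoint_bounded_below_unit by metis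
  have "\<kappa> * D.N u \<le> \<delta>" if \<tau>: "0 \<le> \<tau>" "\<tau> \<le> 1" and u: "u \<in> Lip0 \<Omega>" and \<delta>: "0 \<le> \<delta>"
    and small: "\<forall>z\<in>Lip0 \<Omega>. \<bar>G.ip (grad z) (grad u) + \<tau> * lower_order z u\<bar> \<le> \<delta> * D.N z" for \<tau> u \<delta>
  proof (cases "D.N u = 0")
    case False
    then have N: "0 < D.N u" using D.N_ge_0[OF u] by simp
    define a where "a = 1 / D.N u"
    have a: "0 < a" using N by (simp add: a_def)
    \<comment> \<open>The normalised function \<open>a u\<close>, written with the only available operation.\<close>
    define w where "w x = (a - 1) * u x + u x" for x
    have w: "w \<in> Lip0 \<Omega>" unfolding w_def[abs_def] by (rule Lip0_combination[OF u u])
    have ip: "G.ip (grad w) (grad z) = a * G.ip (grad u) (grad z)" if z: "z \<in> Lip0 \<Omega>" for z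
      unfolding w_def[abs_def] using D.ip_comb[OF u u z, of "a - 1"] by (simp add: algebra_simps)
    have ip': "G.ip (grad z) (grad w) = a * G.ip (grad z) (grad u)" if z: "z \<in> Lip0 \<Omega>" for z
      unfolding w_def[abs_def] using D.ip_comb_right[OF u u z, of "a - 1"] by (simp add: algebra_simps)
    have lo: "lower_order z w = a * lower_order z u" if z: "z \<in> Lip0 \<Omega>" for z
    proof -
      have "lower_order z (\<lambda>x. (a - 1) * u x + u x) = (a - 1) * lower_order z u + lower_order z u"
        using lower_order_form[unfolded D.form_def] u z by blast
      then show ?thesis unfolding w_def[abs_def] by (simp add: left_diff_distrib)
    qed
    have "(D.N w)\<^sup>2 = (a * D.N u)\<^sup>2"
      using ip[OF w] ip'[OF u] D.N_power2[OF w] D.N_power2[OF u] by (simp add: power_mult_distrib power2_eq_square)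
    then have Nw: "D.N w = 1" using D.N_ge_0[OF w] N by (auto simp: a_def power2_eq_1_iff)
    have "\<bar>G.ip (grad z) (grad w) + \<tau> * lower_order z w\<bar> \<le> (a * \<delta>) * D.N z" if z: "z \<in> Lip0 \<Omega>" for z
    proof -
      have "G.ip (grad z) (grad w) + \<tau> * lower_order z w = a * (G.ip (grad z) (grad u) + \<tau> * lower_order z u)"
        using ip'[OF z] lo[OF z] by (simp add: algebra_simps)
      then have "\<bar>G.ip (grad z) (grad w) + \<tau> * lower_order z w\<bar> = a * \<bar>G.ip (grad z) (grad u) + \<tau> * lower_order z u\<bar>"
        using a by (simp add: abs_mult)
      also have "\<dots> \<le> a * (\<delta> * D.N z)" using small z a by (intro mult_left_mono) auto
      finally show ?thesis by (simp add: mult.assoc)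
    qed
    then have "\<kappa> \<le> a * \<delta>" using \<tau> w Nw \<delta> a by (intro unit[of \<tau> w]) auto
    then show ?thesis using N by (simp add: a_def field_simps)
  qed (use \<delta> in simp)
  then show ?thesis unfolding D.bounded_below_def using \<kappa> by blast
qed

section \<open>Existence and uniqueness\<close>

lemma V_nondegenerate: "AE x in M. \<exists>C. \<forall>\<xi>. norm \<xi> \<le> C * V.nrm x \<xi>"
proof -
  have "AE x in M. 0 < v x" using weight_v by (simp add: weight_def)
  then show ?thesis using AE_space
  proof eventually_elim
    fix x assume "0 < v x" "x \<in> space M"
    then show "\<exists>C. \<forall>\<xi>. norm \<xi> \<le> C * V.nrm x \<xi>"
      by (intro exI[of _ "1 / sqrt (v x)"]) (simp add: V_nrm)
  qed
qed

lemma G_nondegenerate: "AE x in M. \<exists>C. \<forall>\<xi>. norm \<xi> \<le> C * G.nrm x \<xi>"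
proof -
  have "AE x in M. invertible (Q x)" using matrix_Q by (simp add: matrix_function_def)
  then show ?thesis using AE_space
  proof eventually_elim
    fix x assume "invertible (Q x)" "x \<in> space M"
    then show "\<exists>C. \<forall>\<xi>. norm \<xi> \<le> C * G.nrm x \<xi>"
      using invertible_psd_norm_le[OF Q_psd] by (simp add: G_nrm)
  qed
qed

lemma QH0_iff:
  "(u, g) \<in> QH0 Q v \<Omega> \<longleftrightarrow> u \<in> V.E \<and> g \<in> G.E \<and>
     (\<forall>\<epsilon>>0. \<exists>\<phi>\<in>Lip0 \<Omega>. V.L2.N (\<lambda>x. \<phi> x - u x) + G.L2.N (\<lambda>x. grad \<phi> x - g x) < \<epsilon>)"
  unfolding QH0_def by (simp add: wLp_eq QL2_eq QLip0_eq wLp_norm_eq QL2_norm_eq)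

text \<open>
  The left-hand side of the weak equation, with the opposite sign, for a pair \<open>(u, g)\<close>.
\<close>

definition oper :: "(real ^ 'n \<Rightarrow> real) \<Rightarrow> (real ^ 'n \<Rightarrow> real ^ 'n) \<Rightarrow> (real ^ 'n \<Rightarrow> real) \<Rightarrow> real" where
  "oper u g \<phi> = G.ip g (grad \<phi>) - drift b \<phi> g + drift c u (grad \<phi>) - react u \<phi>"

lemma oper_Lip0: "oper u (grad u) \<phi> = G.ip (grad u) (grad \<phi>) + lower_order u \<phi>"
  by (simp add: oper_def lower_order_def)

lemma oper_diff:
  assumes u: "u \<in> V.E" "u' \<in> V.E" and g: "g \<in> G.E" "g' \<in> G.E" and \<phi>: "\<phi> \<in> Lip0 \<Omega>"
  shows "oper u g \<phi> - oper u' g' \<phi> = oper (\<lambda>x. u x - u' x) (\<lambda>x. g x - g' x) \<phi>"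
proof -
  have "G.ip (\<lambda>x. g x - g' x) (grad \<phi>) = G.ip g (grad \<phi>) - G.ip g' (grad \<phi>)"
    using G.L2.ip_comb[OF g(2,1) grad_E[OF \<phi>], of "-1"] by simp
  moreover have "drift b \<phi> (\<lambda>x. g x - g' x) = drift b \<phi> g - drift b \<phi> g'"
    using drift_combination_right[OF b_measurable b_subunit Lip0_E[OF \<phi>] g(2,1), of "-1"] by simp
  moreover have "drift c (\<lambda>x. u x - u' x) (grad \<phi>) = drift c u (grad \<phi>) - drift c u' (grad \<phi>)"
    using drift_combination_left[OF c_measurable c_subunit u(2,1) grad_E[OF \<phi>], of "-1"] by simp
  moreover have "react (\<lambda>x. u x - u' x) \<phi> = react u \<phi> - react u' \<phi>"
    using react_combination_left[OF u(2,1) \<phi>, of "-1"] by simp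
  ultimately show ?thesis by (simp add: oper_def)
qed

definition test_size :: "(real ^ 'n \<Rightarrow> real) \<Rightarrow> real" where
  "test_size \<phi> = D.N \<phi> + V.L2.N \<phi> + V.L2.N (\<lambda>x. d x * \<phi> x)"

text \<open>
  For a fixed test function the operator is continuous in the norm of \<open>L\<^sup>2(v) \<oplus> QL\<^sup>2\<close>, so that the weak
  equation passes to limits of pairs.
\<close>

lemma oper_bound:
  assumes u: "u \<in> V.E" and g: "g \<in> G.E" and \<phi>: "\<phi> \<in> Lip0 \<Omega>"
  shows "\<bar>oper u g \<phi>\<bar> \<le> test_size \<phi> * (V.L2.N u + G.L2.N g)"
proof -
  have "\<bar>G.ip g (grad \<phi>)\<bar> \<le> G.L2.N g * D.N \<phi>"
    unfolding D_N_eq by (rule G.L2.Cauchy_Schwarz[OF g grad_E[OF \<phi>]])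
  moreover have "\<bar>drift b \<phi> g\<bar> \<le> V.L2.N \<phi> * G.L2.N g"
    by (rule drift_bound(2)[OF b_measurable b_subunit Lip0_E[OF \<phi>] g])
  moreover have "\<bar>drift c u (grad \<phi>)\<bar> \<le> V.L2.N u * D.N \<phi>"
    unfolding D_N_eq by (rule drift_bound(2)[OF c_measurable c_subunit u grad_E[OF \<phi>]])
  moreover have "\<bar>react u \<phi>\<bar> \<le> V.L2.N (\<lambda>x. d x * \<phi> x) * V.L2.N u"
    unfolding react_eq by (rule V.L2.Cauchy_Schwarz[OF Lip0_mult_E[OF \<phi> d_E] u])
  ultimately have "\<bar>oper u g \<phi>\<bar> \<le> G.L2.N g * D.N \<phi> + V.L2.N \<phi> * G.L2.N g + V.L2.N u * D.N \<phi>
      + V.L2.N (\<lambda>x. d x * \<phi> x) * V.L2.N u"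
    unfolding oper_def by linarith
  also have "\<dots> \<le> test_size \<phi> * (V.L2.N u + G.L2.N g)"
  proof -
    have "0 \<le> V.L2.N \<phi> * V.L2.N u" "0 \<le> V.L2.N (\<lambda>x. d x * \<phi> x) * G.L2.N g"
      using V.L2.N_ge_0[OF Lip0_E[OF \<phi>]] V.L2.N_ge_0[OF u] V.L2.N_ge_0[OF Lip0_mult_E[OF \<phi> d_E]] G.L2.N_ge_0[OF g]
      by simp_all
    then show ?thesis by (simp add: test_size_def algebra_simps)
  qed
  finally show ?thesis .
qed

lemma grad_diff_N:
  assumes "\<phi> \<in> Lip0 \<Omega>" "\<psi> \<in> Lip0 \<Omega>"
  shows "G.L2.N (\<lambda>x. grad \<phi> x - grad \<psi> x) = D.N (\<lambda>x. (-1) * \<psi> x + \<phi> x)"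
  unfolding D_N_eq
proof (rule G.N_cong_AE[symmetric])
  show "AE x in M. grad (\<lambda>x. (-1) * \<psi> x + \<phi> x) x = grad \<phi> x - grad \<psi> x"
    using grad_combination_M[OF assms(2,1), of "-1"] by eventually_elim simp
qed (intro grad_E Lip0_combination G.E_diff assms)+

lemma weak_solution_iff:
  "weak_solution \<Omega> v Q b c d f e h u g \<longleftrightarrow> (u, g) \<in> QH0 Q v \<Omega> \<and>
     (\<forall>\<phi>\<in>Lip0 \<Omega>. oper u g \<phi> = - V.ip f \<phi> + drift e h (grad \<phi>))"
proof -
  have "(LINT x|M. (b x \<bullet> g x) * \<phi> x * v x) = drift b \<phi> g" for \<phi>
    unfolding drift_def by (simp add: mult.commute[of "b _ \<bullet> g _"])
  then show ?thesis
    unfolding weak_solution_def QLip0_eq oper_def react_def G.ip_def V.ip_def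
    by (auto simp: drift_def[of c] drift_def[of e])
qed

text \<open>
  The lower bound turns small residuals into small distances. For approximate solutions \<open>U j\<close> it gives the
  Cauchy property; for test functions \<open>W j\<close> approximating another weak solution it shows that \<open>W j\<close> and
  \<open>U j\<close> are close.
\<close>

theorem Dirichlet_problem_well_posed:
  assumes f: "f \<in> wLp 2 v \<Omega>" and h: "h \<in> wLp 2 v \<Omega>"
    and e: "e \<in> borel_measurable (lebesgue_on \<Omega>)" "degenerate_subunit \<Omega> v Q e"
  shows "\<exists>u g. weak_solution \<Omega> v Q b c d f e h u g \<and>
           (\<forall>u' g'. weak_solution \<Omega> v Q b c d f e h u' g' \<longrightarrow>
              (AE x in lebesgue_on \<Omega>. u' x = u x \<and> g' x = g x))"
proof -
  have fE: "f \<in> V.E" and hE: "h \<in> V.E" using f h by (simp_all add: wLp_eq)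
  define B where "B u z = G.ip (grad u) (grad z) + lower_order u z" for u z
  define F where "F \<phi> = - V.ip f \<phi> + drift e h (grad \<phi>)" for \<phi>
  define K where "K = 1 + lower_order_const"
  obtain \<kappa> where \<kappa>: "0 < \<kappa>" and below: "\<And>\<tau>. 0 \<le> \<tau> \<Longrightarrow> \<tau> \<le> 1 \<Longrightarrow>
     D.bounded_below (\<lambda>u z. G.ip (grad z) (grad u) + \<tau> * lower_order z u) \<kappa>"
    using adjoint_bounded_below by blast
  have solv: "D.solvable B" and bb: "D.bounded_below B \<kappa>"
    using D.solvable_of_adjoint_bounded_below[OF lower_order_form \<kappa> below] by (simp_all add: B_def[abs_def])
  have formB: "D.form B K"
    using D.form_add[OF D.form_ip lower_order_form, of 1] by (simp add: B_def[abs_def] K_def)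
  have B_diff: "B (\<lambda>x. (-1) * w x + u x) z = B u z - B w z"
    if "u \<in> Lip0 \<Omega>" "w \<in> Lip0 \<Omega>" "z \<in> Lip0 \<Omega>" for u w z
  proof -
    have "B (\<lambda>x. (-1) * w x + u x) z = (-1) * B w z + B u z"
      using formB[unfolded D.form_def] that by blast
    then show ?thesis by simp
  qed
  have B_oper: "B u z = oper u (grad u) z" for u z by (simp add: B_def oper_Lip0)
  have F: "D.functional F (V.L2.N f * poincare_const + V.L2.N h)"
    unfolding D.functional_def
  proof (intro conjI ballI allI)
    fix u assume u: "u \<in> Lip0 \<Omega>"
    have "\<bar>V.ip f u\<bar> \<le> V.L2.N f * V.L2.N u" by (rule V.L2.Cauchy_Schwarz[OF fE Lip0_E[OF u]])
    also have "\<dots> \<le> V.L2.N f * (poincare_const * D.N u)" using Poincare[OF u] V.L2.N_ge_0[OF fE] by (rule mult_left_mono)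
    finally have "\<bar>V.ip f u\<bar> \<le> V.L2.N f * poincare_const * D.N u" by simp
    moreover have "\<bar>drift e h (grad u)\<bar> \<le> V.L2.N h * D.N u"
      unfolding D_N_eq by (rule drift_bound(2)[OF e hE grad_E[OF u]])
    ultimately show "\<bar>F u\<bar> \<le> (V.L2.N f * poincare_const + V.L2.N h) * D.N u"
      unfolding F_def distrib_right by linarith
  next
    fix u w a assume uw: "u \<in> Lip0 \<Omega>" "w \<in> Lip0 \<Omega>"
    show "F (\<lambda>x. a * u x + w x) = a * F u + F w"
      using V.L2.ip_comb_right[OF Lip0_E[OF uw(1)] Lip0_E[OF uw(2)] fE, of a]
        drift_grad_combination[OF e hE uw, of a]
      by (simp add: F_def algebra_simps)
  qed
  \<comment> \<open>The factor \<open>1 + poincare_const\<close> makes the approximations Cauchy at rate \<open>4\<^sup>-\<^sup>j\<close> in both norms.\<close>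
  define r where "r j = (1 / 4) ^ j / (1 + poincare_const)" for j :: nat
  define \<eta> where "\<eta> j = \<kappa> * r j / 2" for j :: nat
  have r: "0 < r j" for j unfolding r_def using poincare_const_nonneg by simp
  have \<eta>: "0 < \<eta> j" for j unfolding \<eta>_def using \<kappa> r by simp
  have r_mono: "r k \<le> r j" if "j \<le> k" for j k
    unfolding r_def using poincare_const_nonneg that by (intro divide_right_mono power_decreasing) auto
  have \<eta>_mono: "\<eta> k \<le> \<eta> j" if "j \<le> k" for j k
    unfolding \<eta>_def using \<kappa> r_mono[OF that] by simp
  have r_le: "r j \<le> (1 / 4) ^ j" for j
  proof -
    have "(1 / 4 :: real) ^ j / (1 + poincare_const) \<le> (1 / 4) ^ j / 1"
      using poincare_const_nonneg by (intro divide_left_mono) auto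
    then show ?thesis by (simp add: r_def)
  qed
  have poincare_const_r_le: "poincare_const * r j \<le> (1 / 4) ^ j" for j
  proof -
    have "poincare_const * r j \<le> (1 + poincare_const) * r j" using r[of j] by (intro mult_right_mono) auto
    also have "\<dots> = (1 / 4) ^ j" unfolding r_def using poincare_const_nonneg by simp
    finally show ?thesis .
  qed
  have \<eta>_le: "\<eta> j \<le> \<kappa> * (1 / 4) ^ j" for j
  proof -
    have "\<eta> j \<le> \<kappa> * r j" unfolding \<eta>_def using \<kappa> r[of j] by simp
    also have "\<dots> \<le> \<kappa> * (1 / 4) ^ j" using \<kappa> r_le by (intro mult_left_mono) auto
    finally show ?thesis .
  qed
  have "\<exists>u\<in>Lip0 \<Omega>. \<forall>z\<in>Lip0 \<Omega>. \<bar>B u z - F z\<bar> \<le> \<eta> j * D.N z" for j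
    using solv[unfolded D.solvable_def, rule_format, OF F \<eta>] .
  then obtain U where U: "\<And>j. U j \<in> Lip0 \<Omega>"
    and Ures: "\<And>j z. z \<in> Lip0 \<Omega> \<Longrightarrow> \<bar>B (U j) z - F z\<bar> \<le> \<eta> j * D.N z" by metis
  have compare: "\<kappa> * D.N (\<lambda>x. (-1) * w x + u x) \<le> \<alpha> + \<beta>"
    if u: "u \<in> Lip0 \<Omega>" and w: "w \<in> Lip0 \<Omega>" and pos: "0 \<le> \<alpha>" "0 \<le> \<beta>"
      and ru: "\<And>z. z \<in> Lip0 \<Omega> \<Longrightarrow> \<bar>B u z - F z\<bar> \<le> \<alpha> * D.N z"
      and rw: "\<And>z. z \<in> Lip0 \<Omega> \<Longrightarrow> \<bar>B w z - F z\<bar> \<le> \<beta> * D.N z" for u w \<alpha> \<beta>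
  proof -
    have "\<bar>B (\<lambda>x. (-1) * w x + u x) z\<bar> \<le> (\<alpha> + \<beta>) * D.N z" if z: "z \<in> Lip0 \<Omega>" for z
      using ru[OF z] rw[OF z] unfolding B_diff[OF u w z] distrib_right by linarith
    note bound = this
    show ?thesis
    proof (rule bb[unfolded D.bounded_below_def, rule_format, OF Lip0_combination[OF w u, of "-1"]])
      show "0 \<le> \<alpha> + \<beta>" using pos by simp
      show "\<bar>B (\<lambda>x. (-1) * w x + u x) z\<bar> \<le> (\<alpha> + \<beta>) * D.N z" if "z \<in> Lip0 \<Omega>" for z
        using that by (rule bound)
    qed
  qed
  have UN: "D.N (\<lambda>x. (-1) * U j x + U k x) \<le> r j" if "j \<le> k" for j k
  proof -
    have "\<kappa> * D.N (\<lambda>x. (-1) * U j x + U k x) \<le> \<eta> k + \<eta> j"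
      using \<eta>[THEN less_imp_le] by (intro compare U Ures)
    also have "\<dots> \<le> 2 * \<eta> j" using \<eta>_mono[OF that] by simp
    also have "\<dots> = \<kappa> * r j" by (simp add: \<eta>_def)
    finally show ?thesis using \<kappa> by simp
  qed
  have VU: "V.L2.N (\<lambda>x. U k x - U j x) \<le> (1 / 4) ^ j" if "j \<le> k" for j k
  proof -
    have "V.L2.N (\<lambda>x. (-1) * U j x + U k x) \<le> poincare_const * D.N (\<lambda>x. (-1) * U j x + U k x)"
      by (intro Poincare Lip0_combination U)
    also have "\<dots> \<le> poincare_const * r j" using UN[OF that] poincare_const_nonneg by (rule mult_left_mono)
    also have "\<dots> \<le> (1 / 4) ^ j" by (rule poincare_const_r_le)
    finally show ?thesis by simp
  qed
  have GU: "G.L2.N (\<lambda>x. grad (U k) x - grad (U j) x) \<le> (1 / 4) ^ j" if "j \<le> k" for j k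
    unfolding grad_diff_N[OF U U] using UN[OF that] r_le[of j] by linarith
  obtain u where uE: "u \<in> V.E" and uU: "\<And>j. V.L2.N (\<lambda>x. U j x - u x) \<le> (1 / 4) ^ j"
    using V.complete[OF Lip0_E[OF U] VU V_nondegenerate] by blast
  obtain g where gE: "g \<in> G.E" and gU: "\<And>j. G.L2.N (\<lambda>x. grad (U j) x - g x) \<le> (1 / 4) ^ j"
    using G.complete[OF grad_E[OF U] GU G_nondegenerate] by blast
  have "(u, g) \<in> QH0 Q v \<Omega>"
    unfolding QH0_iff
  proof (intro conjI allI impI uE gE)
    fix \<epsilon> :: real assume "0 < \<epsilon>"
    then obtain j where j: "(1 / 4) ^ j < \<epsilon> / 2" using real_arch_pow_inv[of "\<epsilon> / 2" "1 / 4"] by auto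
    have "V.L2.N (\<lambda>x. U j x - u x) + G.L2.N (\<lambda>x. grad (U j) x - g x) < \<epsilon>"
      using uU[of j] gU[of j] j by linarith
    then show "\<exists>\<phi>\<in>Lip0 \<Omega>. V.L2.N (\<lambda>x. \<phi> x - u x) + G.L2.N (\<lambda>x. grad \<phi> x - g x) < \<epsilon>"
      using U by blast
  qed
  moreover have "oper u g \<phi> = F \<phi>" if \<phi>: "\<phi> \<in> Lip0 \<Omega>" for \<phi>
  proof -
    have "\<bar>oper u g \<phi> - F \<phi>\<bar> \<le> 0"
    proof (rule le_if_geometric_bound)
      fix j :: nat
      have T0: "0 \<le> test_size \<phi>"
        unfolding test_size_def
        using D.N_ge_0[OF \<phi>] V.L2.N_ge_0[OF Lip0_E[OF \<phi>]] V.L2.N_ge_0[OF Lip0_mult_E[OF \<phi> d_E]] by simp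
      have "\<bar>oper (U j) (grad (U j)) \<phi> - oper u g \<phi>\<bar>
          \<le> test_size \<phi> * (V.L2.N (\<lambda>x. U j x - u x) + G.L2.N (\<lambda>x. grad (U j) x - g x))"
        unfolding oper_diff[OF Lip0_E[OF U] uE grad_E[OF U] gE \<phi>]
        by (intro oper_bound V.E_diff G.E_diff Lip0_E grad_E U uE gE \<phi>)
      also have "\<dots> \<le> test_size \<phi> * ((1 / 4) ^ j + (1 / 4) ^ j)"
        using uU gU T0 by (intro mult_left_mono add_mono)
      finally have 1: "\<bar>oper (U j) (grad (U j)) \<phi> - oper u g \<phi>\<bar> \<le> test_size \<phi> * ((1 / 4) ^ j + (1 / 4) ^ j)" .
      have "\<bar>oper (U j) (grad (U j)) \<phi> - F \<phi>\<bar> \<le> \<eta> j * D.N \<phi>"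
        using Ures[OF \<phi>, of j] by (simp add: B_oper)
      also have "\<dots> \<le> \<kappa> * (1 / 4) ^ j * D.N \<phi>" using \<eta>_le D.N_ge_0[OF \<phi>] by (rule mult_right_mono)
      finally have "\<bar>oper u g \<phi> - F \<phi>\<bar> \<le> test_size \<phi> * ((1 / 4) ^ j + (1 / 4) ^ j) + \<kappa> * (1 / 4) ^ j * D.N \<phi>"
        using 1 by linarith
      then show "\<bar>oper u g \<phi> - F \<phi>\<bar> \<le> 0 + (2 * test_size \<phi> + \<kappa> * D.N \<phi>) * (1 / 4) ^ j"
        by (simp add: algebra_simps)
    qed
    then show ?thesis by simp
  qed
  ultimately have sol: "weak_solution \<Omega> v Q b c d f e h u g"
    unfolding weak_solution_iff F_def by blast
  have "AE x in M. u' x = u x \<and> g' x = g x" if sol': "weak_solution \<Omega> v Q b c d f e h u' g'" for u' g'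
  proof -
    have QH: "(u', g') \<in> QH0 Q v \<Omega>" and eq: "\<And>\<phi>. \<phi> \<in> Lip0 \<Omega> \<Longrightarrow> oper u' g' \<phi> = F \<phi>"
      using sol' unfolding weak_solution_iff F_def by blast+
    have u'E: "u' \<in> V.E" and g'E: "g' \<in> G.E" using QH unfolding QH0_iff by blast+
    have "\<exists>\<phi>\<in>Lip0 \<Omega>. V.L2.N (\<lambda>x. \<phi> x - u' x) + G.L2.N (\<lambda>x. grad \<phi> x - g' x) < (1 / 4) ^ j" for j :: nat
      using QH unfolding QH0_iff by simp
    then have "\<forall>j. \<exists>\<phi>. \<phi> \<in> Lip0 \<Omega> \<and> V.L2.N (\<lambda>x. \<phi> x - u' x) + G.L2.N (\<lambda>x. grad \<phi> x - g' x) < (1 / 4) ^ j"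
      by blast
    from choice[OF this] obtain W where W: "\<And>j. W j \<in> Lip0 \<Omega>"
      and Wlt: "\<And>j. V.L2.N (\<lambda>x. W j x - u' x) + G.L2.N (\<lambda>x. grad (W j) x - g' x) < (1 / 4) ^ j" by blast
    have u'W: "V.L2.N (\<lambda>x. W j x - u' x) \<le> (1 / 4) ^ j" for j
      using Wlt[of j] G.L2.N_ge_0[OF G.E_diff[OF grad_E[OF W] g'E], of j] by linarith
    have g'W: "G.L2.N (\<lambda>x. grad (W j) x - g' x) \<le> (1 / 4) ^ j" for j
      using Wlt[of j] V.L2.N_ge_0[OF V.E_diff[OF Lip0_E[OF W] u'E], of j] by linarith
    have K0: "0 \<le> K"
      unfolding K_def lower_order_const_def using poincare_const_nonneg d_moment_nonneg total_weight_nonneg by simp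
    \<comment> \<open>The bound for the residual of \<open>W k\<close> by \<open>test_size z\<close> is not uniform in \<open>z\<close>. Comparing \<open>W j\<close> with \<open>W k\<close> by the boundedness of \<open>B\<close>
      and letting \<open>k\<close> tend to infinity gives one that is.\<close>
    have Wres: "\<bar>B (W j) z - F z\<bar> \<le> (2 * K * (1 / 4) ^ j) * D.N z" if z: "z \<in> Lip0 \<Omega>" for j z
    proof (rule le_if_geometric_bound)
      fix k assume jk: "j \<le> k"
      have "\<bar>B (W k) z - F z\<bar> = \<bar>oper (\<lambda>x. W k x - u' x) (\<lambda>x. grad (W k) x - g' x) z\<bar>"
        unfolding B_oper eq[OF z, symmetric] oper_diff[OF Lip0_E[OF W] u'E grad_E[OF W] g'E z] ..
      also have "\<dots> \<le> test_size z * (V.L2.N (\<lambda>x. W k x - u' x) + G.L2.N (\<lambda>x. grad (W k) x - g' x))"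
        by (intro oper_bound V.E_diff G.E_diff Lip0_E grad_E W u'E g'E z)
      also have "\<dots> \<le> test_size z * (1 / 4) ^ k"
      proof (rule mult_left_mono[OF less_imp_le[OF Wlt]])
        show "0 \<le> test_size z"
          unfolding test_size_def
          using D.N_ge_0[OF z] V.L2.N_ge_0[OF Lip0_E[OF z]] V.L2.N_ge_0[OF Lip0_mult_E[OF z d_E]] by simp
      qed
      finally have 1: "\<bar>B (W k) z - F z\<bar> \<le> test_size z * (1 / 4) ^ k" .
      have "D.N (\<lambda>x. (-1) * W j x + W k x) = G.L2.N (\<lambda>x. grad (W k) x - grad (W j) x)"
        by (rule grad_diff_N[OF W W, symmetric])
      also have "\<dots> \<le> G.L2.N (\<lambda>x. grad (W k) x - g' x) + G.L2.N (\<lambda>x. g' x - grad (W j) x)"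
        by (rule G.N_diff_triangle[OF grad_E[OF W] g'E grad_E[OF W]])
      also have "\<dots> \<le> (1 / 4) ^ k + (1 / 4) ^ j"
        unfolding G.N_diff_commute[of g' "grad (W j)"] using g'W by (intro add_mono)
      also have "\<dots> \<le> 2 * (1 / 4) ^ j" using power_decreasing[OF jk, of "1 / 4 :: real"] by simp
      finally have 2: "D.N (\<lambda>x. (-1) * W j x + W k x) \<le> 2 * (1 / 4) ^ j" .
      have "\<bar>B (W k) z - B (W j) z\<bar> = \<bar>B (\<lambda>x. (-1) * W j x + W k x) z\<bar>"
        by (simp only: B_diff[OF W W z])
      also have "\<dots> \<le> K * D.N (\<lambda>x. (-1) * W j x + W k x) * D.N z"
        using formB Lip0_combination[OF W W] z unfolding D.form_def by blast
      also have "\<dots> \<le> K * (2 * (1 / 4) ^ j) * D.N z"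
        using 2 K0 D.N_ge_0[OF z] by (intro mult_right_mono mult_left_mono)
      finally show "\<bar>B (W j) z - F z\<bar> \<le> (2 * K * (1 / 4) ^ j) * D.N z + test_size z * (1 / 4) ^ k"
        using 1 by (simp add: abs_le_iff algebra_simps)
    qed
    define R where "R = (2 * K + \<kappa>) / \<kappa>"
    have R0: "0 \<le> R" unfolding R_def using K0 \<kappa> by simp
    have WU: "D.N (\<lambda>x. (-1) * U j x + W j x) \<le> R * (1 / 4) ^ j" for j
    proof -
      have "\<kappa> * D.N (\<lambda>x. (-1) * U j x + W j x) \<le> 2 * K * (1 / 4) ^ j + \<eta> j"
        using K0 \<eta>[THEN less_imp_le] by (intro compare U W Ures Wres) auto
      also have "\<dots> \<le> 2 * K * (1 / 4) ^ j + \<kappa> * (1 / 4) ^ j" using \<eta>_le by simp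
      also have "\<dots> = \<kappa> * (R * (1 / 4) ^ j)" using \<kappa> by (simp add: R_def field_simps)
      finally show ?thesis using \<kappa> by simp
    qed
    have "G.L2.N (\<lambda>x. g' x - g x) \<le> 0"
    proof (rule le_if_geometric_bound)
      fix j :: nat
      have "G.L2.N (\<lambda>x. g' x - g x) \<le> G.L2.N (\<lambda>x. g' x - grad (W j) x) + G.L2.N (\<lambda>x. grad (W j) x - g x)"
        by (rule G.N_diff_triangle[OF g'E grad_E[OF W] gE])
      moreover have "G.L2.N (\<lambda>x. grad (W j) x - g x)
          \<le> G.L2.N (\<lambda>x. grad (W j) x - grad (U j) x) + G.L2.N (\<lambda>x. grad (U j) x - g x)"
        by (rule G.N_diff_triangle[OF grad_E[OF W] grad_E[OF U] gE])
      moreover have "G.L2.N (\<lambda>x. grad (W j) x - grad (U j) x) \<le> R * (1 / 4) ^ j"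
        unfolding grad_diff_N[OF W U] by (rule WU)
      moreover have "G.L2.N (\<lambda>x. g' x - grad (W j) x) \<le> (1 / 4) ^ j"
        unfolding G.N_diff_commute[of g'] by (rule g'W)
      ultimately show "G.L2.N (\<lambda>x. g' x - g x) \<le> 0 + (R + 2) * (1 / 4) ^ j"
        using gU[of j] unfolding distrib_right by linarith
    qed
    then have G0: "G.L2.N (\<lambda>x. g' x - g x) = 0" using G.L2.N_ge_0[OF G.E_diff[OF g'E gE]] by simp
    have "V.L2.N (\<lambda>x. u' x - u x) \<le> 0"
    proof (rule le_if_geometric_bound)
      fix j :: nat
      have "V.L2.N (\<lambda>x. u' x - u x) \<le> V.L2.N (\<lambda>x. u' x - W j x) + V.L2.N (\<lambda>x. W j x - u x)"
        by (rule V.N_diff_triangle[OF u'E Lip0_E[OF W] uE])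
      moreover have "V.L2.N (\<lambda>x. W j x - u x) \<le> V.L2.N (\<lambda>x. W j x - U j x) + V.L2.N (\<lambda>x. U j x - u x)"
        by (rule V.N_diff_triangle[OF Lip0_E[OF W] Lip0_E[OF U] uE])
      moreover have "V.L2.N (\<lambda>x. W j x - U j x) \<le> poincare_const * (R * (1 / 4) ^ j)"
      proof -
        have "V.L2.N (\<lambda>x. (-1) * U j x + W j x) \<le> poincare_const * D.N (\<lambda>x. (-1) * U j x + W j x)"
          by (intro Poincare Lip0_combination U W)
        also have "\<dots> \<le> poincare_const * (R * (1 / 4) ^ j)" using WU poincare_const_nonneg by (rule mult_left_mono)
        finally show ?thesis by simp
      qed
      moreover have "V.L2.N (\<lambda>x. u' x - W j x) \<le> (1 / 4) ^ j"
        unfolding V.N_diff_commute[of u'] by (rule u'W)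
      ultimately show "V.L2.N (\<lambda>x. u' x - u x) \<le> 0 + (poincare_const * R + 2) * (1 / 4) ^ j"
        using uU[of j] unfolding distrib_right mult.assoc by linarith
    qed
    then have V0: "V.L2.N (\<lambda>x. u' x - u x) = 0" using V.L2.N_ge_0[OF V.E_diff[OF u'E uE]] by simp
    show ?thesis
      using V.N_eq_0_imp_AE[OF V.E_diff[OF u'E uE] V0 V_nondegenerate]
        G.N_eq_0_imp_AE[OF G.E_diff[OF g'E gE] G0 G_nondegenerate]
      by eventually_elim simp
  qed
  with sol show ?thesis by blast
qed

end

theorem theorem1p5:
  fixes \<Omega> :: "(real ^ 'n) set"
    and v d f h :: "real ^ 'n \<Rightarrow> real"
    and Q :: "real ^ 'n \<Rightarrow> real ^ 'n ^ 'n"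
    and b c e :: "real ^ 'n \<Rightarrow> real ^ 'n"
    and \<sigma> q :: real
  assumes "open \<Omega>" and "bounded \<Omega>" and "connected \<Omega>"
    and "weight \<Omega> v" and "integrable (lebesgue_on \<Omega>) v"
    and "matrix_function \<Omega> Q"
    and "\<exists>k>0. AE x in lebesgue_on \<Omega>. op_norm (Q x) \<le> k * v x"
    and "\<sigma> > 1" and "sobolev_inequality Q v \<Omega> \<sigma>"
    and "local_poincare Q v \<Omega>"
    and "f \<in> wLp 2 v \<Omega>" and "h \<in> wLp 2 v \<Omega>"
    and "d \<in> wLp 2 v \<Omega>"
    and "q > 2 * (\<sigma> / (\<sigma> - 1))" and "d \<in> wLp (q / 2) v \<Omega>"
    and "b \<in> borel_measurable (lebesgue_on \<Omega>)" and "degenerate_subunit \<Omega> v Q b"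
    and "c \<in> borel_measurable (lebesgue_on \<Omega>)" and "degenerate_subunit \<Omega> v Q c"
    and "e \<in> borel_measurable (lebesgue_on \<Omega>)" and "degenerate_subunit \<Omega> v Q e"
    and "\<And>\<phi>. \<phi> \<in> QLip0 Q v \<Omega> \<Longrightarrow> (\<And>x. 0 \<le> \<phi> x) \<Longrightarrow>
           (LINT x|lebesgue_on \<Omega>. (d x * \<phi> x - c x \<bullet> grad \<phi> x) * v x) \<le> 0"
  shows "\<exists>u g. weak_solution \<Omega> v Q b c d f e h u g \<and>
           (\<forall>u' g'. weak_solution \<Omega> v Q b c d f e h u' g' \<longrightarrow>
              (AE x in lebesgue_on \<Omega>. u' x = u x \<and> g' x = g x))"
proof -
  obtain k where k: "AE x in lebesgue_on \<Omega>. op_norm (Q x) \<le> k * v x" using assms(7) by auto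
  obtain C where C: "C > 0" "\<And>\<phi>. \<phi> \<in> Lip0 \<Omega> \<Longrightarrow> wLp_norm (2 * \<sigma>) v \<Omega> \<phi> \<le> C * QL2_norm Q \<Omega> (grad \<phi>)"
    using assms(9) unfolding sobolev_inequality_def by auto
  interpret degenerate_problem \<Omega> v d Q b c \<sigma> q C k
  proof (rule degenerate_problem.intro)
    show "(LINT x|lebesgue_on \<Omega>. (d x * \<phi> x - c x \<bullet> grad \<phi> x) * v x) \<le> 0"
      if "\<phi> \<in> QLip0 Q v \<Omega>" "\<And>x. 0 \<le> \<phi> x" for \<phi>
      using that by (rule assms(22))
  qed (fact assms k C)+
  show ?thesis using assms(11,12,20,21) by (rule Dirichlet_problem_well_posed)
qed

end
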